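(* Let $\mathcal V\to\Delta^*$ be a variation of graded-polarized mixed Hodge structure over the punctured unit disk such that the graded variation is constant, i.e. each of the variations of pure polarized Hodge structure induced by $\mathcal V$ on $Gr^{\mathcal W}_k$ is constant. Then $\mathcal V$ is admissible if and only if the $C^\infty$-grading $\mathcal Y$ of $\mathcal W$, defined on each fiber as the grading $Y_{(F,W)}$ of the mixed Hodge structure on that fiber, extends continuously, as a grading of the weight filtration, to the canonical extension $\tilde{\mathcal V}\to\Delta$.
   Context: Gradings. A grading of an increasing filtration $W$ of a finite-dimensional complex vector space $V$ is identified with the semisimple endomorphism $Y$ of $V$ with integer eigenvalues such that $W_k=\bigoplus_{j\le k}E_j(Y)$, where $E_j(Y)$ is the $j$-eigenspace. $GL(V)$ acts on gradings by $g.Y=gYg^{-1}$. A mixed Hodge structure $(F,W)$ on $V=V_{\mathbb R}\otimes\mathbb C$ determines a unique bigrading $V=\bigoplus_{p,q}I^{p,q}$ with $F^p=\bigoplus_{a\ge p,b}I^{a,b}$, $W_k=\bigoplus_{a+b\le k}I^{a,b}$ and $\overline{I^{p,q}}\equiv I^{q,p} \mod \bigoplus_{r<q,s<p}I^{r,s}$; the grading $Y_{(F,W)}$ of $W$ is multiplication by $k$ on $\bigoplus_{p+q=k}I^{p,q}$. Variations. A variation of graded-polarized mixed Hodge structure over a complex manifold $S$ is a $\mathbb Q$-local system $\mathcal V_{\mathbb Q}\to S$ of finite rank with: a rational flat increasing weight filtration $\mathcal W$ of $\mathcal V_{\mathbb C}$; a decreasing filtration $\mathcal F$ of $\mathcal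 V_{\mathbb C}\otimes\mathcal O_S$ by holomorphic subbundles, horizontal ($\nabla\mathcal F^p\subseteq\Omega^1_S\otimes\mathcal F^{p-1}$ for the flat connection $\nabla$), such that $(\mathcal F,\mathcal W)$ is a mixed Hodge structure on each fiber; and flat rational nondegenerate bilinear forms $\mathcal S_k$ on $Gr^{\mathcal W}_k$ of parity $(-1)^k$ polarizing the pure Hodge structures of weight $k$ induced by $\mathcal F$ on $Gr^{\mathcal W}_k$. Period map. Let $S=\Delta^*$ have coordinate $s=e^{2\pi iz}$, with $z$ in the upper half-plane $U$, and suppose the monodromy is unipotent (automatic if the graded variation is constant). Fix a reference fiber $V=V_{\mathbb R}\otimes\mathbb C$ with its weight filtration $W$ and forms $\mathcal S_k$ on $Gr^W_k$, and write the monodromy as $T=e^{-N}$ with $N$ nilpotent. Parallel translation turns $\mathcal F$ into a holomorphic map $F:U\to\mathcal M$, $z\mapsto F(z)$, with $F(z+1)=e^N.F(z)$. Here $\mathcal M$ is the set of filtrations $F$ of $V$ such that $(F,W)$ is a mixed Hodge structure graded-polarized by $\mathcal S$ with the given graded Hodge numbers $h^{p,q}$, and $\check{\mathcal M}\supseteq\mathcal M$ is the set of decreasing filtrations $F$ of $V$ with $\dim F^pGr^W_k=\sum_{r\ge p}h^{r,k-r}$ for all $p,k$ that satisfy Riemann's first bilinear relation on each $Gr^W_k$ with respect to $\mathcal S_k$. The function $\psi(z)=e^{-zN}.F(z)$ is $1$-periodic and so descends to $\psi(s)$ on $\Delta^*$. Canonical extension. $\tilde{\mathcal V}\to\Delta$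 is Deligne's canonical extension, trivialized by the sections $\tilde\sigma=\exp(\frac{1}{2\pi i}\log s\, N)\sigma$ with $\sigma$ a flat multivalued section of $\mathcal V$. In this trivialization $\mathcal Y$ becomes the function $Y(s)=e^{-zN}.Y_{(F(z),W)}$ on $\Delta^*$, and continuous extension of $\mathcal Y$ to $\tilde{\mathcal V}$ as a grading of the weight filtration means that $\lim_{s\to0}Y(s)$ exists in $\mathrm{End}(V)$ and is a grading of $W$. Admissibility. For a nilpotent endomorphism $N$ of a vector space $H$, $W(N)$ is the monodromy weight filtration, i.e. the unique increasing filtration with $N W_\ell(N)\subseteq W_{\ell-2}(N)$ and $N^\ell:Gr^{W(N)}_\ell\to Gr^{W(N)}_{-\ell}$ an isomorphism for $\ell\geq 0$. The shift is $W[\ell]_j=W_{j+\ell}$. The relative weight filtration ${}^rW={}^rW(N,W)$ is the (unique if it exists) increasing filtration of $V$ with $N\,{}^rW_k\subseteq{}^rW_{k-2}$ inducing on each $Gr^W_k$ the filtration $W(N:Gr^W_k\to Gr^W_k)[-k]$. $\mathcal V$ is admissible if (1) the limiting Hodge filtration $F_\infty=\lim_{s\to0}\psi(s)$ exists as an element of $\check{\mathcal M}$, and (2) ${}^rW(N,W)$ exists. *)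

theory Defs
  imports "HOL-Complex_Analysis.Complex_Analysis" "HOL-Library.Set_Algebras"
begin

section \<open>Linear algebra on \<open>\<complex>\<^sup>n\<close> with its standard rational structure\<close>

text \<open>
  Vector spaces with a rational structure are modelled, after the choice of a rational basis,
  by \<open>complex ^ 'n\<close> with lattice of rational vectors \<open>rat_vecs\<close>. Endomorphisms are matrices, and
  subspaces are complex subspaces (\<open>vec.subspace\<close>).
\<close>

definition rat_vecs :: "(complex ^ 'n) set" where
  "rat_vecs = {v. \<forall>i. v $ i \<in> \<rat>}"

definition cnjv :: "complex ^ 'n \<Rightarrow> complex ^ 'n" where
  "cnjv v = (\<chi> i. cnj (v $ i))"

definition coord_subspace :: "'n set \<Rightarrow> (complex ^ 'n) set" where
  "coord_subspace J = {v. \<forall>i. i \<notin> J \<longrightarrow> v $ i = 0}"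

text \<open>The operation \<open>A * B\<close> on \<open>complex ^ 'n ^ 'n\<close> is componentwise, hence powers and the
  exponential have to be built from \<open>**\<close>. Multiplication by a scalar \<open>c\<close> is \<open>mat c ** A\<close>.\<close>

definition matpow :: "complex ^ 'n ^ 'n \<Rightarrow> nat \<Rightarrow> complex ^ 'n ^ 'n" where
  "matpow A k = (((**) A) ^^ k) (mat 1)"

definition mexp :: "complex ^ 'n ^ 'n \<Rightarrow> complex ^ 'n ^ 'n" where
  "mexp A = (\<Sum>k. (1 / fact k) *\<^sub>R matpow A k)"

text \<open>For unipotent \<open>T\<close> this is the unique nilpotent \<open>N\<close> with \<open>T = mexp (- N)\<close>; the logarithm
  series can be cut off at the dimension since \<open>T - 1\<close> is nilpotent.\<close>

definition neg_log_unipotent :: "complex ^ 'n ^ 'n \<Rightarrow> complex ^ 'n ^ 'n" where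
  "neg_log_unipotent T =
     (\<Sum>k = 1..CARD('n). ((- 1) ^ k / real k) *\<^sub>R matpow (T - mat 1) k)"

section \<open>Filtrations and mixed Hodge structures\<close>

type_synonym 'n filtration = "int \<Rightarrow> (complex ^ 'n) set"

definition increasing_filtration :: "'n::finite filtration \<Rightarrow> bool" where
  "increasing_filtration W \<longleftrightarrow>
     (\<forall>k. vec.subspace (W k)) \<and> mono W \<and> (\<exists>a. W a = {0}) \<and> (\<exists>b. W b = UNIV)"

definition decreasing_filtration :: "'n::finite filtration \<Rightarrow> bool" where
  "decreasing_filtration F \<longleftrightarrow>
     (\<forall>p. vec.subspace (F p)) \<and> antimono F \<and> (\<exists>a. F a = UNIV) \<and> (\<exists>b. F b = {0})"

text \<open>
  Subspaces of a subquotient \<open>A / B\<close> are represented by their preimages, i.e. by the subspaces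
  between \<open>B\<close> and \<open>A\<close>. In particular \<open>gr_ind F W k p\<close> stands for \<open>F\<^sup>p Gr\<^sup>W\<^sub>k\<close> and
  \<open>hodge_comp F W p q\<close> for the Hodge component \<open>H\<^sup>p\<^sup>,\<^sup>q\<close> of \<open>Gr\<^sup>W\<^sub>k\<close>, \<open>k = p + q\<close>.
\<close>

definition gr_ind :: "'n::finite filtration \<Rightarrow> 'n filtration \<Rightarrow> int \<Rightarrow> int \<Rightarrow> (complex ^ 'n) set" where
  "gr_ind F W k p = (F p \<inter> W k) + W (k - 1)"

definition hodge_comp :: "'n::finite filtration \<Rightarrow> 'n filtration \<Rightarrow> int \<Rightarrow> int \<Rightarrow> (complex ^ 'n) set" where
  "hodge_comp F W p q = gr_ind F W (p + q) p \<inter> cnjv ` gr_ind F W (p + q) q"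

definition hodge_number :: "'n::finite filtration \<Rightarrow> 'n filtration \<Rightarrow> int \<Rightarrow> int \<Rightarrow> nat" where
  "hodge_number F W p q = vec.dim (hodge_comp F W p q) - vec.dim (W (p + q - 1))"

text \<open>The last two equations say \<open>Gr\<^sup>W\<^sub>k = F\<^sup>p \<oplus> cnj (F\<^sup>k\<^sup>-\<^sup>p\<^sup>+\<^sup>1)\<close>, i.e. that \<open>F\<close> induces a pure Hodge
  structure of weight \<open>k\<close> on \<open>Gr\<^sup>W\<^sub>k\<close>.\<close>

definition mixed_hodge_structure :: "'n::finite filtration \<Rightarrow> 'n filtration \<Rightarrow> bool" where
  "mixed_hodge_structure F W \<longleftrightarrow>
     increasing_filtration W \<and> (\<forall>k. cnjv ` W k = W k) \<and> decreasing_filtration F \<and>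
     (\<forall>k p. gr_ind F W k p + cnjv ` gr_ind F W k (k - p + 1) = W k \<and>
            gr_ind F W k p \<inter> cnjv ` gr_ind F W k (k - p + 1) = W (k - 1))"

text \<open>\<open>S\<close> is a form on \<open>W k\<close>; having radical \<open>W (k - 1)\<close> it descends to a nondegenerate form on
  \<open>Gr\<^sup>W\<^sub>k\<close>. Its values outside \<open>W k\<close> are irrelevant.\<close>

definition gr_form :: "'n::finite filtration \<Rightarrow> int \<Rightarrow> (complex ^ 'n \<Rightarrow> complex ^ 'n \<Rightarrow> complex) \<Rightarrow> bool" where
  "gr_form W k S \<longleftrightarrow>
     (\<forall>u\<in>W k. \<forall>u'\<in>W k. \<forall>v\<in>W k. \<forall>c.
        S (u + u') v = S u v + S u' v \<and> S (c *s u) v = c * S u v \<and>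
        S v (u + u') = S v u + S v u' \<and> S v (c *s u) = c * S v u) \<and>
     (\<forall>u\<in>W k. \<forall>v\<in>W k. S v u = (- 1) powi k * S u v) \<and>
     {u \<in> W k. \<forall>v\<in>W k. S u v = 0} = W (k - 1) \<and>
     (\<forall>u\<in>W k \<inter> rat_vecs. \<forall>v\<in>W k \<inter> rat_vecs. S u v \<in> \<rat>)"

definition riemann_first :: "'n::finite filtration \<Rightarrow> 'n filtration \<Rightarrow> int \<Rightarrow>
    (complex ^ 'n \<Rightarrow> complex ^ 'n \<Rightarrow> complex) \<Rightarrow> bool" where
  "riemann_first F W k S \<longleftrightarrow>
     (\<forall>p. \<forall>u\<in>gr_ind F W k p. \<forall>v\<in>gr_ind F W k (k - p + 1). S u v = 0)"

definition riemann_second :: "'n::finite filtration \<Rightarrow> 'n filtration \<Rightarrow> int \<Rightarrow>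
    (complex ^ 'n \<Rightarrow> complex ^ 'n \<Rightarrow> complex) \<Rightarrow> bool" where
  "riemann_second F W k S \<longleftrightarrow>
     (\<forall>p q. p + q = k \<longrightarrow> (\<forall>v \<in> hodge_comp F W p q - W (k - 1).
        \<i> powi (p - q) * S v (cnjv v) \<in> \<real> \<and> 0 < Re (\<i> powi (p - q) * S v (cnjv v))))"

section \<open>Gradings and the grading of a mixed Hodge structure\<close>

definition int_eigenspace :: "complex ^ 'n ^ 'n \<Rightarrow> int \<Rightarrow> (complex ^ 'n) set" where
  "int_eigenspace Y j = {v. Y *v v = of_int j *s v}"

text \<open>The first conjunct says that \<open>Y\<close> is semisimple with integer eigenvalues; sums of
  eigenspaces for distinct eigenvalues are automatically direct.\<close>

definition grading_of :: "complex ^ 'n ^ 'n \<Rightarrow> 'n::finite filtration \<Rightarrow> bool" where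
  "grading_of Y W \<longleftrightarrow>
     vec.span (\<Union>j. int_eigenspace Y j) = UNIV \<and>
     (\<forall>k. W k = vec.span (\<Union>j\<in>{..k}. int_eigenspace Y j))"

definition bigrading :: "(int \<Rightarrow> int \<Rightarrow> (complex ^ 'n::finite) set) \<Rightarrow> bool" where
  "bigrading I \<longleftrightarrow>
     (\<forall>p q. vec.subspace (I p q)) \<and> finite {(p, q). I p q \<noteq> {0}} \<and>
     (\<forall>v. \<exists>!c. (\<forall>p q. c (p, q) \<in> I p q) \<and> v = (\<Sum>x \<in> {(p, q). I p q \<noteq> {0}}. c x))"

definition deligne_bigrading :: "'n::finite filtration \<Rightarrow> 'n filtration \<Rightarrow>
    (int \<Rightarrow> int \<Rightarrow> (complex ^ 'n) set) \<Rightarrow> bool" where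
  "deligne_bigrading F W I \<longleftrightarrow>
     bigrading I \<and>
     (\<forall>p. F p = vec.span (\<Union>{I a b | a b. p \<le> a})) \<and>
     (\<forall>k. W k = vec.span (\<Union>{I a b | a b. a + b \<le> k})) \<and>
     (\<forall>p q. cnjv ` I p q + vec.span (\<Union>{I r s | r s. r < q \<and> s < p}) =
            I q p + vec.span (\<Union>{I r s | r s. r < q \<and> s < p}))"

definition mhs_grading :: "'n::finite filtration \<Rightarrow> 'n filtration \<Rightarrow> complex ^ 'n ^ 'n" where
  "mhs_grading F W = (THE Y. \<exists>I. deligne_bigrading F W I \<and>
     (\<forall>p q. \<forall>v\<in>I p q. Y *v v = of_int (p + q) *s v))"

section \<open>Local systems and variations of graded-polarized mixed Hodge structure\<close>

text \<open>
  A local system on \<open>S\<close> is a representation of the fundamental groupoid: after the choice of a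
  rational basis in every fibre, all fibres are \<open>complex ^ 'n\<close> and parallel translation along a
  path \<open>\<gamma>\<close> in \<open>S\<close> is a matrix \<open>P \<gamma>\<close> from the fibre at \<open>pathstart \<gamma>\<close> to the fibre at
  \<open>pathfinish \<gamma>\<close>. No continuity in the base point is implied by this identification of fibres:
  it is \<open>P\<close> alone that carries the topology of the local system.
\<close>

type_synonym 'n transport = "(real \<Rightarrow> complex) \<Rightarrow> complex ^ 'n ^ 'n"

definition rational_local_system :: "complex set \<Rightarrow> 'n::finite transport \<Rightarrow> bool" where
  "rational_local_system S P \<longleftrightarrow>
     (\<forall>\<gamma>. path \<gamma> \<and> path_image \<gamma> \<subseteq> S \<longrightarrow> invertible (P \<gamma>) \<and> (\<forall>i j. P \<gamma> $ i $ j \<in> \<rat>)) \<and>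
     (\<forall>\<gamma> \<gamma>'. homotopic_paths S \<gamma> \<gamma>' \<longrightarrow> P \<gamma> = P \<gamma>') \<and>
     (\<forall>\<gamma> \<gamma>'. path \<gamma> \<and> path_image \<gamma> \<subseteq> S \<and> path \<gamma>' \<and> path_image \<gamma>' \<subseteq> S \<and>
        pathfinish \<gamma> = pathstart \<gamma>' \<longrightarrow> P (\<gamma> +++ \<gamma>') = P \<gamma>' ** P \<gamma>)"

text \<open>A family of subspaces \<open>E t\<close> of the fibres, read in the flat coordinates around \<open>s\<close>, i.e.
  transported radially into the fibre at \<open>s\<close>.\<close>

definition flat_coords :: "'n::finite transport \<Rightarrow> complex \<Rightarrow> (complex \<Rightarrow> (complex ^ 'n) set) \<Rightarrow>
    complex \<Rightarrow> (complex ^ 'n) set" where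
  "flat_coords P s E t = (*v) (P (linepath t s)) ` E t"

definition holomorphic_subbundle :: "complex set \<Rightarrow> 'n::finite transport \<Rightarrow>
    (complex \<Rightarrow> (complex ^ 'n) set) \<Rightarrow> bool" where
  "holomorphic_subbundle S P E \<longleftrightarrow>
     (\<forall>s\<in>S. \<exists>r>0. ball s r \<subseteq> S \<and> (\<exists>(B :: complex \<Rightarrow> complex ^ 'n ^ 'n) J.
        (\<forall>i j. (\<lambda>t. B t $ i $ j) holomorphic_on ball s r) \<and>
        (\<forall>t\<in>ball s r. invertible (B t) \<and> flat_coords P s E t = (*v) (B t) ` coord_subspace J)))"

text \<open>In flat coordinates the connection is differentiation of the components.\<close>

definition horizontal :: "complex set \<Rightarrow> 'n::finite transport \<Rightarrow> (complex \<Rightarrow> 'n filtration) \<Rightarrow> bool" where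
  "horizontal S P F \<longleftrightarrow>
     (\<forall>p. \<forall>s\<in>S. \<forall>r>0. ball s r \<subseteq> S \<longrightarrow> (\<forall>f.
        (\<forall>i. (\<lambda>t. f t $ i) holomorphic_on ball s r) \<and>
        (\<forall>t\<in>ball s r. f t \<in> flat_coords P s (\<lambda>u. F u p) t) \<longrightarrow>
        (\<forall>t\<in>ball s r. (\<chi> i. deriv (\<lambda>u. f u $ i) t) \<in> flat_coords P s (\<lambda>u. F u (p - 1)) t)))"

type_synonym 'n forms = "int \<Rightarrow> complex ^ 'n \<Rightarrow> complex ^ 'n \<Rightarrow> complex"

definition gp_vmhs :: "complex set \<Rightarrow> 'n::finite transport \<Rightarrow> (complex \<Rightarrow> 'n filtration) \<Rightarrow>
    (complex \<Rightarrow> 'n filtration) \<Rightarrow> (complex \<Rightarrow> 'n forms) \<Rightarrow> bool" where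
  "gp_vmhs S P W F Q \<longleftrightarrow>
     open S \<and> rational_local_system S P \<and>
     (\<forall>s\<in>S. \<forall>k. W s k = vec.span (W s k \<inter> rat_vecs)) \<and>
     (\<forall>\<gamma>. path \<gamma> \<and> path_image \<gamma> \<subseteq> S \<longrightarrow>
        (\<forall>k. (*v) (P \<gamma>) ` W (pathstart \<gamma>) k = W (pathfinish \<gamma>) k)) \<and>
     (\<forall>p. holomorphic_subbundle S P (\<lambda>s. F s p)) \<and> horizontal S P F \<and>
     (\<forall>s\<in>S. mixed_hodge_structure (F s) (W s)) \<and>
     (\<forall>s\<in>S. \<forall>k. gr_form (W s) k (Q s k) \<and>
        riemann_first (F s) (W s) k (Q s k) \<and> riemann_second (F s) (W s) k (Q s k)) \<and>
     (\<forall>\<gamma>. path \<gamma> \<and> path_image \<gamma> \<subseteq> S \<longrightarrow>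
        (\<forall>k. \<forall>u\<in>W (pathstart \<gamma>) k. \<forall>v\<in>W (pathstart \<gamma>) k.
           Q (pathfinish \<gamma>) k (P \<gamma> *v u) (P \<gamma> *v v) = Q (pathstart \<gamma>) k u v))"

text \<open>Constancy of the variation on each \<open>Gr\<^sup>W\<^sub>k\<close>: its local system is constant (trivial
  holonomy) and its Hodge filtration is flat.\<close>

definition constant_graded :: "complex set \<Rightarrow> 'n::finite transport \<Rightarrow> (complex \<Rightarrow> 'n filtration) \<Rightarrow>
    (complex \<Rightarrow> 'n filtration) \<Rightarrow> bool" where
  "constant_graded S P W F \<longleftrightarrow>
     (\<forall>k \<gamma>. path \<gamma> \<and> path_image \<gamma> \<subseteq> S \<longrightarrow>
        (pathstart \<gamma> = pathfinish \<gamma> \<longrightarrow>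
           (\<forall>v\<in>W (pathstart \<gamma>) k. P \<gamma> *v v - v \<in> W (pathstart \<gamma>) (k - 1))) \<and>
        (\<forall>p. (*v) (P \<gamma>) ` gr_ind (F (pathstart \<gamma>)) (W (pathstart \<gamma>)) k p =
             gr_ind (F (pathfinish \<gamma>)) (W (pathfinish \<gamma>)) k p))"

section \<open>The punctured disk: period map, canonical extension, admissibility\<close>

definition punctured_disk :: "complex set" where
  "punctured_disk = ball 0 1 - {0}"

definition cover :: "complex \<Rightarrow> complex" where
  "cover z = exp (2 * of_real pi * \<i> * z)"

text \<open>The reference fibre is the fibre at \<open>cover z0\<close>, for a point \<open>z0\<close> of the upper half-plane;
  \<open>translate P z0 z\<close> maps it to the fibre at \<open>cover z\<close>.\<close>

definition translate :: "'n::finite transport \<Rightarrow> complex \<Rightarrow> complex \<Rightarrow> complex ^ 'n ^ 'n" where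
  "translate P z0 z = P (cover \<circ> linepath z0 z)"

definition monodromy :: "'n::finite transport \<Rightarrow> complex \<Rightarrow> complex ^ 'n ^ 'n" where
  "monodromy P z0 = translate P z0 (z0 + 1)"

definition mono_log :: "'n::finite transport \<Rightarrow> complex \<Rightarrow> complex ^ 'n ^ 'n" where
  "mono_log P z0 = neg_log_unipotent (monodromy P z0)"

definition period_map :: "'n::finite transport \<Rightarrow> (complex \<Rightarrow> 'n filtration) \<Rightarrow> complex \<Rightarrow>
    complex \<Rightarrow> 'n filtration" where
  "period_map P F z0 z p = {v. translate P z0 z *v v \<in> F (cover z) p}"

text \<open>A preimage of \<open>s\<close> under \<open>cover\<close>. For unipotent monodromy, the functions of \<open>s\<close> defined with
  it below do not depend on the choice of the preimage (1-periodicity).\<close>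

definition lift :: "complex \<Rightarrow> complex" where
  "lift s = Ln s / (2 * of_real pi * \<i>)"

definition untwisted_period :: "'n::finite transport \<Rightarrow> (complex \<Rightarrow> 'n filtration) \<Rightarrow> complex \<Rightarrow>
    complex \<Rightarrow> 'n filtration" where
  "untwisted_period P F z0 s p =
     (*v) (mexp (mat (- lift s) ** mono_log P z0)) ` period_map P F z0 (lift s) p"

text \<open>The isomorphism from the reference fibre to the fibre at \<open>s\<close> which sends \<open>v\<close> to the value at
  \<open>s\<close> of the section \<open>exp (log s / (2 \<pi> i) N) \<sigma>\<close>, where \<open>\<sigma>\<close> is the multivalued flat section
  with value \<open>v\<close>. These sections trivialize the canonical extension, whose fibre at \<open>0\<close> is thereby
  identified with the reference fibre.\<close>

definition canonical_frame :: "'n::finite transport \<Rightarrow> complex \<Rightarrow> complex \<Rightarrow> complex ^ 'n ^ 'n" where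
  "canonical_frame P z0 s = translate P z0 (lift s) ** mexp (mat (lift s) ** mono_log P z0)"

definition grading_extends :: "'n::finite transport \<Rightarrow> (complex \<Rightarrow> 'n filtration) \<Rightarrow>
    (complex \<Rightarrow> 'n filtration) \<Rightarrow> complex \<Rightarrow> bool" where
  "grading_extends P W F z0 \<longleftrightarrow>
     (\<exists>Y0. ((\<lambda>s. matrix_inv (canonical_frame P z0 s) ** mhs_grading (F s) (W s) **
                 canonical_frame P z0 s) \<longlongrightarrow> Y0) (at 0) \<and>
           grading_of Y0 (W (cover z0)))"

text \<open>Membership in the set of filtrations with prescribed graded Hodge numbers \<open>h\<close> satisfying
  the first bilinear relation. The sum is over the finite support of \<open>h\<close>.\<close>

definition compact_dual :: "'n::finite filtration \<Rightarrow> 'n forms \<Rightarrow> (int \<Rightarrow> int \<Rightarrow> nat) \<Rightarrow>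
    'n filtration set" where
  "compact_dual W Q h = {F. decreasing_filtration F \<and>
     (\<forall>p k. vec.dim (gr_ind F W k p) - vec.dim (W (k - 1)) =
            (\<Sum>r \<in> {r. p \<le> r \<and> h r (k - r) \<noteq> 0}. h r (k - r))) \<and>
     (\<forall>k. riemann_first F W k (Q k))}"

text \<open>Convergence in the Grassmannian, topologized as a quotient of the space of frames.\<close>

definition subspace_tendsto :: "('a \<Rightarrow> (complex ^ 'n::finite) set) \<Rightarrow> (complex ^ 'n) set \<Rightarrow>
    'a filter \<Rightarrow> bool" where
  "subspace_tendsto E E0 A \<longleftrightarrow>
     (\<exists>(B :: 'a \<Rightarrow> complex ^ 'n ^ 'n) B0 J. (B \<longlongrightarrow> B0) A \<and> invertible B0 \<and> E0 = (*v) B0 ` coord_subspace J \<and>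
        (\<forall>\<^sub>F s in A. E s = (*v) (B s) ` coord_subspace J))"

text \<open>\<open>L\<close> is the monodromy weight filtration of the endomorphism of \<open>A / B\<close> induced by \<open>N\<close>.
  The last two conditions say that \<open>N\<^sup>l\<close> is injective resp. surjective from \<open>Gr\<^sub>l\<close> to
  \<open>Gr\<^sub>-\<^sub>l\<close>.\<close>

definition monodromy_weight_filtration :: "complex ^ 'n::finite ^ 'n \<Rightarrow> (complex ^ 'n) set \<Rightarrow>
    (complex ^ 'n) set \<Rightarrow> 'n filtration \<Rightarrow> bool" where
  "monodromy_weight_filtration N A B L \<longleftrightarrow>
     (\<forall>l. vec.subspace (L l)) \<and> mono L \<and> (\<exists>a. L a = B) \<and> (\<exists>b. L b = A) \<and>
     (\<forall>l. B \<subseteq> L l \<and> L l \<subseteq> A) \<and>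
     (\<forall>l. (*v) N ` L l \<subseteq> L (l - 2)) \<and>
     (\<forall>l::nat. (\<forall>v \<in> L (int l). matpow N l *v v \<in> L (- int l - 1) \<longrightarrow> v \<in> L (int l - 1)) \<and>
               (\<forall>w \<in> L (- int l). \<exists>v \<in> L (int l). w - matpow N l *v v \<in> L (- int l - 1)))"

text \<open>\<open>M\<close> induces \<open>W(N)[-k]\<close> on \<open>Gr\<^sup>W\<^sub>k\<close>, i.e. \<open>M\<^sub>j Gr\<^sup>W\<^sub>k = W(N)\<^sub>j\<^sub>-\<^sub>k\<close>.\<close>

definition relative_weight_filtration :: "complex ^ 'n::finite ^ 'n \<Rightarrow> 'n filtration \<Rightarrow>
    'n filtration \<Rightarrow> bool" where
  "relative_weight_filtration N W M \<longleftrightarrow>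
     increasing_filtration M \<and> (\<forall>k. (*v) N ` M k \<subseteq> M (k - 2)) \<and>
     (\<forall>k. monodromy_weight_filtration N (W k) (W (k - 1)) (\<lambda>l. gr_ind M W k (l + k)))"

definition admissible :: "'n::finite transport \<Rightarrow> (complex \<Rightarrow> 'n filtration) \<Rightarrow>
    (complex \<Rightarrow> 'n filtration) \<Rightarrow> (complex \<Rightarrow> 'n forms) \<Rightarrow> complex \<Rightarrow> bool" where
  "admissible P W F Q z0 \<longleftrightarrow>
     (\<exists>Finf \<in> compact_dual (W (cover z0)) (Q (cover z0)) (hodge_number (F (cover z0)) (W (cover z0))).
        \<forall>p. subspace_tendsto (\<lambda>s. untwisted_period P F z0 s p) (Finf p) (at 0)) \<and>
     (\<exists>M. relative_weight_filtration (mono_log P z0) (W (cover z0)) M)"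

end

theory Submission
  imports Defs
begin

text \<open>
  Put \<open>z = lift s\<close> and \<open>y = Im z\<close>, let \<open>N\<close> be the logarithm of the monodromy, and let \<open>psi s\<close> be the
  untwisted period map. Nothing moves on the graded pieces: \<open>N\<close> lowers weights, and all the
  filtrations \<open>psi s\<close> induce the same Hodge filtration on \<open>Gr\<^sup>W\<close>. Orthogonal complements split \<open>W\<close>
  over the reals, and the Hodge decomposition of the graded pieces then gives projections \<open>pr (p, q)\<close>
  of the reference fibre with \<open>pr (q, p)\<close> conjugate to \<open>pr (p, q)\<close> (\<open>frame_exists\<close>). Relative to
  them, matrices are decomposed into blocks of types \<open>(r, s)\<close>, and all filtrations in question have the
  form \<open>g HF\<close>, where \<open>g\<close> is unipotent and lowers weights, and \<open>HF\<close> is the filtration of the frame.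

  In this language, \<open>g\<close> carries the frame to the Deligne bigrading of the fibre at \<open>s\<close> if and only if
  \<open>\<lambda> = g\<^sup>-\<^sup>1 e\<^sup>-\<^sup>2\<^sup>i\<^sup>y\<^sup>N conj(g)\<close> is unipotent with types in \<open>LamT\<close>, i.e. with \<open>r, s < 0\<close>. Such a \<open>g\<close> is found
  degree by degree (\<open>deligne_splitting\<close>), and the grading in the canonical extension is
  \<open>Y(s) = g YR g\<^sup>-\<^sup>1\<close> with the constant \<open>YR\<close> (\<open>mhs_grading_frame\<close>, \<open>splitting_at\<close>). Moreover the relative
  weight filtration exists if and only if \<open>N\<close> lowers weights by two, since it can only be \<open>W\<close>
  (\<open>relative_weight_filtration_iff\<close>).

  If \<open>Y(s)\<close> converges, then so does \<open>g\<close> (\<open>conj_grading_converges\<close>), and hence \<open>psi s = g HF\<close>. In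
  degree \<open>-1\<close> the definition of \<open>\<lambda>\<close> says that \<open>conj(g) - g\<close> is \<open>2iy N\<close>. As \<open>g\<close> is bounded and \<open>y\<close> tends to
  infinity, \<open>N\<close> has no component of degree \<open>-1\<close> (\<open>weight_drop\<close>).

  Let conversely the variation be admissible. Then the limiting filtration has the same graded pieces
  (\<open>limit_same_gr\<close>), hence a Deligne splitting \<open>g\<^sub>\<infinity>\<close>, and \<open>psi s = g\<^sub>\<infinity> u(s) HF\<close> with \<open>u\<close> holomorphic
  at \<open>0\<close> and \<open>u(0) = 1\<close>. By horizontality, \<open>\<nu> = g\<^sub>\<infinity>\<^sup>-\<^sup>1 N g\<^sub>\<infinity>\<close> maps \<open>HF\<^sup>p\<close> to \<open>HF\<^sup>p\<^sup>-\<^sup>1\<close>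
  (\<open>limit_horizontal\<close>), and as \<open>N\<close> is real and lowers weights by two, \<open>\<nu>\<close> has types in \<open>LamT\<close>
  (\<open>horizontal_supp_LamT\<close>). Therefore the constant \<open>g\<^sub>\<infinity>\<close> would be a splitting for all \<open>y\<close> if \<open>u\<close> were
  \<open>1\<close>. Since \<open>u - 1 = O(s)\<close> decays exponentially in \<open>y\<close> while everything else is polynomial in \<open>y\<close>, the
  true splittings \<open>g\<close> converge to \<open>g\<^sub>\<infinity>\<close> (\<open>splitting_converges\<close>), and so does \<open>Y(s)\<close>.
\<close>

(* The dollar sign is kept for entries of vectors and matrices. *)
no_notation fps_nth (infixl "$" 75)

section \<open>Complex matrices\<close>

lemma mat_add_rdistrib: "((A::complex^'n^'m) + B) ** (C::complex^'k^'n) = A ** C + B ** C"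
  by (simp add: vec_eq_iff matrix_matrix_mult_def sum.distrib ring_distribs)

lemma mat_diff_rdistrib: "((A::complex^'n^'m) - B) ** (C::complex^'k^'n) = A ** C - B ** C"
  by (simp add: vec_eq_iff matrix_matrix_mult_def sum_subtractf ring_distribs)

lemma mat_diff_ldistrib: "(C::complex^'n^'m) ** ((A::complex^'k^'n) - B) = C ** A - C ** B"
  by (simp add: vec_eq_iff matrix_matrix_mult_def sum_subtractf ring_distribs)

lemma mat_zero_mult [simp]: "(0::complex^'n^'m) ** (C::complex^'k^'n) = 0" "(D::complex^'n^'m) ** (0::complex^'k^'n) = 0"
  by (simp_all add: vec_eq_iff matrix_matrix_mult_def)

lemma mat_uminus_mult [simp]: "(- A::complex^'n^'m) ** (C::complex^'k^'n) = - (A ** C)"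
  "(A::complex^'n^'m) ** (- C::complex^'k^'n) = - (A ** C)"
  by (simp_all add: vec_eq_iff matrix_matrix_mult_def sum_negf)

lemma mat_sum_mult: "sum f S ** (C::complex^'k^'n) = (\<Sum>x\<in>S. (f x :: complex^'n^'m) ** C)"
  by (induction S rule: infinite_finite_induct) (auto simp: mat_add_rdistrib)

lemma mat_mult_sum: "(C::complex^'n^'m) ** sum f S = (\<Sum>x\<in>S. C ** (f x :: complex^'k^'n))"
  by (induction S rule: infinite_finite_induct) (auto simp: matrix_add_ldistrib)

lemma sum_mat_vec: "sum f S *v v = (\<Sum>x\<in>S. (f x :: complex^'n^'m) *v v)"
  by (induction S rule: infinite_finite_induct) (auto simp: algebra_simps)

lemma mat_sum_prod: "sum f S ** sum g T = (\<Sum>x\<in>S. \<Sum>y\<in>T. (f x :: complex^'n^'m) ** (g y :: complex^'k^'n))"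
  by (subst mat_sum_mult) (simp add: mat_mult_sum)

lemmas mat_algebra = matrix_add_ldistrib mat_add_rdistrib mat_diff_rdistrib mat_diff_ldistrib
  matrix_mul_assoc

lemma mat_scalar_nth: "(mat c ** (A::complex^'n^'m)) $ i $ j = c * A $ i $ j"
proof -
  have "(\<Sum>k\<in>UNIV. (if i = k then c else 0) * A $ k $ j) = (\<Sum>k\<in>{i}. c * A $ k $ j)"
    by (rule sum.mono_neutral_cong_right) auto
  then show ?thesis by (simp add: matrix_matrix_mult_def mat_def)
qed

lemma mat_scalar_commute: "(A::complex^'n^'n) ** mat c = mat c ** A"
proof -
  have "(\<Sum>k\<in>UNIV. A $ i $ k * (if k = j then c else 0)) = (\<Sum>k\<in>{j}. A $ i $ k * c)" for i j
    by (rule sum.mono_neutral_cong_right) auto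
  then show ?thesis by (simp add: vec_eq_iff mat_scalar_nth) (simp add: matrix_matrix_mult_def mat_def)
qed

lemma mat_scalar_vec: "(mat c ** (A::complex^'n^'m)) *v v = c *s (A *v v)"
  by (simp add: vec_eq_iff matrix_vector_mult_def mat_scalar_nth sum_distrib_left mult.assoc)

lemma mat_vec: "mat c *v (v::complex^'n) = c *s v"
  using mat_scalar_vec[of c "mat 1" v] by simp

lemma mat_mat: "mat a ** mat b = (mat (a * b) :: complex^'n^'n)"
  by (simp add: vec_eq_iff mat_scalar_nth) (simp add: mat_def)

lemma mat_plus: "mat a + mat b = (mat (a + b) :: complex^'n^'n)"
  by (simp add: vec_eq_iff mat_def)

lemma mat_scalar_left: "(A::complex^'n^'n) ** (mat c ** B) = mat c ** (A ** B)"
  by (metis mat_scalar_commute matrix_mul_assoc)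

lemma mat_scalar_mult: "(mat a ** (A::complex^'n^'n)) ** (mat b ** B) = mat (a * b) ** (A ** B)"
proof -
  have "(mat a ** A) ** (mat b ** B) = mat b ** ((mat a ** A) ** B)" by (rule mat_scalar_left)
  also have "\<dots> = (mat b ** mat a) ** (A ** B)" by (simp only: matrix_mul_assoc)
  finally show ?thesis by (simp only: mat_mat mult.commute[of b a])
qed

lemma scaleR_mat: "c *\<^sub>R (A::complex^'n^'n) = mat (of_real c) ** A"
  by (simp add: vec_eq_iff mat_scalar_nth) (simp add: scaleR_conv_of_real)

lemma mv_scale: "(A::complex^'n^'m) *v (c *s v) = c *s (A *v v)"
  by (simp add: vec_eq_iff matrix_vector_mult_def sum_distrib_left mult.left_commute)

lemma subspace_mv_image: "vec.subspace S \<Longrightarrow> vec.subspace ((*v) (A::complex^'n^'n) ` S)"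
  unfolding vec.subspace_def
  by (auto simp: image_iff) (metis matrix_vector_mult_0_right, metis matrix_vector_right_distrib, metis mv_scale)

subsection \<open>Inverses\<close>

lemma mat_inv_right: "invertible (A::complex^'n^'n) \<Longrightarrow> A ** matrix_inv A = mat 1"
  and mat_inv_left: "invertible (A::complex^'n^'n) \<Longrightarrow> matrix_inv A ** A = mat 1"
  using someI_ex[of "\<lambda>B. A ** B = mat 1 \<and> B ** A = mat 1"]
  unfolding matrix_inv_def invertible_def by auto

lemma mat_inv_right': "invertible (A::complex^'n^'n) \<Longrightarrow> B ** A ** matrix_inv A = B"
  and mat_inv_left': "invertible (A::complex^'n^'n) \<Longrightarrow> B ** matrix_inv A ** A = B"
  by (metis mat_inv_right mat_inv_left matrix_mul_assoc matrix_mul_rid)+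

lemma mat_inv_unique: "(A::complex^'n^'n) ** B = mat 1 \<Longrightarrow> matrix_inv A = B"
  by (metis invertible_right_inverse mat_inv_left matrix_mul_assoc matrix_mul_lid matrix_mul_rid)

lemma invertibleI: "(A::complex^'n^'n) ** B = mat 1 \<Longrightarrow> invertible A"
  using invertible_right_inverse by blast

lemma invertible_mat_1: "invertible (mat 1 :: complex^'n^'n)"
  by (rule invertibleI[of _ "mat 1"]) simp

lemma mat_inv_mat_1: "matrix_inv (mat 1 :: complex^'n^'n) = mat 1"
  by (rule mat_inv_unique) simp

lemma invertible_mat_inv: "invertible (A::complex^'n^'n) \<Longrightarrow> invertible (matrix_inv A)"
  using invertibleI mat_inv_left by blast

lemma mat_inv_inv: "invertible (A::complex^'n^'n) \<Longrightarrow> matrix_inv (matrix_inv A) = A"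
  using mat_inv_left mat_inv_unique by blast

lemma mat_inv_mult: "invertible (A::complex^'n^'n) \<Longrightarrow> invertible (B::complex^'n^'n) \<Longrightarrow>
    matrix_inv (A ** B) = matrix_inv B ** matrix_inv A"
  by (rule mat_inv_unique) (simp add: matrix_mul_assoc mat_inv_right' mat_inv_right)

lemma mat_inv_vec: "invertible (A::complex^'n^'n) \<Longrightarrow> matrix_inv A *v (A *v v) = v"
  "invertible (A::complex^'n^'n) \<Longrightarrow> A *v (matrix_inv A *v v) = v"
  by (simp_all add: matrix_vector_mul_assoc mat_inv_left mat_inv_right)

lemma image_mat_inv_iff: "invertible (A::complex^'n^'n) \<Longrightarrow> v \<in> (*v) A ` S \<longleftrightarrow> matrix_inv A *v v \<in> S"
  by (metis (no_types, lifting) image_iff mat_inv_vec)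

lemma image_mat_mult: "(*v) (A ** B) ` S = (*v) (A::complex^'n^'n) ` ((*v) (B::complex^'n^'n) ` S)"
  by (simp add: image_image matrix_vector_mul_assoc)

lemma image_inv_image: "invertible (A::complex^'n^'n) \<Longrightarrow> (*v) (matrix_inv A) ` ((*v) A ` S) = S"
  "invertible (A::complex^'n^'n) \<Longrightarrow> (*v) A ` ((*v) (matrix_inv A) ` S) = S"
  by (simp_all add: image_image mat_inv_vec)

lemma inj_invertible: "invertible (A::complex^'n^'n) \<Longrightarrow> inj ((*v) A)"
  using inj_matrix_vector_mult by blast

subsection \<open>Complex conjugation\<close>

definition cnjm :: "complex^'n^'n \<Rightarrow> complex^'n^'n" where
  "cnjm A = (\<chi> i j. cnj (A $ i $ j))"

lemma cnjm_nth [simp]: "cnjm A $ i $ j = cnj (A $ i $ j)" by (simp add: cnjm_def)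
lemma cnjv_nth [simp]: "cnjv v $ i = cnj (v $ i)" by (simp add: cnjv_def)
lemma cnjm_cnjm [simp]: "cnjm (cnjm A) = A" by (simp add: vec_eq_iff)
lemma cnjv_cnjv [simp]: "cnjv (cnjv v) = v" by (simp add: vec_eq_iff)
lemma cnjm_mult: "cnjm (A ** B) = cnjm A ** cnjm B" by (simp add: vec_eq_iff matrix_matrix_mult_def)
lemma cnjm_add: "cnjm (A + B) = cnjm A + cnjm B" by (simp add: vec_eq_iff)
lemma cnjm_diff: "cnjm (A - B) = cnjm A - cnjm B" by (simp add: vec_eq_iff)
lemma cnjm_0 [simp]: "cnjm 0 = 0" by (simp add: vec_eq_iff)
lemma cnjm_mat [simp]: "cnjm (mat c) = mat (cnj c)" by (simp add: vec_eq_iff mat_def)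
lemma cnjm_sum: "cnjm (sum f S) = (\<Sum>x\<in>S. cnjm (f x))"
  by (induction S rule: infinite_finite_induct) (auto simp: cnjm_add)
lemma cnjv_mv: "cnjv (A *v v) = cnjm A *v cnjv v" by (simp add: vec_eq_iff matrix_vector_mult_def)
lemma cnjv_add: "cnjv (u + v) = cnjv u + cnjv v" by (simp add: vec_eq_iff)
lemma cnjv_diff: "cnjv (u - v) = cnjv u - cnjv v" by (simp add: vec_eq_iff)
lemma cnjv_scale: "cnjv (c *s v) = cnj c *s cnjv v" by (simp add: vec_eq_iff)
lemma cnjv_0 [simp]: "cnjv 0 = 0" by (simp add: vec_eq_iff)
lemma cnjv_image_iff: "v \<in> cnjv ` S \<longleftrightarrow> cnjv v \<in> S" by (metis cnjv_cnjv image_iff)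

lemma invertible_cnjm: "invertible A \<Longrightarrow> invertible (cnjm A)"
  and cnjm_inv: "invertible A \<Longrightarrow> cnjm (matrix_inv A) = matrix_inv (cnjm A)"
proof -
  assume "invertible A"
  then have "cnjm A ** cnjm (matrix_inv A) = mat 1" by (simp flip: cnjm_mult add: mat_inv_right)
  then show "invertible (cnjm A)" "cnjm (matrix_inv A) = matrix_inv (cnjm A)"
    using invertibleI mat_inv_unique by metis+
qed

lemma subspace_cnjv: "vec.subspace S \<Longrightarrow> vec.subspace (cnjv ` S)"
  unfolding vec.subspace_def cnjv_image_iff by (auto simp: cnjv_add cnjv_scale)

subsection \<open>Limits and holomorphy\<close>

lemma tendsto_mat_iff: "(A \<longlongrightarrow> (A0::complex^'n^'m)) F \<longleftrightarrow> (\<forall>i j. ((\<lambda>s. A s $ i $ j) \<longlongrightarrow> A0 $ i $ j) F)"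
  using vec_tendstoI[of A A0 F] vec_tendstoI[of "\<lambda>s. A s $ _" "A0 $ _" F] tendsto_vec_nth[of A A0 F]
    tendsto_vec_nth[of "\<lambda>s. A s $ _" "A0 $ _" F] by blast

lemma tendsto_mat_mult: "(A \<longlongrightarrow> (A0::complex^'n^'m)) F \<Longrightarrow> (B \<longlongrightarrow> (B0::complex^'k^'n)) F \<Longrightarrow>
    ((\<lambda>s. A s ** B s) \<longlongrightarrow> A0 ** B0) F"
  unfolding matrix_matrix_mult_def by (intro vec_tendstoI) (auto intro!: tendsto_intros)

lemma tendsto_mat_vec: "(A \<longlongrightarrow> (A0::complex^'n^'m)) F \<Longrightarrow> (v \<longlongrightarrow> v0) F \<Longrightarrow>
    ((\<lambda>s. A s *v v s) \<longlongrightarrow> A0 *v v0) F"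
  unfolding matrix_vector_mult_def
  by (rule vec_tendstoI) (auto intro!: tendsto_intros tendsto_vec_nth)

lemma tendsto_cnjm: "(A \<longlongrightarrow> A0) F \<Longrightarrow> ((\<lambda>s. cnjm (A s)) \<longlongrightarrow> cnjm A0) F"
  unfolding cnjm_def by (intro vec_tendstoI) (auto intro!: tendsto_intros)

lemma tendsto_det: "(A \<longlongrightarrow> (A0::complex^'n^'n)) F \<Longrightarrow> ((\<lambda>s. det (A s)) \<longlongrightarrow> det A0) F"
  unfolding det_def by (auto intro!: tendsto_intros)

text \<open>Cramer's rule shows that the inverse depends continuously and holomorphically on the matrix.\<close>

lemma mat_inv_nth:
  fixes A :: "complex^'n^'n"
  assumes "invertible A"
  shows "matrix_inv A $ k $ j = det (\<chi> i l. if l = k then (if i = j then 1 else 0) else A $ i $ l) / det A"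
proof -
  have d: "det A \<noteq> 0" using assms invertible_det_nz by blast
  have "A *v (matrix_inv A *v axis j 1) = axis j 1" using assms mat_inv_vec(2) by blast
  then have "matrix_inv A *v axis j 1 = (\<chi> k. det (\<chi> i l. if l = k then axis j 1 $ i else A $ i $ l) / det A)"
    using cramer[OF d] by blast
  moreover have "(matrix_inv A *v axis j 1) $ k = matrix_inv A $ k $ j"
    by (simp add: matrix_vector_mult_def axis_def if_distrib[of "\<lambda>x. _ * x"] sum.delta cong: if_cong)
  ultimately show ?thesis by (simp add: axis_def cong: if_cong)
qed

lemma tendsto_mat_inv:
  fixes A :: "'a \<Rightarrow> complex^'n^'n"
  assumes A: "(A \<longlongrightarrow> A0) F" and i: "invertible A0"
  shows "\<forall>\<^sub>F s in F. invertible (A s)" "((\<lambda>s. matrix_inv (A s)) \<longlongrightarrow> matrix_inv A0) F"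
proof -
  have d0: "det A0 \<noteq> 0" using i invertible_det_nz by blast
  have "\<forall>\<^sub>F s in F. det (A s) \<noteq> 0" using tendsto_det[OF A] d0 tendsto_imp_eventually_ne by blast
  then show ev: "\<forall>\<^sub>F s in F. invertible (A s)" by (simp add: invertible_det_nz)
  have "((\<lambda>s. matrix_inv (A s) $ k $ j) \<longlongrightarrow> matrix_inv A0 $ k $ j) F" for k j
  proof -
    let ?B = "\<lambda>A. \<chi> i l. if l = k then (if i = j then 1 else 0) else A $ i $ l"
    have "((\<lambda>s. ?B (A s)) \<longlongrightarrow> ?B A0) F"
      using A unfolding tendsto_mat_iff by auto
    then have "((\<lambda>s. det (?B (A s)) / det (A s)) \<longlongrightarrow> det (?B A0) / det A0) F"
      using tendsto_det[OF A] d0 by (intro tendsto_divide) (rule tendsto_det)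
    moreover have "\<forall>\<^sub>F s in F. det (?B (A s)) / det (A s) = matrix_inv (A s) $ k $ j"
      using ev by eventually_elim (simp add: mat_inv_nth)
    ultimately show ?thesis unfolding mat_inv_nth[OF i] by (rule Lim_transform_eventually)
  qed
  then show "((\<lambda>s. matrix_inv (A s)) \<longlongrightarrow> matrix_inv A0) F" by (simp add: tendsto_mat_iff)
qed

definition hol_mat :: "(complex \<Rightarrow> complex^'n^'n) \<Rightarrow> complex set \<Rightarrow> bool" where
  "hol_mat A S \<longleftrightarrow> (\<forall>i j. (\<lambda>t. A t $ i $ j) holomorphic_on S)"

lemma hol_mat_const: "hol_mat (\<lambda>_. A) S" by (simp add: hol_mat_def)

lemma hol_mat_mult: "hol_mat A S \<Longrightarrow> hol_mat B S \<Longrightarrow> hol_mat (\<lambda>t. A t ** B t) S"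
  by (auto simp: hol_mat_def matrix_matrix_mult_def intro!: holomorphic_intros)

lemma hol_mat_add: "hol_mat A S \<Longrightarrow> hol_mat B S \<Longrightarrow> hol_mat (\<lambda>t. A t + B t) S"
  by (auto simp: hol_mat_def intro!: holomorphic_intros)

lemma hol_mat_sum: "(\<And>x. x \<in> I \<Longrightarrow> hol_mat (A x) S) \<Longrightarrow> hol_mat (\<lambda>t. \<Sum>x\<in>I. A x t) S"
  by (auto simp: hol_mat_def intro!: holomorphic_intros)

lemma hol_mat_scalar:
  assumes f: "f holomorphic_on S"
  shows "hol_mat (\<lambda>t. mat (f t) :: complex^'n^'n) S"
proof -
  have "(\<lambda>t. (mat (f t) :: complex^'n^'n) $ i $ j) holomorphic_on S" for i j :: 'n
    by (cases "i = j") (simp_all add: mat_def f)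
  then show ?thesis by (simp add: hol_mat_def)
qed

lemma hol_det: "hol_mat A S \<Longrightarrow> (\<lambda>t. det (A t)) holomorphic_on S"
  unfolding hol_mat_def det_def by (auto intro!: holomorphic_intros)

lemma hol_mat_inv:
  fixes A :: "complex \<Rightarrow> complex^'n^'n"
  assumes A: "hol_mat A S" and i: "\<And>t. t \<in> S \<Longrightarrow> invertible (A t)"
  shows "hol_mat (\<lambda>t. matrix_inv (A t)) S"
  unfolding hol_mat_def
proof (intro allI)
  fix k j
  let ?B = "\<lambda>A::complex^'n^'n. (\<chi> i l. if l = k then (if i = j then 1 else 0) else A $ i $ l)::complex^'n^'n"
  have "(\<lambda>t. ?B (A t) $ i $ l) holomorphic_on S" for i l
    using A by (cases "l = k") (auto simp: hol_mat_def)
  then have "hol_mat (\<lambda>t. ?B (A t)) S" unfolding hol_mat_def by blast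
  then have "(\<lambda>t. det (?B (A t)) / det (A t)) holomorphic_on S"
    using A i by (intro holomorphic_intros hol_det) (auto simp: invertible_det_nz)
  then show "(\<lambda>t. matrix_inv (A t) $ k $ j) holomorphic_on S"
    by (rule holomorphic_transform) (simp add: mat_inv_nth i)
qed

subsection \<open>Nilpotent matrices and the exponential\<close>

lemma matpow_0 [simp]: "matpow A 0 = mat 1" by (simp add: matpow_def)
lemma matpow_Suc: "matpow A (Suc k) = A ** matpow A k" by (simp add: matpow_def)
lemma matpow_add: "matpow A (j + k) = matpow A j ** matpow A k"
  by (induction j) (simp_all add: matpow_Suc matrix_mul_assoc)
lemma matpow_1 [simp]: "matpow A (Suc 0) = A" by (simp add: matpow_Suc)

lemma matpow_scalar: "matpow (mat c ** A) k = mat (c ^ k) ** matpow A k"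
  by (induction k) (simp_all add: matpow_Suc, metis mat_mat mat_scalar_commute matrix_mul_assoc)

lemma cnjm_matpow: "cnjm (matpow A k) = matpow (cnjm A) k"
  by (induction k) (simp_all add: matpow_Suc cnjm_mult)

text \<open>The ranges of the powers decrease strictly until they vanish.\<close>

lemma nilpotent_card:
  fixes X :: "complex^'n^'n"
  assumes "matpow X m = 0"
  shows "CARD('n) \<le> k \<Longrightarrow> matpow X k = 0"
proof -
  let ?R = "\<lambda>j. range ((*v) (matpow X j))"
  have sub: "vec.subspace (?R j)" for j
    using subspace_mv_image[OF vec.subspace_UNIV] by blast
  have step: "?R (Suc j) = (*v) X ` ?R j" for j
    by (simp add: matpow_Suc image_mat_mult)
  have R0: "matpow X j = 0" if "?R j \<subseteq> {0}" for j
    using that by (auto simp: matrix_eq image_subset_iff)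
  have mono: "?R (Suc j) \<subseteq> ?R j" for j
    using matpow_add[of X j 1] by (auto simp: matrix_vector_mul_assoc[symmetric])
  have claim: "?R j \<subseteq> {0} \<or> vec.dim (?R j) + j \<le> CARD('n)" for j
  proof (induction j)
    case 0
    then show ?case by (metis add.right_neutral dim_subset_UNIV_cart_gen)
  next
    case (Suc j)
    show ?case
    proof (cases "?R (Suc j) = ?R j")
      case True
      have "?R (j + i) = ?R j" for i
        by (induction i) (simp_all add: step True[unfolded step])
      then have "?R (j + m) = ?R j" by blast
      then show ?thesis using True by (auto simp: matpow_add assms)
    next
      case False
      then have "vec.dim (?R (Suc j)) < vec.dim (?R j)"
        using mono[of j] sub[of j] sub[of "Suc j"]
        by (intro vec.dim_psubset) (simp add: vec.span_eq_iff[THEN iffD2] psubset_eq)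
      moreover have "\<not> ?R j \<subseteq> {0}"
      proof
        assume "?R j \<subseteq> {0}"
        then have "?R j = {0}" "?R (Suc j) = {0}"
          using mono[of j] vec.subspace_0[OF sub[of j]] vec.subspace_0[OF sub[of "Suc j"]] by blast+
        with False show False by simp
      qed
      ultimately show ?thesis using Suc by auto
    qed
  qed
  have "?R (CARD('n)) \<subseteq> {0}"
    using claim[of "CARD('n)"] by simp
  then show "matpow X k = 0" if "CARD('n) \<le> k"
    using R0[of "CARD('n)"] matpow_add[of X "CARD('n)" "k - CARD('n)"] that by simp
qed

definition nilpotent :: "complex^'n^'n \<Rightarrow> bool" where
  "nilpotent X \<longleftrightarrow> (\<exists>m. matpow X m = 0)"

lemma nilpotentD: "nilpotent (X::complex^'n^'n) \<Longrightarrow> CARD('n) \<le> k \<Longrightarrow> matpow X k = 0"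
  using nilpotent_card unfolding nilpotent_def by blast

text \<open>Evaluation of power series at a nilpotent matrix, a ring homomorphism, turns identities
  between power series into identities between matrices.\<close>

definition fps_ev :: "complex^'n^'n \<Rightarrow> complex fps \<Rightarrow> complex^'n^'n" where
  "fps_ev X f = (\<Sum>k\<le>CARD('n). mat (fps_nth f k) ** matpow X k)"

lemma fps_ev_mult:
  fixes X :: "complex^'n^'n"
  assumes "nilpotent X"
  shows "fps_ev X (f * g) = fps_ev X f ** fps_ev X g"
proof -
  let ?n = "CARD('n)" and ?t = "\<lambda>i j. mat (fps_nth f i * fps_nth g j) ** matpow X (i + j)"
  have z: "matpow X k = 0" if "?n \<le> k" for k
    using assms nilpotentD that by blast
  have "fps_ev X f ** fps_ev X g = (\<Sum>i\<le>?n. \<Sum>j\<le>?n. ?t i j)"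
    unfolding fps_ev_def mat_sum_prod
    by (intro sum.cong refl) (simp add: matpow_add mat_scalar_mult)
  also have "\<dots> = (\<Sum>(i,j)\<in>{..?n} \<times> {..?n}. ?t i j)" by (simp add: sum.cartesian_product)
  also have "\<dots> = (\<Sum>(i,j)\<in>{(i,j). i + j \<le> ?n}. ?t i j)"
    by (rule sum.mono_neutral_right) (auto, metis nat_le_linear mat_zero_mult(2) z)
  also have "\<dots> = (\<Sum>k\<le>?n. \<Sum>i\<le>k. ?t i (k - i))" by (rule sum.triangle_reindex_eq)
  also have "\<dots> = fps_ev X (f * g)"
    unfolding fps_ev_def
  proof (rule sum.cong[OF refl])
    fix k
    have "(mat (\<Sum>i\<in>S. h i) :: complex^'n^'n) = (\<Sum>i\<in>S. mat (h i))" for S and h :: "nat \<Rightarrow> complex"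
      by (induction S rule: infinite_finite_induct) (auto simp: mat_plus[symmetric] vec_eq_iff mat_def)
    then show "(\<Sum>i\<le>k. ?t i (k - i)) = mat (fps_nth (f * g) k) ** matpow X k"
      by (simp add: fps_mult_nth mat_sum_mult atLeast0AtMost)
  qed
  finally show ?thesis by simp
qed

lemma fps_ev_cong: "(\<And>k. k \<le> CARD('n) \<Longrightarrow> fps_nth f k = fps_nth g k) \<Longrightarrow> fps_ev (X::complex^'n^'n) f = fps_ev X g"
  by (simp add: fps_ev_def)

lemma fps_ev_1: "fps_ev X 1 = mat 1"
proof -
  have "fps_ev X 1 = (\<Sum>k\<in>{0}. mat (fps_nth 1 k) ** matpow X k)"
    unfolding fps_ev_def by (rule sum.mono_neutral_right) (auto simp: vec_eq_iff mat_scalar_nth)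
  then show ?thesis by simp
qed

lemma fps_ev_X: "fps_ev X fps_X = (X::complex^'n^'n)"
proof -
  have "fps_ev X fps_X = (\<Sum>k\<in>{1}. mat (fps_nth fps_X k) ** matpow X k)"
    unfolding fps_ev_def using zero_less_card_finite[where 'a='n]
    by (intro sum.mono_neutral_right) (auto simp: vec_eq_iff mat_scalar_nth Suc_le_eq)
  then show ?thesis by simp
qed

lemma fps_ev_add: "fps_ev X (f + g) = fps_ev X f + fps_ev X g"
  by (simp add: fps_ev_def mat_plus[symmetric] mat_add_rdistrib sum.distrib)

lemma fps_ev_const: "fps_ev X (fps_const c * f) = mat c ** fps_ev X f"
  by (simp add: fps_ev_def mat_mult_sum mat_mat[symmetric] matrix_mul_assoc)

lemma fps_ev_sum: "fps_ev X (sum f S) = (\<Sum>k\<in>S. fps_ev X (f k))"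
  by (induction S rule: infinite_finite_induct)
    (auto simp: fps_ev_add, simp_all add: fps_ev_def vec_eq_iff mat_scalar_nth)

lemma fps_ev_power: "nilpotent X \<Longrightarrow> fps_ev X (f ^ k) = matpow (fps_ev X f) k"
  by (induction k) (simp_all add: fps_ev_1 fps_ev_mult matpow_Suc)

lemma nilpotent_fps_ev:
  assumes "nilpotent (X::complex^'n^'n)" "fps_nth f 0 = 0"
  shows "nilpotent (fps_ev X f)"
proof -
  have "matpow (fps_ev X f) (Suc CARD('n)) = fps_ev X (f ^ Suc CARD('n))"
    by (simp only: fps_ev_power[OF assms(1)])
  also have "\<dots> = fps_ev X 0"
    using startsby_zero_power_prefix[OF assms(2), of "Suc CARD('n)"] by (intro fps_ev_cong) auto
  also have "\<dots> = 0" by (simp add: fps_ev_def vec_eq_iff mat_scalar_nth)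
  finally show ?thesis unfolding nilpotent_def by blast
qed

lemma mexp_nilpotent:
  assumes "nilpotent (X::complex^'n^'n)"
  shows "mexp X = (\<Sum>k\<le>CARD('n). mat (1 / fact k) ** matpow X k)"
proof -
  have "mexp X = (\<Sum>k\<le>CARD('n). (1 / fact k) *\<^sub>R matpow X k)"
    unfolding mexp_def by (intro suminf_finite) (auto simp: nilpotentD[OF assms])
  then show ?thesis by (simp add: scaleR_mat)
qed

lemma nilpotent_scalar: "nilpotent X \<Longrightarrow> nilpotent (mat c ** X)"
  unfolding nilpotent_def matpow_scalar by (metis mat_zero_mult(2))

lemma mexp_scalar: "nilpotent X \<Longrightarrow> mexp (mat c ** X) = fps_ev X (fps_exp c)"
  unfolding mexp_nilpotent[OF nilpotent_scalar] fps_ev_def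
  by (intro sum.cong refl) (simp add: matpow_scalar matrix_mul_assoc mat_mat)

lemma mexp_add: "nilpotent X \<Longrightarrow> mexp (mat (a + b) ** X) = mexp (mat a ** X) ** mexp (mat b ** X)"
  by (simp add: mexp_scalar fps_exp_add_mult fps_ev_mult)

lemma mexp_0: "nilpotent X \<Longrightarrow> mexp (mat 0 ** X) = mat 1"
  by (simp only: mexp_scalar fps_exp_0 fps_ev_1)

lemma mexp_inv:
  assumes "nilpotent X"
  shows "invertible (mexp (mat a ** X))" "matrix_inv (mexp (mat a ** X)) = mexp (mat (- a) ** X)"
proof -
  have "mexp (mat a ** X) ** mexp (mat (- a) ** X) = mat 1"
    using mexp_add[OF assms, of a "- a"] mexp_0[OF assms] by simp
  then show "invertible (mexp (mat a ** X))" "matrix_inv (mexp (mat a ** X)) = mexp (mat (- a) ** X)"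
    using invertibleI mat_inv_unique by auto
qed

lemma cnjm_mexp: "nilpotent X \<Longrightarrow> cnjm X = X \<Longrightarrow> cnjm (mexp (mat a ** X)) = mexp (mat (cnj a) ** X)"
  by (simp add: mexp_scalar fps_ev_def cnjm_sum cnjm_mult cnjm_matpow)

text \<open>The logarithm of a unipotent matrix as the value of a power series.\<close>

lemma neg_log_unipotent_fps:
  "neg_log_unipotent (T::complex^'n^'n) =
     fps_ev (T - mat 1) (Abs_fps (\<lambda>k. if k = 0 then 0 else (- 1) ^ k / of_nat k))"
proof -
  have "{..CARD('n)} = insert 0 {1..CARD('n)}" by auto
  then show ?thesis
    unfolding neg_log_unipotent_def fps_ev_def
    by (simp add: scaleR_mat vec_eq_iff mat_scalar_nth)
qed

text \<open>With \<open>g = - log (1 + X)\<close> the derivative of \<open>(1 + X) exp g\<close> is zero.\<close>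

lemma mexp_neg_log:
  fixes T :: "complex^'n^'n"
  assumes nil: "nilpotent (T - mat 1)"
  shows "T ** mexp (neg_log_unipotent T) = mat 1"
proof -
  define g :: "complex fps" where "g = Abs_fps (\<lambda>k. if k = 0 then 0 else (- 1) ^ k / of_nat k)"
  define e where "e = fps_compose (fps_exp 1) g"
  have g0: "fps_nth g 0 = 0" by (simp add: g_def)
  have dgn: "fps_nth (fps_deriv g) n = (- 1) ^ Suc n" for n
    by (simp add: g_def del: of_nat_Suc)
  have dg: "(1 + fps_X) * fps_deriv g = - 1"
  proof (rule fps_ext)
    fix n
    show "fps_nth ((1 + fps_X) * fps_deriv g) n = fps_nth (- 1) n"
      by (cases n) (simp_all add: distrib_right dgn del: fps_deriv_nth)
  qed
  have "fps_deriv ((1 + fps_X) * e) = e + (1 + fps_X) * (e * fps_deriv g)"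
    by (simp add: e_def fps_compose_deriv[OF g0])
  also have "\<dots> = e + e * ((1 + fps_X) * fps_deriv g)" by (simp only: mult_ac)
  finally have "fps_deriv ((1 + fps_X) * e) = 0" by (simp add: dg)
  then have "(1 + fps_X) * e = fps_const (fps_nth ((1 + fps_X) * e) 0)" by (simp only: fps_deriv_eq_0_iff)
  also have "fps_nth ((1 + fps_X) * e) 0 = 1" by (simp add: e_def)
  finally have e: "(1 + fps_X) * e = 1" by simp
  define X where "X = T - mat 1"
  have N: "neg_log_unipotent T = fps_ev X g" by (simp add: neg_log_unipotent_fps g_def X_def)
  have nX: "nilpotent X" using nil by (simp add: X_def)
  have "mexp (neg_log_unipotent T) = (\<Sum>k\<le>CARD('n). mat (1 / fact k) ** matpow (fps_ev X g) k)"
    unfolding N by (rule mexp_nilpotent) (rule nilpotent_fps_ev[OF nX g0])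
  also have "\<dots> = fps_ev X (\<Sum>k\<le>CARD('n). fps_const (1 / fact k) * g ^ k)"
    by (simp add: fps_ev_sum fps_ev_const fps_ev_power nX)
  also have "\<dots> = fps_ev X e"
  proof (rule fps_ev_cong)
    fix m assume m: "m \<le> CARD('n)"
    have "fps_nth (\<Sum>k\<le>CARD('n). fps_const (1 / fact k) * g ^ k) m
        = (\<Sum>k\<le>CARD('n). 1 / fact k * fps_nth (g ^ k) m)" by (simp add: fps_sum_nth)
    also have "\<dots> = (\<Sum>k\<le>m. 1 / fact k * fps_nth (g ^ k) m)"
      using m startsby_zero_power_prefix[OF g0] by (intro sum.mono_neutral_right) auto
    finally show "fps_nth (\<Sum>k\<le>CARD('n). fps_const (1 / fact k) * g ^ k) m = fps_nth e m"
      by (simp add: e_def fps_compose_nth atLeast0AtMost)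
  qed
  finally have "mexp (neg_log_unipotent T) = fps_ev X e" .
  moreover have "T = fps_ev X (1 + fps_X)" by (simp add: fps_ev_add fps_ev_1 fps_ev_X X_def)
  ultimately show ?thesis using e fps_ev_mult[OF nX, of "1 + fps_X" e] by (simp add: fps_ev_1)
qed

declare split_paired_All [simp del] split_paired_Ex [simp del]

section \<open>Bigraded frames\<close>

text \<open>A homomorphism of type \<open>(r, s)\<close> maps \<open>H\<^sup>p\<^sup>,\<^sup>q\<close> to \<open>H\<^sup>p\<^sup>+\<^sup>r\<^sup>,\<^sup>q\<^sup>+\<^sup>s\<close>. The types in \<open>NegT\<close> lower weights, those
  in \<open>StabT\<close> also preserve the Hodge filtration, and \<open>LamT\<close> gives Deligne's \<open>\<Lambda>\<^sup>-\<^sup>1\<^sup>,\<^sup>-\<^sup>1\<close>. The complement \<open>ChartT\<close> of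
  \<open>StabT\<close> in \<open>NegT\<close> parametrizes the filtrations with given graded pieces. Finally \<open>NegT\<close> is the disjoint
  union of \<open>StabT\<close>, its conjugate and \<open>LamT\<close>.\<close>

definition wt :: "int \<times> int \<Rightarrow> int" where "wt d = fst d + snd d"

definition NegT :: "(int \<times> int) set" where "NegT = {d. wt d < 0}"
definition StabT :: "(int \<times> int) set" where "StabT = {d. 0 \<le> fst d \<and> wt d < 0}"
definition LamT :: "(int \<times> int) set" where "LamT = {d. fst d < 0 \<and> snd d < 0}"
definition ChartT :: "(int \<times> int) set" where "ChartT = {d. fst d < 0 \<and> wt d < 0}"

definition add_closed :: "(int \<times> int) set \<Rightarrow> bool" where
  "add_closed S \<longleftrightarrow> S \<subseteq> NegT \<and> (\<forall>s\<in>S. \<forall>t\<in>S. s + t \<in> S)"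

lemma wt_simps [simp]: "wt (x + y) = wt x + wt y" "wt (x - y) = wt x - wt y" "wt 0 = 0"
  "wt (prod.swap x) = wt x" "wt (p, q) = p + q"
  by (auto simp: wt_def)

lemma add_closed_types: "add_closed NegT" "add_closed StabT" "add_closed LamT" "add_closed ChartT"
  by (auto simp: add_closed_def NegT_def StabT_def LamT_def ChartT_def wt_def)

lemma swap_diff: "prod.swap x - prod.swap y = prod.swap (x - y :: int \<times> int)"
  by (cases x; cases y) simp

lemma swap_image: "prod.swap ` S = {x. prod.swap x \<in> S}"
proof
  show "{x. prod.swap x \<in> S} \<subseteq> prod.swap ` S" using image_eqI[of _ prod.swap "prod.swap _"] by (metis mem_Collect_eq subsetI swap_swap)
qed auto

lemma swap_NegT: "prod.swap ` NegT = NegT"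
  unfolding swap_image by (simp add: NegT_def)

text \<open>A bigrading that splits over the reals, given by its projections. Its components vanish outside of the
  finite set \<open>R\<close>.\<close>

locale bigraded_frame =
  fixes pr :: "int \<times> int \<Rightarrow> complex^'n^'n" and R :: "(int \<times> int) set"
  assumes finR: "finite R"
    and pr_out: "x \<notin> R \<Longrightarrow> pr x = 0"
    and pr_pr: "pr x ** pr y = (if x = y then pr x else 0)"
    and pr_sum: "(\<Sum>x\<in>R. pr x) = mat 1"
    and cnjm_pr: "cnjm (pr x) = pr (prod.swap x)"
begin

lemma pr_pr_vec: "pr x *v (pr y *v v) = (if x = y then pr x *v v else 0)"
  by (simp add: matrix_vector_mul_assoc pr_pr)

subsection \<open>Blocks and supports of matrices\<close>

definition blk :: "complex^'n^'n \<Rightarrow> int \<times> int \<Rightarrow> int \<times> int \<Rightarrow> complex^'n^'n" where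
  "blk A x y = pr x ** A ** pr y"

lemma blk_out: "x \<notin> R \<or> y \<notin> R \<Longrightarrow> blk A x y = 0"
  by (auto simp: blk_def pr_out)

lemma mat_decomp: "A = (\<Sum>x\<in>R. \<Sum>y\<in>R. blk A x y)"
proof -
  have "A = (\<Sum>x\<in>R. pr x) ** A ** (\<Sum>y\<in>R. pr y)" by (simp add: pr_sum)
  also have "\<dots> = (\<Sum>x\<in>R. pr x ** A) ** (\<Sum>y\<in>R. pr y)" by (simp only: mat_sum_mult)
  also have "\<dots> = (\<Sum>x\<in>R. \<Sum>y\<in>R. blk A x y)" by (simp only: mat_sum_prod blk_def)
  finally show ?thesis .
qed

lemma blk_eqI: "(\<And>x y. blk A x y = blk B x y) \<Longrightarrow> A = B"
  by (subst mat_decomp[of A], subst mat_decomp[of B]) simp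

lemma blk_add: "blk (A + B) x y = blk A x y + blk B x y" by (simp add: blk_def mat_algebra)
lemma blk_diff: "blk (A - B) x y = blk A x y - blk B x y" by (simp add: blk_def mat_algebra)
lemma blk_uminus: "blk (- A) x y = - blk A x y" by (simp add: blk_def)
lemma blk_0 [simp]: "blk 0 x y = 0" by (simp add: blk_def)
lemma blk_sum: "blk (sum f S) x y = (\<Sum>i\<in>S. blk (f i) x y)"
  by (simp add: blk_def mat_sum_mult mat_mult_sum)
lemma blk_scalar: "blk (mat c ** A) x y = mat c ** blk A x y"
proof -
  have "pr x ** (mat c ** A) ** pr y = mat c ** (pr x ** A) ** pr y" by (simp only: mat_scalar_left)
  then show ?thesis by (simp only: blk_def matrix_mul_assoc)
qed
lemma blk_one: "blk (mat 1) x y = (if x = y then pr x else 0)" by (simp add: blk_def pr_pr)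

lemma pr_blk: "pr z ** blk A x y = (if z = x then blk A x y else 0)"
  "blk A x y ** pr z = (if z = y then blk A x y else 0)"
  unfolding blk_def by (simp_all add: matrix_mul_assoc pr_pr) (simp add: matrix_mul_assoc[symmetric] pr_pr)

lemma blk_blk: "blk (blk A x y) x' y' = (if x' = x \<and> y' = y then blk A x y else 0)"
  unfolding blk_def[of "blk A x y"] by (auto simp: pr_blk)

lemma blk_mult: "blk (A ** B) x y = (\<Sum>z\<in>R. blk A x z ** blk B z y)"
proof -
  have "blk (A ** B) x y = pr x ** A ** (\<Sum>z\<in>R. pr z ** pr z) ** B ** pr y"
    by (simp add: pr_pr pr_sum blk_def matrix_mul_assoc)
  also have "\<dots> = (\<Sum>z\<in>R. blk A x z ** blk B z y)"
    by (simp only: mat_mult_sum mat_sum_mult blk_def matrix_mul_assoc)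
  finally show ?thesis .
qed

lemma blk_cnj: "blk (cnjm A) x y = cnjm (blk A (prod.swap x) (prod.swap y))"
  by (simp add: blk_def cnjm_mult cnjm_pr)

text \<open>Differences of indices are types: \<open>blk A x y\<close> maps the summand of index \<open>y\<close> to that of index \<open>x\<close>.\<close>

definition supp :: "(int \<times> int) set \<Rightarrow> complex^'n^'n \<Rightarrow> bool" where
  "supp S A \<longleftrightarrow> (\<forall>x y. blk A x y \<noteq> 0 \<longrightarrow> x - y \<in> S)"

lemma supp_mono: "supp S A \<Longrightarrow> S \<subseteq> T \<Longrightarrow> supp T A" by (auto simp: supp_def)
lemma supp_0: "supp S 0" by (simp add: supp_def)
lemma supp_add:
  assumes "supp S A" "supp S B"
  shows "supp S (A + B)"
  unfolding supp_def
proof (intro allI impI)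
  fix x y assume "blk (A + B) x y \<noteq> 0"
  then have "blk A x y \<noteq> 0 \<or> blk B x y \<noteq> 0" by (auto simp: blk_add)
  then show "x - y \<in> S" using assms unfolding supp_def by blast
qed
lemma supp_uminus: "supp S A \<Longrightarrow> supp S (- A)" by (auto simp: supp_def blk_uminus)
lemma supp_diff: "supp S A \<Longrightarrow> supp S B \<Longrightarrow> supp S (A - B)"
  using supp_add[of S A "- B"] supp_uminus by simp
lemma supp_scalar: "supp S A \<Longrightarrow> supp S (mat c ** A)" by (simp add: supp_def blk_scalar) (metis mat_zero_mult(2))
lemma supp_sum: "(\<And>i. i \<in> I \<Longrightarrow> supp S (f i)) \<Longrightarrow> supp S (sum f I)"
  by (induction I rule: infinite_finite_induct) (auto simp: supp_0 supp_add)
lemma supp_one: "0 \<in> S \<Longrightarrow> supp S (mat 1)" by (auto simp: supp_def blk_one)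

lemma supp_mult:
  assumes "supp S A" "supp T B" and "\<And>s t. s \<in> S \<Longrightarrow> t \<in> T \<Longrightarrow> s + t \<in> U"
  shows "supp U (A ** B)"
  unfolding supp_def
proof (intro allI impI)
  fix x y assume "blk (A ** B) x y \<noteq> 0"
  then obtain z where "blk A x z ** blk B z y \<noteq> 0"
    unfolding blk_mult by (meson sum.neutral)
  then have "blk A x z \<noteq> 0" "blk B z y \<noteq> 0" by auto
  then have "x - z \<in> S" "z - y \<in> T" using assms(1,2) by (auto simp: supp_def)
  then have "(x - z) + (z - y) \<in> U" by (rule assms(3))
  then show "x - y \<in> U" by simp
qed

lemma supp_cnj: "supp S A \<Longrightarrow> supp (prod.swap ` S) (cnjm A)"
  unfolding supp_def blk_cnj
proof (intro allI impI)
  fix x y assume *: "\<forall>x y. blk A x y \<noteq> 0 \<longrightarrow> x - y \<in> S" "cnjm (blk A (prod.swap x) (prod.swap y)) \<noteq> 0"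
  then have "blk A (prod.swap x) (prod.swap y) \<noteq> 0" by auto
  with * have "prod.swap (x - y) \<in> S" by (metis swap_diff)
  then show "x - y \<in> prod.swap ` S" by (metis image_eqI swap_swap)
qed

definition part :: "(int \<times> int) set \<Rightarrow> complex^'n^'n \<Rightarrow> complex^'n^'n" where
  "part S A = (\<Sum>x\<in>R. \<Sum>y\<in>R. if x - y \<in> S then blk A x y else 0)"

lemma blk_part: "blk (part S A) x y = (if x - y \<in> S then blk A x y else 0)"
proof (cases "x \<in> R \<and> y \<in> R")
  case True
  have "blk (part S A) x y = (\<Sum>a\<in>R. \<Sum>b\<in>R. if a = x \<and> b = y then (if x - y \<in> S then blk A x y else 0) else 0)"
    unfolding part_def blk_sum by (intro sum.cong refl) (auto simp: blk_blk)
  also have "\<dots> = (\<Sum>a\<in>R. if a = x then (if x - y \<in> S then blk A x y else 0) else 0)"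
    using True finR by (intro sum.cong refl) (auto simp: sum.delta)
  also have "\<dots> = (if x - y \<in> S then blk A x y else 0)" using True finR by (simp add: sum.delta)
  finally show ?thesis .
qed (auto simp: blk_out)

lemma supp_part: "supp S (part S A)" by (simp add: supp_def blk_part)

lemma wt_bounded: "\<exists>m::nat. \<forall>x\<in>R. \<forall>y\<in>R. wt y - wt x < int m"
proof -
  let ?M = "Max (insert 0 ((\<lambda>(x, y). wt y - wt x) ` (R \<times> R)))"
  have "wt y - wt x \<le> ?M" if "x \<in> R" "y \<in> R" for x y
    using finR that by (intro Max_ge) (auto intro!: image_eqI[of _ _ "(x, y)"])
  then have "\<forall>x\<in>R. \<forall>y\<in>R. wt y - wt x < int (nat ?M + 1)" by force
  then show ?thesis by blast
qed

text \<open>Powers lower the weight more and more, and there are only finitely many weights.\<close>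

lemma supp_nilpotent:
  assumes "supp S X" "S \<subseteq> NegT"
  shows "nilpotent X"
proof -
  have pow: "supp {d. wt d \<le> - int k} (matpow X k)" for k
  proof (induction k)
    case (Suc k)
    show ?case unfolding matpow_Suc
      by (rule supp_mult[OF assms(1) Suc]) (use assms(2) in \<open>force simp: NegT_def\<close>)
  qed (simp add: supp_one)
  obtain m :: nat where bd: "\<And>x y. x \<in> R \<Longrightarrow> y \<in> R \<Longrightarrow> wt y - wt x < int m" using wt_bounded by blast
  have "matpow X m = 0"
  proof (rule blk_eqI)
    fix x y
    show "blk (matpow X m) x y = blk 0 x y"
    proof (rule ccontr)
      assume "blk (matpow X m) x y \<noteq> blk 0 x y"
      then have "blk (matpow X m) x y \<noteq> 0" by simp
      then have "x - y \<in> {d. wt d \<le> - int m}" "x \<in> R" "y \<in> R"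
        using pow[of m] blk_out[of x y] unfolding supp_def by blast+
      then have "wt x - wt y \<le> - int m" by simp
      with bd[of x y] \<open>x \<in> R\<close> \<open>y \<in> R\<close> show False by linarith
    qed
  qed
  then show ?thesis unfolding nilpotent_def by blast
qed

lemma supp_matpow:
  assumes "supp S X" "add_closed S"
  shows "supp S (matpow X (Suc k))"
proof (induction k)
  case (Suc k)
  show ?case unfolding matpow_Suc[of X "Suc k"]
    by (rule supp_mult[OF assms(1) Suc]) (use assms(2) in \<open>auto simp: add_closed_def\<close>)
qed (use assms in simp)

subsection \<open>Unipotent groups\<close>

text \<open>For an \<open>add_closed\<close> set of types these matrices form a unipotent group.\<close>

definition UT :: "(int \<times> int) set \<Rightarrow> complex^'n^'n \<Rightarrow> bool" where
  "UT S A \<longleftrightarrow> supp S (A - mat 1)"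

lemma UT_mono: "UT S A \<Longrightarrow> S \<subseteq> T \<Longrightarrow> UT T A" by (auto simp: UT_def intro: supp_mono)

lemma UT_LamT_NegT: "UT LamT A \<Longrightarrow> UT NegT A"
  by (erule UT_mono) (auto simp: LamT_def NegT_def wt_def)

lemma UT_StabT_NegT: "UT StabT A \<Longrightarrow> UT NegT A"
  by (erule UT_mono) (auto simp: StabT_def NegT_def)

lemma UT_one: "UT S (mat 1)" by (simp add: UT_def supp_0)

lemma UT_mult: "add_closed S \<Longrightarrow> UT S A \<Longrightarrow> UT S B \<Longrightarrow> UT S (A ** B)"
proof -
  assume *: "add_closed S" "UT S A" "UT S B"
  have "A ** B - mat 1 = (A - mat 1) ** (B - mat 1) + (A - mat 1) + (B - mat 1)"
    by (simp add: mat_algebra)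
  moreover have "supp S ((A - mat 1) ** (B - mat 1))"
    by (rule supp_mult[of S _ S]) (use * in \<open>auto simp: UT_def add_closed_def\<close>)
  ultimately show ?thesis using * unfolding UT_def by (simp only: supp_add)
qed

lemma UT_inv:
  assumes S: "add_closed S" and A: "UT S A"
  shows "invertible A" "UT S (matrix_inv A)"
proof -
  define Y where "Y = mat 1 - A"
  have sY: "supp S Y" using A supp_uminus[of S "A - mat 1"] by (simp add: Y_def UT_def)
  obtain m where m: "matpow Y m = 0"
    using supp_nilpotent[OF sY] S by (auto simp: add_closed_def nilpotent_def)
  define B where "B = (\<Sum>k<m. matpow Y k)"
  have "A ** B = mat 1 - matpow Y k" if "B = (\<Sum>k<k. matpow Y k)" for k B using that
  proof (induction k arbitrary: B)
    case (Suc k)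
    have "A ** B = mat 1 - matpow Y k + (mat 1 - Y) ** matpow Y k"
      using Suc.IH[OF refl] by (simp add: Suc.prems matrix_add_ldistrib) (simp add: Y_def)
    then show ?case by (simp add: mat_algebra matpow_Suc)
  qed simp
  from this[OF B_def] have AB: "A ** B = mat 1" by (simp add: m)
  show "invertible A" using invertibleI[OF AB] .
  have "B - mat 1 = (\<Sum>k\<in>{..<m} - {0}. matpow Y k)" if "m \<noteq> 0"
    unfolding B_def using that by (subst sum.remove[of _ 0]) auto
  moreover have "supp S (matpow Y k)" if "k \<noteq> 0" for k
    using supp_matpow[OF sY S, of "k - 1"] that by simp
  ultimately have "supp S (B - mat 1)" if "m \<noteq> 0" using that by (auto intro!: supp_sum)
  moreover have "supp S (B - mat 1)" if "m = 0"
  proof -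
    have "mat 1 = (0 :: complex^'n^'n)" using m that by simp
    then show ?thesis using that by (simp add: B_def supp_0)
  qed
  ultimately show "UT S (matrix_inv A)" using mat_inv_unique[OF AB] by (auto simp: UT_def)
qed

lemma UT_cnj: "UT S A \<Longrightarrow> UT (prod.swap ` S) (cnjm A)"
  using supp_cnj[of S "A - mat 1"] by (simp add: UT_def cnjm_diff)

lemma UT_blk: "UT S A \<Longrightarrow> x - y \<notin> S \<Longrightarrow> blk A x y = (if x = y then pr x else 0)"
  by (auto simp: UT_def supp_def blk_diff blk_one split: if_splits)

subsection \<open>Sums of summands\<close>

text \<open>The sum of the summands with index in \<open>S\<close>, as the common kernel of the other projections.\<close>

definition sec :: "(int \<times> int) set \<Rightarrow> (complex^'n) set" where
  "sec S = {v. \<forall>x. x \<notin> S \<longrightarrow> pr x *v v = 0}"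

lemma subspace_sec: "vec.subspace (sec S)"
  by (auto simp: vec.subspace_def sec_def algebra_simps mv_scale)

lemma vec_decomp: "v = (\<Sum>x\<in>R. pr x *v v)"
  by (simp add: sum_mat_vec[symmetric] pr_sum)

lemma pr_sec: "pr x *v v \<in> sec {x}" by (auto simp: sec_def pr_pr_vec)

lemma sec_pr: "v \<in> sec {x} \<Longrightarrow> pr x *v v = v"
proof -
  assume v: "v \<in> sec {x}"
  have "v = (\<Sum>y\<in>R. if y = x then pr x *v v else 0)"
    by (subst vec_decomp[of v], rule sum.cong) (use v in \<open>auto simp: sec_def\<close>)
  also have "\<dots> = pr x *v v" using finR by (simp add: sum.delta pr_out)
  finally show ?thesis by simp
qed

lemma sec_mono: "S \<subseteq> T \<Longrightarrow> sec S \<subseteq> sec T" by (auto simp: sec_def)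
lemma sec_Int: "sec S \<inter> sec T = sec (S \<inter> T)" by (auto simp: sec_def)
lemma sec_UNIV: "sec UNIV = UNIV" by (auto simp: sec_def)

lemma vec_eqI: "(\<And>x. pr x *v u = pr x *v v) \<Longrightarrow> u = v"
  by (subst vec_decomp[of u], subst vec_decomp[of v]) simp

lemma sec_empty: "sec {} = {0}"
  using vec_eqI[of _ 0] by (auto simp: sec_def)

lemma sec_R: "sec S = sec (S \<inter> R)"
  by (auto simp: sec_def) (metis matrix_vector_mult_0 pr_out)

lemma sum_pr_sec: "(\<Sum>x\<in>S\<inter>R. pr x *v v) \<in> sec S"
  by (intro vec.subspace_sum[OF subspace_sec]) (use pr_sec sec_mono[of "{_}" S] in blast)

lemma sec_split: "v \<in> sec (S \<union> T) \<Longrightarrow> \<exists>a\<in>sec S. v - a \<in> sec T"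
proof
  assume v: "v \<in> sec (S \<union> T)"
  let ?a = "\<Sum>x\<in>S\<inter>R. pr x *v v"
  show "?a \<in> sec S" by (rule sum_pr_sec)
  have "pr y *v ?a = (if y \<in> S then pr y *v v else 0)" for y
  proof -
    have "pr y *v ?a = (\<Sum>x\<in>S\<inter>R. if x = y then pr y *v v else 0)"
      unfolding vec.sum by (rule sum.cong) (auto simp: pr_pr_vec)
    then show ?thesis using finR by (auto simp: sum.delta pr_out)
  qed
  then show "v - ?a \<in> sec T" using v by (auto simp: sec_def algebra_simps)
qed

lemma sec_Un: "sec S + sec T = sec (S \<union> T)"
proof
  show "sec S + sec T \<subseteq> sec (S \<union> T)" by (auto simp: sec_def set_plus_def algebra_simps)
  show "sec (S \<union> T) \<subseteq> sec S + sec T"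
  proof
    fix v assume "v \<in> sec (S \<union> T)"
    then obtain a where "a \<in> sec S" "v - a \<in> sec T" using sec_split by blast
    then have "a + (v - a) \<in> sec S + sec T" by (rule set_plus_intro)
    then show "v \<in> sec S + sec T" by simp
  qed
qed

lemma pr_mult_vec: "pr x *v (A *v v) = (\<Sum>y\<in>R. blk A x y *v v)"
proof -
  have "A *v v = A *v (\<Sum>y\<in>R. pr y *v v)" by (simp flip: vec_decomp)
  then show ?thesis by (simp add: vec.sum matrix_vector_mul_assoc blk_def matrix_mul_assoc)
qed

lemma blk_vec: "v \<in> sec T \<Longrightarrow> y \<notin> T \<Longrightarrow> blk A x y *v v = 0"
  by (simp add: blk_def sec_def flip: matrix_vector_mul_assoc)

lemma supp_sec:
  assumes "supp S A" "v \<in> sec T" and "\<And>y s. y \<in> T \<Longrightarrow> s \<in> S \<Longrightarrow> y + s \<in> U"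
  shows "A *v v \<in> sec U"
  unfolding sec_def
proof (intro CollectI allI impI)
  fix x assume x: "x \<notin> U"
  have "blk A x y *v v = 0" for y
  proof (cases "y \<in> T")
    case True
    then have "x - y \<notin> S" using assms(3)[of y "x - y"] x by auto
    then have "blk A x y = 0" using assms(1) unfolding supp_def by blast
    then show ?thesis by simp
  qed (rule blk_vec[OF assms(2)])
  then show "pr x *v (A *v v) = 0" by (simp add: pr_mult_vec)
qed

lemma UT_sec_mem:
  assumes "UT S A" "v \<in> sec T" "\<And>y s. y \<in> T \<Longrightarrow> s \<in> S \<Longrightarrow> y + s \<in> T"
  shows "A *v v \<in> sec T"
proof -
  have "(A - mat 1) *v v \<in> sec T" using supp_sec assms unfolding UT_def by blast
  then have "(A - mat 1) *v v + v \<in> sec T" using vec.subspace_add[OF subspace_sec] assms(2) by blast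
  then show ?thesis by (simp add: algebra_simps)
qed

lemma UT_sec:
  assumes "add_closed S" "UT S A" "\<And>y s. y \<in> T \<Longrightarrow> s \<in> S \<Longrightarrow> y + s \<in> T"
  shows "(*v) A ` sec T = sec T"
proof
  show "(*v) A ` sec T \<subseteq> sec T" using UT_sec_mem[OF assms(2) _ assms(3)] by blast
  have "matrix_inv A *v v \<in> sec T" if "v \<in> sec T" for v
    using UT_sec_mem[OF UT_inv(2)[OF assms(1,2)] that assms(3)] .
  then show "sec T \<subseteq> (*v) A ` sec T"
    using image_mat_inv_iff[OF UT_inv(1)[OF assms(1,2)]] by blast
qed

lemma sec_image_supp:
  assumes "\<And>v y. v \<in> sec {y} \<Longrightarrow> A *v v \<in> sec {x. x - y \<in> S}"
  shows "supp S A"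
  unfolding supp_def
proof (intro allI impI)
  fix x y assume "blk A x y \<noteq> 0"
  then obtain v where "blk A x y *v v \<noteq> 0" using matrix_eq[of "blk A x y" 0] by auto
  then have *: "pr x *v (A *v (pr y *v v)) \<noteq> 0" by (simp add: blk_def matrix_vector_mul_assoc matrix_mul_assoc)
  have "A *v (pr y *v v) \<in> sec {x. x - y \<in> S}" using assms pr_sec by blast
  with * show "x - y \<in> S" by (auto simp: sec_def)
qed

lemma cnjv_sec: "cnjv ` sec S = sec (prod.swap ` S)"
proof -
  have mem: "cnjv v \<in> sec T \<longleftrightarrow> v \<in> sec (prod.swap ` T)" for v T
  proof -
    have "pr x *v cnjv v = cnjv (pr (prod.swap x) *v v)" for x by (simp add: cnjv_mv cnjm_pr)
    moreover have "cnjv u = 0 \<longleftrightarrow> u = 0" for u :: "complex^'n" by (metis cnjv_0 cnjv_cnjv)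
    ultimately have "cnjv v \<in> sec T \<longleftrightarrow> (\<forall>x. x \<notin> T \<longrightarrow> pr (prod.swap x) *v v = 0)" by (simp add: sec_def)
    also have "\<dots> \<longleftrightarrow> (\<forall>x. x \<notin> prod.swap ` T \<longrightarrow> pr x *v v = 0)"
      by (metis (no_types, opaque_lifting) image_iff swap_swap)
    finally show ?thesis by (simp add: sec_def)
  qed
  show ?thesis using mem cnjv_image_iff by blast
qed

lemma dim_sec_Un: "S \<inter> T = {} \<Longrightarrow> vec.dim (sec (S \<union> T)) = vec.dim (sec S) + vec.dim (sec T)"
proof -
  assume "S \<inter> T = {}"
  then have "sec S \<inter> sec T = {0}" by (simp add: sec_Int sec_empty)
  moreover have "{x + y |x y. x \<in> sec S \<and> y \<in> sec T} = sec (S \<union> T)"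
    unfolding sec_Un[symmetric] set_plus_def by auto
  ultimately show ?thesis using vec.dim_sums_Int[OF subspace_sec subspace_sec, of S T] by simp
qed

lemma dim_sec: "vec.dim (sec S) = (\<Sum>x\<in>S\<inter>R. vec.dim (sec {x}))"
proof -
  have "vec.dim (sec A) = (\<Sum>x\<in>A. vec.dim (sec {x}))" if "finite A" for A using that
  proof (induction A rule: finite_induct)
    case (insert x A)
    then show ?case using dim_sec_Un[of "{x}" A] by simp
  qed (simp add: sec_empty)
  from this[of "S \<inter> R"] show ?thesis using finR by (subst sec_R) simp
qed

end

lemma setplusE: "v \<in> A + B \<Longrightarrow> (\<And>a b. a \<in> A \<Longrightarrow> b \<in> B \<Longrightarrow> v = a + b \<Longrightarrow> thesis) \<Longrightarrow> thesis"
  by (auto simp: set_plus_def)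

lemma image_set_plus: "(*v) (g::complex^'n^'n) ` (A + B) = (*v) g ` A + (*v) g ` B"
proof
  show "(*v) g ` (A + B) \<subseteq> (*v) g ` A + (*v) g ` B"
    by (auto elim!: setplusE simp: matrix_vector_right_distrib intro!: set_plus_intro)
  show "(*v) g ` A + (*v) g ` B \<subseteq> (*v) g ` (A + B)"
    by (auto elim!: setplusE simp: matrix_vector_right_distrib[symmetric] intro!: imageI set_plus_intro)
qed

context bigraded_frame
begin

section \<open>The grading of a mixed Hodge structure\<close>

text \<open>The Hodge filtration, the weight filtration and the grading of the frame.\<close>

definition HF :: "'n filtration" where "HF p = sec {x. p \<le> fst x}"
definition HW :: "'n filtration" where "HW k = sec {x. wt x \<le> k}"
definition YR :: "complex^'n^'n" where "YR = (\<Sum>x\<in>R. mat (of_int (wt x)) ** pr x)"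

lemma subspace_HF: "vec.subspace (HF p)" and subspace_HW: "vec.subspace (HW k)"
  by (simp_all add: HF_def HW_def subspace_sec)

lemma YR_sec: "v \<in> sec {x} \<Longrightarrow> YR *v v = of_int (wt x) *s v"
proof -
  assume v: "v \<in> sec {x}"
  have "YR *v v = (\<Sum>y\<in>R. if y = x then of_int (wt x) *s v else 0)"
    unfolding YR_def sum_mat_vec
    by (rule sum.cong) (use v sec_pr[OF v] in \<open>auto simp: mat_scalar_vec sec_def\<close>)
  also have "\<dots> = of_int (wt x) *s v"
    using finR sec_pr[OF v] pr_out[of x] by (cases "x \<in> R") (auto simp: sum.delta)
  finally show ?thesis .
qed

lemma image_HW: "UT NegT g \<Longrightarrow> (*v) g ` HW k = HW k"
  unfolding HW_def by (rule UT_sec[OF add_closed_types(1)]) (auto simp: NegT_def)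

lemma image_HF: "UT StabT g \<Longrightarrow> (*v) g ` HF p = HF p"
  unfolding HF_def by (rule UT_sec[OF add_closed_types(2)]) (auto simp: StabT_def)

text \<open>Let \<open>v\<close> lie in \<open>I\<^sup>p\<^sup>,\<^sup>q\<close>. The conjugation condition writes \<open>conj v\<close> by components \<open>I\<^sup>q\<^sup>,\<^sup>p\<close> and \<open>I\<^sup>r\<^sup>,\<^sup>s\<close> with \<open>s < p\<close>.
  As these lie in steps of \<open>F\<close> and \<open>W\<close>, the components of \<open>v\<close> in the frame have first index less than
  \<open>p\<close>, except for the one of index \<open>(p, q)\<close>. But \<open>v\<close> belongs to \<open>F\<^sup>p\<close>. This is Deligne's formula for
  \<open>I\<^sup>p\<^sup>,\<^sup>q\<close> by \<open>F\<close>, \<open>W\<close> and their conjugates.\<close>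

lemma deligne_bigrading_unique:
  assumes G: "invertible G" and lam: "UT LamT (matrix_inv G ** cnjm G)"
    and D: "deligne_bigrading F W I"
    and F: "\<And>p. F p = (*v) G ` HF p" and W: "\<And>k. W k = (*v) G ` HW k"
  shows "I p q \<subseteq> (*v) G ` sec {(p, q)}"
proof
  fix v assume v: "v \<in> I p q"
  have DF: "F a = vec.span (\<Union>{I a' b | a' b. a \<le> a'})" and DW: "W k = vec.span (\<Union>{I a b | a b. a + b \<le> k})"
    and DC: "cnjv ` I a b + vec.span (\<Union>{I r s | r s. r < b \<and> s < a}) =
            I b a + vec.span (\<Union>{I r s | r s. r < b \<and> s < a})" for a b k
    using D by (auto simp: deligne_bigrading_def)
  have IF: "I a b \<subseteq> F a" and IW: "I a b \<subseteq> W (a + b)" for a b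
    unfolding DF DW by (rule order.trans[OF _ vec.span_superset], blast)+
  have loc: "I r s \<subseteq> (*v) G ` sec {x. r \<le> fst x \<and> wt x \<le> r + s}" for r s
  proof
    fix w assume "w \<in> I r s"
    then have "w \<in> (*v) G ` HF r" "w \<in> (*v) G ` HW (r + s)" using IF IW F W by blast+
    then have "matrix_inv G *v w \<in> sec {x. r \<le> fst x} \<inter> sec {x. wt x \<le> r + s}"
      by (simp add: image_mat_inv_iff[OF G] HF_def HW_def)
    then show "w \<in> (*v) G ` sec {x. r \<le> fst x \<and> wt x \<le> r + s}"
      unfolding image_mat_inv_iff[OF G] sec_Int by (simp add: Collect_conj_eq)
  qed
  define T where "T = insert (q, p) {x. snd x < p}"
  define D' where "D' = vec.span (\<Union>{I r s | r s. r < q \<and> s < p})"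
  have "\<Union>{I r s | r s. r < q \<and> s < p} \<subseteq> (*v) G ` sec T"
  proof (clarify)
    fix w r s assume "w \<in> I r s" "s < p"
    then show "w \<in> (*v) G ` sec T"
      using loc[of r s] sec_mono[of "{x. r \<le> fst x \<and> wt x \<le> r + s}" T] by (force simp: T_def wt_def)
  qed
  then have D'T: "D' \<subseteq> (*v) G ` sec T"
    unfolding D'_def by (rule vec.span_minimal) (rule subspace_mv_image[OF subspace_sec])
  have "{x. q \<le> fst x \<and> wt x \<le> q + p} \<subseteq> T" by (auto simp: T_def wt_def)
  then have IT: "I q p \<subseteq> (*v) G ` sec T" using loc[of q p] sec_mono by blast
  have "cnjv v + 0 \<in> cnjv ` I p q + D'"
    using v by (intro set_plus_intro) (auto simp: D'_def vec.span_zero)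
  then have "cnjv v \<in> I q p + D'" using DC[of p q] by (simp add: D'_def)
  then obtain a b where ab: "a \<in> I q p" "b \<in> D'" "cnjv v = a + b" by (rule setplusE)
  then have "a \<in> (*v) G ` sec T" "b \<in> (*v) G ` sec T" using IT D'T by blast+
  then have "cnjv v \<in> (*v) G ` sec T"
    unfolding ab(3) by (rule vec.subspace_add[OF subspace_mv_image[OF subspace_sec]])
  then have "matrix_inv G *v cnjv v \<in> sec T" by (simp add: image_mat_inv_iff[OF G])
  then have c: "cnjv (matrix_inv G *v cnjv v) \<in> sec (insert (p, q) {x. fst x < p})"
  proof -
    have "prod.swap ` T = insert (p, q) {x. fst x < p}" by (auto simp: T_def swap_image prod_eq_iff)
    moreover have "cnjv (matrix_inv G *v cnjv v) \<in> cnjv ` sec T"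
      using \<open>matrix_inv G *v cnjv v \<in> sec T\<close> by (rule imageI)
    ultimately show ?thesis by (simp only: cnjv_sec)
  qed
  have "matrix_inv G *v v = (matrix_inv G ** cnjm G) *v cnjv (matrix_inv G *v cnjv v)"
    by (simp add: cnjv_mv cnjm_inv[OF G] matrix_vector_mul_assoc
        mat_inv_right'[OF invertible_cnjm[OF G]])
  also have "\<dots> \<in> sec (insert (p, q) {x. fst x < p})"
    by (rule UT_sec_mem[OF lam c]) (auto simp: LamT_def)
  finally have "matrix_inv G *v v \<in> sec (insert (p, q) {x. fst x < p})" .
  moreover have "matrix_inv G *v v \<in> sec {x. p \<le> fst x \<and> wt x \<le> p + q}"
    using loc[of p q] v image_mat_inv_iff[OF G] by blast
  ultimately have "matrix_inv G *v v \<in> sec (insert (p, q) {x. fst x < p} \<inter> {x. p \<le> fst x \<and> wt x \<le> p + q})"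
    unfolding sec_Int[symmetric] by blast
  also have "insert (p, q) {x. fst x < p} \<inter> {x. p \<le> fst x \<and> wt x \<le> p + q} = {(p, q)}" by auto
  finally show "v \<in> (*v) G ` sec {(p, q)}" by (simp add: image_mat_inv_iff[OF G])
qed

lemma span_image_sec:
  fixes G :: "complex^'n^'n"
  shows "vec.span (\<Union>{(*v) G ` sec {(a, b)} | a b. Q a b}) = (*v) G ` sec {x. Q (fst x) (snd x)}"
proof
  show "vec.span (\<Union>{(*v) G ` sec {(a, b)} | a b. Q a b}) \<subseteq> (*v) G ` sec {x. Q (fst x) (snd x)}"
  proof (rule vec.span_minimal)
    show "\<Union>{(*v) G ` sec {(a, b)} | a b. Q a b} \<subseteq> (*v) G ` sec {x. Q (fst x) (snd x)}"
    proof (intro Union_least, elim CollectE exE conjE, hypsubst)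
      fix a b assume "Q a b"
      then show "(*v) G ` sec {(a, b)} \<subseteq> (*v) G ` sec {x. Q (fst x) (snd x)}"
        by (intro image_mono sec_mono) simp
    qed
  qed (rule subspace_mv_image[OF subspace_sec])
  show "(*v) G ` sec {x. Q (fst x) (snd x)} \<subseteq> vec.span (\<Union>{(*v) G ` sec {(a, b)} | a b. Q a b})"
  proof clarify
    fix v assume v: "v \<in> sec {x. Q (fst x) (snd x)}"
    have "G *v v = G *v (\<Sum>x\<in>R. pr x *v v)" by (simp flip: vec_decomp)
    also have "\<dots> = (\<Sum>x\<in>R. G *v (pr x *v v))" by (simp add: vec.sum)
    also have "\<dots> \<in> vec.span (\<Union>{(*v) G ` sec {(a, b)} | a b. Q a b})"
    proof (rule vec.span_sum)
      fix x
      show "G *v (pr x *v v) \<in> vec.span (\<Union>{(*v) G ` sec {(a, b)} | a b. Q a b})"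
      proof (cases "Q (fst x) (snd x)")
        case True
        then have "G *v (pr x *v v) \<in> \<Union>{(*v) G ` sec {(a, b)} | a b. Q a b}"
          using pr_sec[of x v] by (intro UnionI[of "(*v) G ` sec {(fst x, snd x)}"] CollectI exI conjI refl) simp_all
        then show ?thesis by (rule vec.span_base)
      next
        case False
        then have "pr x *v v = 0" using v by (auto simp: sec_def)
        then show ?thesis by (simp add: vec.span_zero)
      qed
    qed
    finally show "G *v v \<in> vec.span (\<Union>{(*v) G ` sec {(a, b)} | a b. Q a b})" .
  qed
qed

lemma bigrading_frame:
  fixes G :: "complex^'n^'n"
  assumes G: "invertible G"
  shows "bigrading (\<lambda>p q. (*v) G ` sec {(p, q)})"
proof -
  define S where "S = {(p, q). (*v) G ` sec {(p, q)} \<noteq> {0}}"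
  have SR: "S \<subseteq> R"
  proof (rule subsetI, rule ccontr)
    fix x assume x: "x \<in> S" "x \<notin> R"
    obtain p q where pq: "x = (p, q)" by (cases x)
    have "sec {x} = {0}" using x(2) sec_R[of "{x}"] sec_empty by simp
    then show False using x(1) by (simp add: S_def pq)
  qed
  then have finS: "finite S" using finR by (rule finite_subset)
  have Sout: "w = 0" if "w \<in> (*v) G ` sec {x}" "x \<notin> S" for w x
    using that by (cases x) (auto simp: S_def)
  have "\<exists>!c. (\<forall>p q. c (p, q) \<in> (*v) G ` sec {(p, q)}) \<and> v = (\<Sum>x\<in>S. c x)" for v
  proof (rule ex1I)
    let ?c = "\<lambda>x. G *v (pr x *v (matrix_inv G *v v))"
    have mem: "?c x \<in> (*v) G ` sec {x}" for x using pr_sec by blast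
    have "v = G *v (\<Sum>x\<in>R. pr x *v (matrix_inv G *v v))"
      by (simp add: mat_inv_vec[OF G] flip: vec_decomp)
    also have "\<dots> = (\<Sum>x\<in>R. ?c x)" by (simp add: vec.sum)
    also have "\<dots> = (\<Sum>x\<in>S. ?c x)"
      using finR SR Sout[OF mem] by (intro sum.mono_neutral_right ballI) blast+
    finally show "(\<forall>p q. ?c (p, q) \<in> (*v) G ` sec {(p, q)}) \<and> v = (\<Sum>x\<in>S. ?c x)" using mem by blast
    fix c assume c: "(\<forall>p q. c (p, q) \<in> (*v) G ` sec {(p, q)}) \<and> v = (\<Sum>x\<in>S. c x)"
    then have cm: "c x \<in> (*v) G ` sec {x}" for x by (cases x) auto
    then have ci: "matrix_inv G *v c x \<in> sec {x}" for x by (simp add: image_mat_inv_iff[OF G])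
    show "c = ?c"
    proof
      fix x
      have "pr x *v (matrix_inv G *v v) = (\<Sum>y\<in>S. pr x *v (matrix_inv G *v c y))"
        using c by (simp add: vec.sum)
      also have "\<dots> = (\<Sum>y\<in>S. if y = x then matrix_inv G *v c x else 0)"
      proof (rule sum.cong)
        fix y show "pr x *v (matrix_inv G *v c y) = (if y = x then matrix_inv G *v c x else 0)"
          using ci[of y] sec_pr[OF ci[of x]] by (auto simp: sec_def)
      qed simp
      also have "\<dots> = matrix_inv G *v c x"
        using Sout[OF cm[of x]] finS by (auto simp: sum.delta)
      finally show "c x = ?c x" by (simp add: mat_inv_vec[OF G])
    qed
  qed
  then show ?thesis
    unfolding bigrading_def using finS subspace_mv_image[OF subspace_sec] unfolding S_def by blast
qed

lemma deligne_bigrading_frame: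
  assumes G: "invertible G" and lam: "UT LamT (matrix_inv G ** cnjm G)"
    and F: "\<And>p. F p = (*v) G ` HF p" and W: "\<And>k. W k = (*v) G ` HW k"
  shows "deligne_bigrading F W (\<lambda>p q. (*v) G ` sec {(p, q)})"
proof -
  define lm where "lm = matrix_inv G ** cnjm G"
  have cG: "cnjv (G *v v) = G *v (lm *v cnjv v)" for v
    by (simp add: lm_def cnjv_mv matrix_vector_mul_assoc matrix_mul_assoc mat_inv_right[OF G])
  have lmi: "invertible lm" using UT_inv[OF add_closed_types(3)] lam by (simp add: lm_def)
  have conj: "cnjv ` ((*v) G ` sec {(p, q)}) + (*v) G ` sec {x. fst x < q \<and> snd x < p} =
     (*v) G ` sec (insert (q, p) {x. fst x < q \<and> snd x < p})" (is "?A + (*v) G ` sec ?D = (*v) G ` sec ?T") for p q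
  proof
    have lmT: "lm *v w \<in> sec ?T" if "w \<in> sec ?T" for w
      using that by (rule UT_sec_mem[OF lam[folded lm_def]]) (auto simp: LamT_def)
    have lmiT: "matrix_inv lm *v w \<in> sec ?T" if "w \<in> sec ?T" for w
      using that UT_inv(2)[OF add_closed_types(3)] lam[folded lm_def]
      by (rule_tac UT_sec_mem[of LamT]) (auto simp: LamT_def)
    have cq: "cnjv w \<in> sec {(q, p)}" if "w \<in> sec {(p, q)}" for w
      using that cnjv_sec[of "{(p, q)}"] by auto
    have sub: "vec.subspace ((*v) G ` sec ?T)" by (rule subspace_mv_image[OF subspace_sec])
    have "?A \<subseteq> (*v) G ` sec ?T"
    proof clarify
      fix w assume "w \<in> sec {(p, q)}"
      then have "cnjv w \<in> sec ?T" using cq sec_mono[of "{(q, p)}" ?T] by blast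
      then show "cnjv (G *v w) \<in> (*v) G ` sec ?T" unfolding cG by (intro imageI lmT)
    qed
    moreover have "(*v) G ` sec ?D \<subseteq> (*v) G ` sec ?T" using sec_mono[of ?D ?T] by blast
    ultimately show "?A + (*v) G ` sec ?D \<subseteq> (*v) G ` sec ?T"
      using vec.subspace_add[OF sub] by (intro subsetI) (elim setplusE, blast)
    show "(*v) G ` sec ?T \<subseteq> ?A + (*v) G ` sec ?D"
    proof clarify
      fix w assume "w \<in> sec ?T"
      then have "w \<in> sec ({(q, p)} \<union> ?D)" by simp
      then obtain a where a: "a \<in> sec {(q, p)}" "w - a \<in> sec ?D" using sec_split by blast
      have ca: "cnjv a \<in> sec {(p, q)}" using a(1) cnjv_sec[of "{(q, p)}"] by auto
      have "(lm - mat 1) *v a \<in> sec ?D"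
        using lam a(1) unfolding UT_def lm_def[symmetric] by (rule supp_sec) (auto simp: LamT_def)
      then have "w - a - (lm - mat 1) *v a \<in> sec ?D" using a(2) vec.subspace_diff[OF subspace_sec] by blast
      then have d: "w - lm *v a \<in> sec ?D" by (simp add: algebra_simps)
      have "G *v w = cnjv (G *v cnjv a) + G *v (w - lm *v a)" by (simp add: cG algebra_simps)
      then show "G *v w \<in> ?A + (*v) G ` sec ?D" using ca d by (simp add: set_plus_intro)
    qed
  qed
  have Ieq: "(*v) G ` sec {(q, p)} + (*v) G ` sec {x. fst x < q \<and> snd x < p} =
     (*v) G ` sec (insert (q, p) {x. fst x < q \<and> snd x < p})" (is "_ + (*v) G ` sec ?D = _") for p q
    by (simp add: sec_Un flip: image_set_plus)
  show ?thesis
    unfolding deligne_bigrading_def span_image_sec F W HF_def HW_def wt_def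
    using bigrading_frame[OF G] conj Ieq by (intro conjI allI) simp_all
qed

text \<open>A second bigrading as in the definition of \<open>mhs_grading\<close> has its summands inside those of the first,
  so that the two gradings agree on a spanning set.\<close>

theorem mhs_grading_frame:
  assumes G: "invertible G" and lam: "UT LamT (matrix_inv G ** cnjm G)"
    and F: "\<And>p. F p = (*v) G ` HF p" and W: "\<And>k. W k = (*v) G ` HW k"
  shows "mhs_grading F W = G ** YR ** matrix_inv G"
  unfolding mhs_grading_def
proof (rule the_equality)
  define Y where "Y = G ** YR ** matrix_inv G"
  have Y: "Y *v v = of_int (p + q) *s v" if "v \<in> (*v) G ` sec {(p, q)}" for v p q
  proof -
    have "YR *v (matrix_inv G *v v) = of_int (wt (p, q)) *s (matrix_inv G *v v)"
      using that by (intro YR_sec) (simp add: image_mat_inv_iff[OF G])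
    then have "G *v (YR *v (matrix_inv G *v v)) = of_int (p + q) *s v"
      by (simp only: mv_scale mat_inv_vec[OF G] wt_simps)
    then show ?thesis by (simp add: Y_def matrix_vector_mul_assoc matrix_mul_assoc)
  qed
  show "\<exists>I. deligne_bigrading F W I \<and> (\<forall>p q. \<forall>v\<in>I p q. G ** YR ** matrix_inv G *v v = of_int (p + q) *s v)"
    using deligne_bigrading_frame[OF assms] Y unfolding Y_def by blast
  fix Y' assume "\<exists>I. deligne_bigrading F W I \<and> (\<forall>p q. \<forall>v\<in>I p q. Y' *v v = of_int (p + q) *s v)"
  then obtain I where I: "deligne_bigrading F W I" "\<And>p q v. v \<in> I p q \<Longrightarrow> Y' *v v = of_int (p + q) *s v" by blast
  have eq: "Y' *v v = Y *v v" if "v \<in> I p q" for v p q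
  proof -
    have "v \<in> (*v) G ` sec {(p, q)}"
      using deligne_bigrading_unique[OF assms(1,2) I(1) F W, of p q] that by blast
    then show ?thesis using I(2)[OF that] Y[of v p q] by (simp only:)
  qed
  have "Y' *v v = Y *v v" for v
  proof -
    have "\<exists>!c. (\<forall>p q. c (p, q) \<in> I p q) \<and> v = (\<Sum>x \<in> {(p, q). I p q \<noteq> {0}}. c x)"
      using I(1) unfolding deligne_bigrading_def bigrading_def by (elim conjE) (erule allE)
    then obtain c where c: "\<And>p q. c (p, q) \<in> I p q" "v = (\<Sum>x \<in> {(p, q). I p q \<noteq> {0}}. c x)"
      by (elim ex1E conjE) blast
    have "Y' *v c x = Y *v c x" for x using eq c(1) by (cases x) blast
    then show ?thesis unfolding c(2) by (simp add: vec.sum)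
  qed
  then show "Y' = G ** YR ** matrix_inv G" unfolding Y_def[symmetric] by (simp add: matrix_eq)
qed

section \<open>Existence of the Deligne splitting\<close>

text \<open>One step of the construction of the splitting. The degree \<open>-d\<close> part of \<open>X\<close> with types in \<open>StabT\<close>
  is removed by \<open>Z\<close>. The equation \<open>(1 + X) conj(1 + X) = 1\<close> makes the part of the conjugate
  types its negative conjugate, so that \<open>conj Z\<close> removes this part at the same time.\<close>

lemma splitting_step:
  assumes d: "1 \<le> d" and X: "supp (LamT \<union> {t. wt t \<le> - d}) X"
    and inv: "(mat 1 + X) ** cnjm (mat 1 + X) = mat 1"
  shows "\<exists>Z. supp StabT Z \<and>
    supp (LamT \<union> {t. wt t \<le> - d - 1}) (matrix_inv (mat 1 + Z) ** (mat 1 + X) ** cnjm (mat 1 + Z) - mat 1)"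
proof -
  define S where "S = StabT \<inter> {t. wt t = - d}"
  define Z where "Z = part S X"
  have sZ: "supp S Z" by (simp add: Z_def supp_part)
  have sZ': "supp StabT Z" using sZ by (rule supp_mono) (simp add: S_def)
  have UZ: "UT StabT (mat 1 + Z)" using sZ' by (simp add: UT_def)
  define V where "V = matrix_inv (mat 1 + Z) - mat 1"
  have sV: "supp NegT V"
    using UT_inv(2)[OF add_closed_types(2) UZ] by (auto simp: UT_def V_def StabT_def NegT_def intro: supp_mono)
  have "mat 1 + (V + Z + V ** Z) = (mat 1 + V) ** (mat 1 + Z)" by (simp add: mat_algebra)
  also have "\<dots> = mat 1" using UT_inv(1)[OF add_closed_types(2) UZ] mat_inv_left by (simp add: V_def)
  finally have "V + Z + V ** Z = 0" by (simp only: add_cancel_left_right)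
  then have VZ: "V + Z = - (V ** Z)" by (simp only: eq_neg_iff_add_eq_0)
  let ?L = "{t. wt t \<le> - d - 1}" and ?D = "{t. wt t \<le> - d}"
  have "supp ?L (V ** Z)" by (rule supp_mult[OF sV sZ]) (auto simp: NegT_def S_def)
  then have sVZ: "supp ?L (V + Z)" unfolding VZ by (rule supp_uminus)
  have sX: "supp NegT X" using X by (rule supp_mono) (use d in \<open>auto simp: LamT_def NegT_def wt_def\<close>)
  have sVd: "supp ?D V"
  proof -
    have "supp ?D (V + Z)" "supp ?D Z" using sVZ sZ by (auto intro: supp_mono simp: S_def)
    then have "supp ?D (V + Z - Z)" by (rule supp_diff)
    then show ?thesis by simp
  qed
  have sCZ: "supp ?D (cnjm Z)" using supp_cnj[OF sZ] by (rule supp_mono) (auto simp: S_def)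
  have "supp ?L (V ** X)" by (rule supp_mult[OF sVd sX]) (auto simp: NegT_def)
  moreover have "supp ?L (V ** cnjm Z)"
    by (rule supp_mult[OF sV sCZ]) (auto simp: NegT_def)
  moreover have "supp ?L (X ** cnjm Z)" by (rule supp_mult[OF sX sCZ]) (auto simp: NegT_def)
  moreover have "supp ?L (V ** X ** cnjm Z)"
    by (rule supp_mult[OF calculation(1) sCZ]) (use d in auto)
  ultimately have rest: "supp ?L (V + Z + V ** X + V ** cnjm Z + X ** cnjm Z + V ** X ** cnjm Z)"
    by (intro supp_add sVZ)
  have inv': "X + cnjm X + X ** cnjm X = 0"
  proof -
    have "mat 1 + (X + cnjm X + X ** cnjm X) = (mat 1 + X) ** cnjm (mat 1 + X)"
      by (simp add: cnjm_add mat_algebra)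
    then show ?thesis unfolding inv by (simp only: add_cancel_left_right)
  qed
  have sCX: "supp (LamT \<union> ?D) (cnjm X)"
    using supp_cnj[OF X] by (rule supp_mono) (auto simp: LamT_def)
  have "supp (LamT \<union> ?L) (X ** cnjm X)"
    by (rule supp_mult[OF X sCX]) (use d in \<open>auto simp: LamT_def wt_def\<close>)
  then have XC: "blk (X + cnjm X) x y = 0" if "x - y \<notin> LamT \<union> ?L" for x y
  proof -
    have "blk (X ** cnjm X) x y = 0" using \<open>supp (LamT \<union> ?L) (X ** cnjm X)\<close> that unfolding supp_def by blast
    moreover have "blk (X + cnjm X + X ** cnjm X) x y = 0" by (simp add: inv')
    ultimately show ?thesis by (simp add: blk_add)
  qed
  have "supp (LamT \<union> ?L) (X - Z + cnjm Z)"
    unfolding supp_def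
  proof (intro allI impI, rule ccontr)
    fix x y assume nz: "blk (X - Z + cnjm Z) x y \<noteq> 0" and t: "x - y \<notin> LamT \<union> ?L"
    have CZ: "blk (cnjm Z) x y = (if prod.swap (x - y) \<in> S then blk (cnjm X) x y else 0)"
      by (simp add: Z_def blk_cnj blk_part swap_diff)
    have BZ: "blk Z x y = (if x - y \<in> S then blk X x y else 0)" by (simp add: Z_def blk_part)
    show False
    proof (cases "wt (x - y) = - d")
      case False
      then have "x - y \<notin> LamT \<union> ?D" using t by auto
      then have "blk X x y = 0" using X unfolding supp_def by blast
      then show False using nz False by (simp add: blk_add blk_diff CZ BZ S_def)
    next
      case True
      then have "x - y \<in> StabT \<or> prod.swap (x - y) \<in> StabT" and
        "\<not> (x - y \<in> StabT \<and> prod.swap (x - y) \<in> StabT)"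
        using t d by (auto simp: LamT_def StabT_def) (auto simp: wt_def)
      then show False using nz True XC[OF t] by (auto simp: blk_add blk_diff CZ BZ S_def)
    qed
  qed
  moreover have "matrix_inv (mat 1 + Z) ** (mat 1 + X) ** cnjm (mat 1 + Z) - mat 1
     = (X - Z + cnjm Z) + (V + Z + V ** X + V ** cnjm Z + X ** cnjm Z + V ** X ** cnjm Z)"
  proof -
    have "matrix_inv (mat 1 + Z) = mat 1 + V" by (simp add: V_def)
    then show ?thesis by (simp add: mat_algebra cnjm_add)
  qed
  ultimately show ?thesis
    using sZ' supp_add[OF _ supp_mono[OF rest, of "LamT \<union> ?L"]] by (intro exI[of _ Z]) (simp only: Un_upper2 simp_thms)
qed

text \<open>The factor \<open>h\<close> preserves the filtration \<open>G HF\<close>. So among the bigradings adapted to \<open>G HF\<close> there is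
  one that satisfies Deligne's conjugation condition.\<close>

theorem deligne_splitting:
  assumes G: "invertible G" and a: "UT NegT (matrix_inv G ** cnjm G)"
  shows "\<exists>h. UT StabT h \<and> UT LamT (matrix_inv (G ** h) ** cnjm (G ** h))"
proof -
  have step: "\<exists>h. UT StabT h \<and> supp (LamT \<union> {t. wt t \<le> - int (Suc d)}) (matrix_inv (G ** h) ** cnjm (G ** h) - mat 1)" for d
  proof (induction d)
    case 0
    have "supp (LamT \<union> {t. wt t \<le> - int (Suc 0)}) (matrix_inv (G ** mat 1) ** cnjm (G ** mat 1) - mat 1)"
      using a by (auto simp: UT_def NegT_def intro: supp_mono)
    then show ?case using UT_one by blast
  next
    case (Suc d)
    then obtain h where h: "UT StabT h"
      "supp (LamT \<union> {t. wt t \<le> - int (Suc d)}) (matrix_inv (G ** h) ** cnjm (G ** h) - mat 1)" by blast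
    define H where "H = G ** h"
    define X where "X = matrix_inv H ** cnjm H - mat 1"
    have iH: "invertible H" unfolding H_def using G UT_inv(1)[OF add_closed_types(2) h(1)] by (rule invertible_mult)
    have X1: "mat 1 + X = matrix_inv H ** cnjm H" by (simp add: X_def)
    have "matrix_inv H ** cnjm H ** (matrix_inv (cnjm H) ** H) = mat 1"
      by (simp add: matrix_mul_assoc mat_inv_right'[OF invertible_cnjm[OF iH]] mat_inv_left[OF iH])
    then have "(mat 1 + X) ** cnjm (mat 1 + X) = mat 1"
      unfolding X1 cnjm_mult cnjm_inv[OF iH] cnjm_cnjm .
    then obtain Z where Z: "supp StabT Z"
      "supp (LamT \<union> {t. wt t \<le> - int (Suc d) - 1}) (matrix_inv (mat 1 + Z) ** (mat 1 + X) ** cnjm (mat 1 + Z) - mat 1)"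
      using splitting_step[of "int (Suc d)" X] h(2) unfolding X_def H_def by auto
    have UZ: "UT StabT (mat 1 + Z)" using Z(1) by (simp add: UT_def)
    have "matrix_inv (G ** (h ** (mat 1 + Z))) ** cnjm (G ** (h ** (mat 1 + Z)))
      = matrix_inv (mat 1 + Z) ** (mat 1 + X) ** cnjm (mat 1 + Z)"
      unfolding X1 matrix_mul_assoc H_def[symmetric] mat_inv_mult[OF iH UT_inv(1)[OF add_closed_types(2) UZ]] cnjm_mult ..
    then show ?case using Z(2) UT_mult[OF add_closed_types(2) h(1) UZ]
      by (intro exI[of _ "h ** (mat 1 + Z)"]) (simp add: algebra_simps)
  qed
  obtain m where m: "\<forall>x\<in>R. \<forall>y\<in>R. wt y - wt x < int m" using wt_bounded by blast
  obtain h where h: "UT StabT h" "supp (LamT \<union> {t. wt t \<le> - int (Suc m)}) (matrix_inv (G ** h) ** cnjm (G ** h) - mat 1)"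
    using step by blast
  have "supp LamT (matrix_inv (G ** h) ** cnjm (G ** h) - mat 1)"
    unfolding supp_def
  proof (intro allI impI)
    fix x y assume nz: "blk (matrix_inv (G ** h) ** cnjm (G ** h) - mat 1) x y \<noteq> 0"
    then have "x \<in> R" "y \<in> R" using blk_out by blast+
    then have "wt y - wt x < int m" using m by blast
    moreover have "x - y \<in> LamT \<union> {t. wt t \<le> - int (Suc m)}" using h(2) nz unfolding supp_def by blast
    ultimately show "x - y \<in> LamT" by auto
  qed
  then show ?thesis using h(1) by (auto simp: UT_def)
qed

end

section \<open>Projections\<close>

definition complementary :: "(complex^'n) set \<Rightarrow> (complex^'n) set \<Rightarrow> bool" where
  "complementary A B \<longleftrightarrow> vec.subspace A \<and> vec.subspace B \<and> A \<inter> B = {0} \<and> (\<forall>v. \<exists>a\<in>A. v - a \<in> B)"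

definition proj :: "(complex^'n) set \<Rightarrow> (complex^'n) set \<Rightarrow> complex^'n^'n" where
  "proj A B = (SOME E. \<forall>v. E *v v \<in> A \<and> v - E *v v \<in> B)"

lemma complementary_unique:
  assumes "complementary A B" "a \<in> A" "v - a \<in> B" "a' \<in> A" "v - a' \<in> B"
  shows "a = a'"
proof -
  have "a - a' \<in> A" using assms by (auto simp: complementary_def vec.subspace_diff)
  moreover have "(v - a') - (v - a) \<in> B"
    using assms unfolding complementary_def by (blast intro: vec.subspace_diff)
  ultimately have "a - a' \<in> A \<inter> B" by simp
  then have "a - a' = 0" using assms(1) unfolding complementary_def by blast
  then show ?thesis by simp
qed

lemma complementary_Int: "complementary A B \<Longrightarrow> v \<in> A \<Longrightarrow> v \<in> B \<Longrightarrow> v = 0"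
  unfolding complementary_def by blast

lemma
  assumes c: "complementary A B"
  shows proj_in: "proj A B *v v \<in> A" and proj_diff: "v - proj A B *v v \<in> B"
proof -
  have sA: "vec.subspace A" and sB: "vec.subspace B" using c by (auto simp: complementary_def)
  have "\<forall>v. \<exists>a. a \<in> A \<and> v - a \<in> B" using c unfolding complementary_def by blast
  then obtain f where f: "\<And>v. f v \<in> A" "\<And>v. v - f v \<in> B" by metis
  have lin: "Vector_Spaces.linear (*s) (*s) f"
    unfolding Vector_Spaces.linear_iff
  proof (intro conjI allI)
    show "f (u + v) = f u + f v" for u v
    proof (rule complementary_unique[OF c f(1) f(2)])
      show "f u + f v \<in> A" using f(1) vec.subspace_add[OF sA] by blast
      have "(u - f u) + (v - f v) \<in> B" using f(2) vec.subspace_add[OF sB] by blast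
      then show "u + v - (f u + f v) \<in> B" by (simp add: algebra_simps)
    qed
    show "f (r *s u) = r *s f u" for r u
    proof (rule complementary_unique[OF c f(1) f(2)])
      show "r *s f u \<in> A" using f(1) vec.subspace_scale[OF sA] by blast
      have "r *s (u - f u) \<in> B" using f(2) vec.subspace_scale[OF sB] by blast
      then show "r *s u - r *s f u \<in> B" by (simp add: vec.scale_right_diff_distrib)
    qed
  qed unfold_locales
  then have "\<exists>E. \<forall>v. E *v v \<in> A \<and> v - E *v v \<in> B"
    using f by (intro exI[of _ "matrix f"]) (simp add: matrix_works[OF lin])
  then have "\<forall>v. proj A B *v v \<in> A \<and> v - proj A B *v v \<in> B"
    unfolding proj_def by (rule someI_ex)
  then show "proj A B *v v \<in> A" "v - proj A B *v v \<in> B" by blast+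
qed

lemma proj_eqI: "complementary A B \<Longrightarrow> a \<in> A \<Longrightarrow> v - a \<in> B \<Longrightarrow> proj A B *v v = a"
  using complementary_unique proj_in proj_diff by metis

lemma proj_unique: "complementary A B \<Longrightarrow> (\<And>v. E *v v \<in> A) \<Longrightarrow> (\<And>v. v - E *v v \<in> B) \<Longrightarrow> proj A B = E"
  by (simp add: matrix_eq proj_eqI)

text \<open>If \<open>K\<close> moves \<open>A\<close> to another complement of \<open>B\<close>, then the matrix that is \<open>K\<close> on \<open>A\<close> and the
  identity on \<open>B\<close> conjugates the projections. This gives projections that vary holomorphically
  with the subspace.\<close>

lemma proj_move:
  fixes K :: "complex^'n^'n"
  assumes c: "complementary A B" and c': "complementary ((*v) K ` A) B" and K: "invertible K"
  defines "M \<equiv> K ** proj A B + (mat 1 - proj A B)"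
  shows "invertible M" "proj ((*v) K ` A) B = M ** proj A B ** matrix_inv M"
proof -
  let ?E = "proj A B"
  have Mv: "M *v v = K *v (?E *v v) + (v - ?E *v v)" for v
    by (simp add: M_def algebra_simps matrix_vector_mul_assoc)
  have "v = 0" if "M *v v = 0" for v
  proof -
    have k1: "K *v (?E *v v) = - (v - ?E *v v)" using that Mv by (metis eq_neg_iff_add_eq_0)
    have "- (v - ?E *v v) \<in> B" using vec.subspace_neg[OF _ proj_diff[OF c]] c unfolding complementary_def by blast
    then have "K *v (?E *v v) \<in> B" by (simp only: k1)
    moreover have "K *v (?E *v v) \<in> (*v) K ` A" using proj_in[OF c] by (rule imageI)
    ultimately have K0: "K *v (?E *v v) = 0" using c' unfolding complementary_def by blast
    then have "?E *v v = 0" using mat_inv_vec(1)[OF K, of "?E *v v"] by simp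
    then show ?thesis using that Mv[of v] by simp
  qed
  then show iM: "invertible M"
    using matrix_left_invertible_ker[of M] invertible_left_inverse by blast
  show "proj ((*v) K ` A) B = M ** ?E ** matrix_inv M"
  proof (rule proj_unique[OF c'])
    fix v
    define u where "u = matrix_inv M *v v"
    have v: "v = M *v u" using mat_inv_vec(2)[OF iM] by (simp add: u_def)
    have Eu: "?E *v (?E *v u) = ?E *v u"
      by (rule proj_eqI[OF c proj_in[OF c]]) (use c vec.subspace_0 in \<open>auto simp: complementary_def\<close>)
    have ME: "M *v (?E *v u) = K *v (?E *v u)" using Mv[of "?E *v u"] Eu by simp
    have "M ** ?E ** matrix_inv M *v v = M *v (?E *v u)"
      by (simp add: u_def matrix_vector_mul_assoc matrix_mul_assoc)
    then have eq: "M ** ?E ** matrix_inv M *v v = K *v (?E *v u)" by (simp only: ME)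
    show "M ** ?E ** matrix_inv M *v v \<in> (*v) K ` A" unfolding eq using proj_in[OF c] by blast
    show "v - M ** ?E ** matrix_inv M *v v \<in> B" unfolding eq using Mv[of u] v proj_diff[OF c, of u] by simp
  qed
qed

text \<open>The frames \<open>K s\<close> of \<open>E s\<close> provide the matrices that move \<open>E0\<close> to \<open>E s\<close>.\<close>

lemma proj_tendsto:
  fixes B :: "(complex^'n) set"
  assumes E: "subspace_tendsto E E0 A"
    and c: "\<forall>\<^sub>F s in A. complementary (E s) B" and c0: "complementary E0 B"
  shows "((\<lambda>s. proj (E s) B) \<longlongrightarrow> proj E0 B) A"
proof -
  obtain K :: "'a \<Rightarrow> complex^'n^'n" and K0 J where K: "(K \<longlongrightarrow> K0) A" "invertible K0" "E0 = (*v) K0 ` coord_subspace J"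
    "\<forall>\<^sub>F s in A. E s = (*v) (K s) ` coord_subspace J"
    using E unfolding subspace_tendsto_def by blast
  define L where "L s = K s ** matrix_inv K0" for s
  define M where "M s = L s ** proj E0 B + (mat 1 - proj E0 B)" for s
  have Lt: "(L \<longlongrightarrow> mat 1) A"
    using tendsto_mat_mult[OF K(1) tendsto_const[of "matrix_inv K0"]] mat_inv_right[OF K(2)] unfolding L_def by simp
  have "((\<lambda>s. L s ** proj E0 B) \<longlongrightarrow> mat 1 ** proj E0 B) A" by (rule tendsto_mat_mult[OF Lt tendsto_const])
  from tendsto_add[OF this tendsto_const[of "mat 1 - proj E0 B"]]
  have Mt: "(M \<longlongrightarrow> mat 1) A" unfolding M_def by simp
  have Mit: "((\<lambda>s. matrix_inv (M s)) \<longlongrightarrow> mat 1) A" using tendsto_mat_inv(2)[OF Mt invertible_mat_1] by (simp add: mat_inv_mat_1)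
  have lim: "((\<lambda>s. M s ** proj E0 B ** matrix_inv (M s)) \<longlongrightarrow> mat 1 ** proj E0 B ** mat 1) A"
    by (intro tendsto_mat_mult Mt Mit tendsto_const)
  have "\<forall>\<^sub>F s in A. invertible (L s)" by (rule tendsto_mat_inv(1)[OF Lt invertible_mat_1])
  with c K(4) have "\<forall>\<^sub>F s in A. M s ** proj E0 B ** matrix_inv (M s) = proj (E s) B"
  proof eventually_elim
    case (elim s)
    have "E s = (*v) (L s) ` E0"
      unfolding elim(2) L_def image_mat_mult K(3) image_inv_image(1)[OF K(2)] ..
    then show ?case using proj_move(2)[OF c0 _ elim(3)] elim(1) unfolding M_def by simp
  qed
  then show ?thesis using Lim_transform_eventually[OF lim] by simp
qed

lemma proj_hol:
  fixes B :: "complex \<Rightarrow> complex^'n^'n"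
  assumes B: "hol_mat B (ball s r)" and iB: "\<And>t. t \<in> ball s r \<Longrightarrow> invertible (B t)" and r: "0 < r"
    and E: "\<And>t. t \<in> ball s r \<Longrightarrow> E t = (*v) (B t) ` coord_subspace J"
    and c: "\<And>t. t \<in> ball s r \<Longrightarrow> complementary (E t) C"
  shows "hol_mat (\<lambda>t. proj (E t) C) (ball s r)"
proof -
  define L where "L t = B t ** matrix_inv (B s)" for t
  define M where "M t = L t ** proj (E s) C + (mat 1 - proj (E s) C)" for t
  have s: "s \<in> ball s r" using r by simp
  have iL: "invertible (L t)" if "t \<in> ball s r" for t
    unfolding L_def using iB[OF that] invertible_mat_inv[OF iB[OF s]] by (rule invertible_mult)
  have Es: "E t = (*v) (L t) ` E s" if "t \<in> ball s r" for t
    unfolding E[OF that] L_def image_mat_mult E[OF s] image_inv_image(1)[OF iB[OF s]] ..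
  have mv: "invertible (M t) \<and> proj (E t) C = M t ** proj (E s) C ** matrix_inv (M t)" if "t \<in> ball s r" for t
    using proj_move[OF c[OF s] _ iL[OF that]] c[OF that] Es[OF that] unfolding M_def by simp
  have "hol_mat M (ball s r)"
    unfolding M_def L_def by (intro hol_mat_add hol_mat_mult hol_mat_const B)
  then have "hol_mat (\<lambda>t. M t ** proj (E s) C ** matrix_inv (M t)) (ball s r)"
    using mv by (intro hol_mat_mult hol_mat_const hol_mat_inv) blast+
  then show ?thesis
    unfolding hol_mat_def
  proof (intro allI)
    fix i j
    assume *: "\<forall>i j. (\<lambda>t. (M t ** proj (E s) C ** matrix_inv (M t)) $ i $ j) holomorphic_on ball s r"
    then have "(\<lambda>t. (M t ** proj (E s) C ** matrix_inv (M t)) $ i $ j) holomorphic_on ball s r" by blast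
    then show "(\<lambda>t. proj (E t) C $ i $ j) holomorphic_on ball s r"
      by (rule holomorphic_transform) (simp add: mv)
  qed
qed

section \<open>Charts\<close>

context bigraded_frame
begin

text \<open>A complement of \<open>HF p\<close> that is preserved by the group of type \<open>ChartT\<close>.\<close>

definition EF :: "int \<Rightarrow> (complex^'n) set" where "EF p = sec {x. fst x < p}"

definition same_gr :: "'n filtration \<Rightarrow> bool" where
  "same_gr F \<longleftrightarrow> (\<forall>p. vec.subspace (F p)) \<and> antimono F \<and> (\<forall>k p. gr_ind F HW k p = gr_ind HF HW k p)"

lemma gr_HF: "gr_ind HF HW k p = sec ({x. p \<le> fst x \<and> wt x = k} \<union> {x. wt x < k})"
proof -
  have "gr_ind HF HW k p = sec (({x. p \<le> fst x} \<inter> {x. wt x \<le> k}) \<union> {x. wt x \<le> k - 1})"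
    unfolding gr_ind_def HF_def HW_def sec_Int sec_Un ..
  also have "({x. p \<le> fst x} \<inter> {x. wt x \<le> k}) \<union> {x. wt x \<le> k - 1} = {x. p \<le> fst x \<and> wt x = k} \<union> {x. wt x < k}"
    by auto
  finally show ?thesis .
qed

lemma HW_low: "\<exists>k0. \<forall>k\<le>k0. HW k = {0}"
proof -
  define k0 where "k0 = Min (insert 0 (wt ` R)) - 1"
  have "HW k = {0}" if "k \<le> k0" for k
  proof -
    have "{x. wt x \<le> k} \<inter> R = {}"
    proof (rule ccontr)
      assume "{x. wt x \<le> k} \<inter> R \<noteq> {}"
      then obtain x where "x \<in> R" "wt x \<le> k" by auto
      moreover have "Min (insert 0 (wt ` R)) \<le> wt x" using finR \<open>x \<in> R\<close> by (intro Min_le) auto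
      ultimately show False using that by (simp add: k0_def)
    qed
    then show ?thesis unfolding HW_def by (subst sec_R) (simp add: sec_empty)
  qed
  then show ?thesis by blast
qed

lemma HW_induct:
  assumes "\<And>v. v = 0 \<Longrightarrow> Q v" and "\<And>k v. (\<And>u. u \<in> HW k \<Longrightarrow> Q u) \<Longrightarrow> v \<in> HW (k + 1) \<Longrightarrow> Q v"
  shows "v \<in> HW k \<Longrightarrow> Q v"
proof -
  obtain k0 where k0: "\<And>k. k \<le> k0 \<Longrightarrow> HW k = {0}" using HW_low by blast
  have "\<forall>v\<in>HW k. Q v"
  proof (cases "k \<le> k0")
    case True
    then show ?thesis using k0 assms(1) by auto
  next
    case False
    then have "k0 \<le> k" by simp
    then show ?thesis
    proof (induction k rule: int_ge_induct)
      case base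
      then show ?case using k0 assms(1) by auto
    next
      case (step i)
      then show ?case using assms(2)[of i] by blast
    qed
  qed
  then show "v \<in> HW k \<Longrightarrow> Q v" by blast
qed

lemma HW_top: "\<exists>k. v \<in> HW k"
proof -
  define k where "k = Max (insert 0 (wt ` R))"
  have "pr x *v v = 0" if "wt x > k" for x
  proof -
    have "x \<notin> R"
    proof
      assume "x \<in> R"
      then have "wt x \<le> k" unfolding k_def using finR by (intro Max_ge) auto
      then show False using that by simp
    qed
    then show ?thesis by (simp add: pr_out)
  qed
  then show ?thesis by (intro exI[of _ k]) (auto simp: HW_def sec_def)
qed

text \<open>By induction on the weight, as the two summands are complementary on every graded piece. The last
  clause says that the decomposition is compatible with the weight filtration.\<close>

lemma same_gr_split:
  assumes F: "same_gr F"
  shows "v \<in> HW k \<Longrightarrow> \<exists>w. w \<in> F p \<and> v - w \<in> EF p \<and> (\<forall>j. v \<in> HW j \<longrightarrow> w \<in> HW j)"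
proof -
  have sF: "vec.subspace (F p)" using F by (simp add: same_gr_def)
  have sEF: "vec.subspace (EF p)" unfolding EF_def by (rule subspace_sec)
  have main: "\<forall>v\<in>HW k. \<exists>w. w \<in> F p \<and> w \<in> HW k \<and> v - w \<in> EF p" for k
  proof -
    obtain k0 where k0: "\<And>k. k \<le> k0 \<Longrightarrow> HW k = {0}" using HW_low by blast
    have zero: "\<forall>v\<in>HW k. \<exists>w. w \<in> F p \<and> w \<in> HW k \<and> v - w \<in> EF p" if "k \<le> k0" for k
      using k0[OF that] vec.subspace_0[OF sF] vec.subspace_0[OF sEF] by auto
    show ?thesis
    proof (cases "k \<le> k0")
      case False
      then have "k0 \<le> k" by simp
      then show ?thesis
      proof (induction k rule: int_ge_induct)
        case base
        then show ?case using zero by blast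
      next
        case (step i)
        show ?case
        proof
          fix v assume v: "v \<in> HW (i + 1)"
          have "{x. wt x \<le> i + 1} = ({x. p \<le> fst x \<and> wt x = i + 1} \<union> {x. wt x < i + 1}) \<union> {x. fst x < p \<and> wt x = i + 1}"
            by auto
          then have "v \<in> sec (({x. p \<le> fst x \<and> wt x = i + 1} \<union> {x. wt x < i + 1}) \<union> {x. fst x < p \<and> wt x = i + 1})"
            using v by (simp add: HW_def)
          from sec_split[OF this] obtain a where a': "a \<in> sec ({x. p \<le> fst x \<and> wt x = i + 1} \<union> {x. wt x < i + 1})"
            and a2: "v - a \<in> sec {x. fst x < p \<and> wt x = i + 1}" by blast
          have "a \<in> gr_ind F HW (i + 1) p" using F a' by (simp add: same_gr_def gr_HF)
          note a = this a2
          obtain w u where wu: "w \<in> F p \<inter> HW (i + 1)" "u \<in> HW i" "a = w + u"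
            using a(1) unfolding gr_ind_def by (auto elim: setplusE)
          obtain w' where w': "w' \<in> F p" "w' \<in> HW i" "u - w' \<in> EF p" using step(2) wu(2) by blast
          have mono: "HW i \<subseteq> HW (i + 1)" unfolding HW_def by (rule sec_mono) auto
          have "v - a \<in> EF p" using a(2) sec_mono[of "{x. fst x < p \<and> wt x = i + 1}" "{x. fst x < p}"]
            unfolding EF_def by blast
          then have "(v - a) + (u - w') \<in> EF p" using w'(3) vec.subspace_add[OF sEF] by blast
          then have "v - (w + w') \<in> EF p" using wu(3) by (simp add: algebra_simps)
          moreover have "w + w' \<in> F p" using wu w' vec.subspace_add[OF sF] by blast
          moreover have "w + w' \<in> HW (i + 1)" using wu w' mono vec.subspace_add[OF subspace_HW] by blast
          ultimately show "\<exists>w. w \<in> F p \<and> w \<in> HW (i + 1) \<and> v - w \<in> EF p" by blast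
        qed
      qed
    qed (rule zero)
  qed
  assume v: "v \<in> HW k"
  obtain k0 where k0: "\<And>k. k \<le> k0 \<Longrightarrow> HW k = {0}" using HW_low by blast
  show ?thesis
  proof (cases "v = 0")
    case True
    then show ?thesis
      using vec.subspace_0[OF sF] vec.subspace_0[OF sEF] vec.subspace_0[OF subspace_HW] by (intro exI[of _ 0]) simp
  next
    case False
    \<comment> \<open>The smallest step \<open>HW m\<close> with \<open>v \<in> HW m\<close> serves all \<open>j\<close> with \<open>v \<in> HW j\<close> at once.\<close>
    define J where "J = {j. k0 < j \<and> j \<le> k \<and> v \<in> HW j}"
    have finJ: "finite J" by (rule finite_subset[of _ "{k0..k}"]) (auto simp: J_def)
    have kJ: "k \<in> J" using v False k0[of k] by (force simp: J_def)
    define m where "m = Min J"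
    have m: "m \<in> J" unfolding m_def using finJ kJ by (intro Min_in) auto
    obtain w where w: "w \<in> F p" "w \<in> HW m" "v - w \<in> EF p" using main m by (auto simp: J_def)
    have "w \<in> HW j" if "v \<in> HW j" for j
    proof -
      have "k0 < j" using that k0[of j] False by force
      have "m \<le> j"
      proof (cases "j \<le> k")
        case True
        then have "j \<in> J" using that \<open>k0 < j\<close> by (simp add: J_def)
        then show ?thesis unfolding m_def using finJ by (intro Min_le)
      next
        case False
        then show ?thesis using m by (simp add: J_def)
      qed
      then have "HW m \<subseteq> HW j" unfolding HW_def by (intro sec_mono) auto
      then show ?thesis using w by blast
    qed
    then show ?thesis using w by blast
  qed
qed

lemma same_gr_Int:
  assumes F: "same_gr F" and v: "v \<in> F p" "v \<in> EF p"
  shows "v = 0"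
proof -
  have "\<exists>k. v \<in> HW k" by (rule HW_top)
  then obtain k where "v \<in> HW k" by blast
  then have "v \<in> F p \<longrightarrow> v \<in> EF p \<longrightarrow> v = 0"
  proof (rule HW_induct[rotated 2])
    fix k v assume IH: "\<And>u. u \<in> HW k \<Longrightarrow> u \<in> F p \<longrightarrow> u \<in> EF p \<longrightarrow> u = 0" and v: "v \<in> HW (k + 1)"
    show "v \<in> F p \<longrightarrow> v \<in> EF p \<longrightarrow> v = 0"
    proof (intro impI)
      assume vF: "v \<in> F p" and vE: "v \<in> EF p"
      have "v + 0 \<in> gr_ind F HW (k + 1) p"
        unfolding gr_ind_def using vF v vec.subspace_0[OF subspace_sec] by (intro set_plus_intro) (auto simp: HW_def)
      then have "v \<in> sec ({x. p \<le> fst x \<and> wt x = k + 1} \<union> {x. wt x < k + 1})"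
        using F by (simp add: same_gr_def gr_HF)
      then have "v \<in> sec (({x. p \<le> fst x \<and> wt x = k + 1} \<union> {x. wt x < k + 1}) \<inter> {x. fst x < p})"
        using vE unfolding sec_Int[symmetric] EF_def by blast
      then have "v \<in> HW k" unfolding HW_def by (rule sec_mono[THEN subsetD, rotated]) auto
      then show "v = 0" using IH vF vE by blast
    qed
  qed simp
  then show ?thesis using v by blast
qed

lemma same_gr_complementary:
  assumes F: "same_gr F"
  shows "complementary (F p) (EF p)"
  unfolding complementary_def
proof (intro conjI allI)
  show sF: "vec.subspace (F p)" using F by (simp add: same_gr_def)
  show sE: "vec.subspace (EF p)" unfolding EF_def by (rule subspace_sec)
  show "F p \<inter> EF p = {0}"
    using same_gr_Int[OF F] vec.subspace_0[OF sF] vec.subspace_0[OF sE] by blast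
  fix v
  obtain k where "v \<in> HW k" using HW_top by blast
  then show "\<exists>a\<in>F p. v - a \<in> EF p" using same_gr_split[OF F] by blast
qed

text \<open>The unique \<open>g\<close> of type \<open>ChartT\<close> with \<open>F = g HF\<close>: it maps a vector of the summand \<open>(p, q)\<close> to its
  projection to \<open>F p\<close> along \<open>EF p\<close>. This formula makes limits and holomorphy of \<open>g\<close> visible.\<close>

definition chart :: "'n filtration \<Rightarrow> complex^'n^'n" where
  "chart F = (\<Sum>x\<in>R. proj (F (fst x)) (EF (fst x)) ** pr x)"

lemma chart_sec:
  assumes v: "v \<in> sec {x}"
  shows "chart F *v v = proj (F (fst x)) (EF (fst x)) *v v"
proof -
  have "chart F *v v = (\<Sum>y\<in>R. if y = x then proj (F (fst x)) (EF (fst x)) *v v else 0)"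
    unfolding chart_def sum_mat_vec
    by (rule sum.cong) (use v sec_pr[OF v] in \<open>auto simp: sec_def simp flip: matrix_vector_mul_assoc\<close>)
  then show ?thesis using finR sec_pr[OF v] pr_out[of x] by (cases "x \<in> R") (auto simp: sum.delta)
qed

lemma chart_UT:
  assumes F: "same_gr F"
  shows "UT ChartT (chart F)"
  unfolding UT_def
proof (rule sec_image_supp)
  fix v y assume v: "v \<in> sec {y}"
  have c: "complementary (F (fst y)) (EF (fst y))" by (rule same_gr_complementary[OF F])
  define p where "p = fst y" define k where "k = wt y"
  have "v \<in> sec ({x. p \<le> fst x \<and> wt x = k} \<union> {x. wt x < k})"
    using v by (rule sec_mono[THEN subsetD, rotated]) (auto simp: p_def k_def)
  then have "v \<in> gr_ind F HW k p" using F by (simp add: same_gr_def gr_HF)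
  then obtain w u where wu: "w \<in> F p" "w \<in> HW k" "u \<in> HW (k - 1)" "v = w + u"
    unfolding gr_ind_def by (auto elim: setplusE)
  obtain w' where w': "w' \<in> F p" "u - w' \<in> EF p" "w' \<in> HW (k - 1)"
    using same_gr_split[OF F wu(3), of p] wu(3) by blast
  have "w + w' \<in> F p" using wu w' F vec.subspace_add by (auto simp: same_gr_def)
  moreover have "v - (w + w') \<in> EF p" using w'(2) wu(4) by simp
  ultimately have "proj (F p) (EF p) *v v = w + w'" using c by (intro proj_eqI) (auto simp: p_def)
  then have "(chart F - mat 1) *v v = w' - u"
    using chart_sec[OF v, of F] wu(4) by (simp add: p_def algebra_simps)
  moreover have "w' - u \<in> HW (k - 1)" using w'(3) wu(3) vec.subspace_diff[OF subspace_HW] by blast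
  moreover have "w' - u \<in> EF p"
    using vec.subspace_neg[OF _ w'(2)] subspace_sec by (simp add: EF_def)
  ultimately have "(chart F - mat 1) *v v \<in> sec ({x. wt x \<le> k - 1} \<inter> {x. fst x < p})"
    unfolding sec_Int[symmetric] by (simp add: HW_def EF_def)
  then show "(chart F - mat 1) *v v \<in> sec {x. x - y \<in> ChartT}"
    by (rule sec_mono[THEN subsetD, rotated]) (auto simp: ChartT_def p_def k_def)
qed

lemma UT_Neg_chart: "same_gr F \<Longrightarrow> UT NegT (chart F)"
  by (rule UT_mono[OF chart_UT]) (auto simp: ChartT_def NegT_def)

lemma chart_image:
  assumes F: "same_gr F"
  shows "(*v) (chart F) ` HF p = F p"
proof
  have c: "complementary (F p) (EF p)" for p by (rule same_gr_complementary[OF F])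
  have anti: "F q \<subseteq> F p" if "p \<le> q" for p q using F that by (auto simp: same_gr_def antimono_def)
  show sub: "(*v) (chart F) ` HF p \<subseteq> F p"
  proof clarify
    fix v assume v: "v \<in> HF p"
    have "chart F *v v = chart F *v (\<Sum>x\<in>R. pr x *v v)" by (simp flip: vec_decomp)
    also have "\<dots> = (\<Sum>x\<in>R. chart F *v (pr x *v v))" by (simp add: vec.sum)
    also have "\<dots> \<in> F p"
    proof (rule vec.subspace_sum)
      show "vec.subspace (F p)" using F by (simp add: same_gr_def)
      fix x
      show "chart F *v (pr x *v v) \<in> F p"
      proof (cases "p \<le> fst x")
        case True
        then show ?thesis unfolding chart_sec[OF pr_sec] using anti proj_in[OF c] by blast
      next
        case False
        then have "pr x *v v = 0" using v by (auto simp: HF_def sec_def)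
        then show ?thesis using F vec.subspace_0 by (auto simp: same_gr_def)
      qed
    qed
    finally show "chart F *v v \<in> F p" .
  qed
  show "F p \<subseteq> (*v) (chart F) ` HF p"
  proof
    fix w assume w: "w \<in> F p"
    have U: "UT ChartT (chart F)" by (rule chart_UT[OF F])
    define v where "v = matrix_inv (chart F) *v w"
    have wv: "w = chart F *v v"
      using mat_inv_vec(2)[OF UT_inv(1)[OF add_closed_types(4) U]] by (simp add: v_def)
    have "v \<in> sec ({x. p \<le> fst x} \<union> {x. fst x < p})"
    proof -
      have "{x. p \<le> fst x} \<union> {x. fst x < p} = (UNIV :: (int \<times> int) set)" by auto
      then show ?thesis by (simp only: sec_UNIV UNIV_I)
    qed
    then obtain a where a: "a \<in> HF p" "v - a \<in> EF p" unfolding HF_def EF_def using sec_split by blast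
    have "chart F *v (v - a) \<in> EF p"
      using a(2) unfolding EF_def by (rule UT_sec_mem[OF U]) (auto simp: ChartT_def)
    moreover have "chart F *v (v - a) = w - chart F *v a" by (simp add: wv algebra_simps)
    moreover have "chart F *v a \<in> F p" using sub a(1) by blast
    then have "w - chart F *v a \<in> F p"
      using w F unfolding same_gr_def by (blast intro: vec.subspace_diff)
    ultimately have "w - chart F *v a = 0" using complementary_Int[OF c[of p]] by metis
    then show "w \<in> (*v) (chart F) ` HF p" using a(1) by auto
  qed
qed

lemma same_gr_HF: "same_gr HF"
  unfolding same_gr_def HF_def by (auto simp: subspace_sec antimono_def intro!: sec_mono)

lemma chart_HF: "chart HF = mat 1"
proof -
  have "proj (HF (fst x)) (EF (fst x)) *v (pr x *v v) = pr x *v v" for x v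
  proof (rule proj_eqI[OF same_gr_complementary[OF same_gr_HF]])
    show "pr x *v v \<in> HF (fst x)" unfolding HF_def
      by (rule sec_mono[THEN subsetD, OF _ pr_sec]) auto
    show "pr x *v v - pr x *v v \<in> EF (fst x)" using vec.subspace_0[OF subspace_sec] by (simp add: EF_def)
  qed
  then have "chart HF *v v = v" for v
    by (simp add: chart_def sum_mat_vec vec_decomp[symmetric] flip: matrix_vector_mul_assoc)
  then show ?thesis by (simp add: matrix_eq)
qed

lemma image_gr_HF:
  assumes g: "UT NegT g"
  shows "(*v) g ` gr_ind HF HW k p = gr_ind HF HW k p"
  unfolding gr_HF by (rule UT_sec[OF add_closed_types(1) g]) (auto simp: NegT_def)

lemma same_gr_image:
  assumes F: "same_gr F" and g: "UT NegT g"
  shows "same_gr (\<lambda>p. (*v) g ` F p)"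
proof -
  have ig: "invertible g" by (rule UT_inv(1)[OF add_closed_types(1) g])
  have gW: "(*v) g ` HW k = HW k" for k by (rule image_HW[OF g])
  have "gr_ind (\<lambda>p. (*v) g ` F p) HW k p = (*v) g ` gr_ind F HW k p" for k p
  proof -
    have "(*v) g ` F p \<inter> HW k = (*v) g ` (F p \<inter> HW k)"
      using image_Int[OF inj_invertible[OF ig]] gW by metis
    then show ?thesis unfolding gr_ind_def image_set_plus gW by simp
  qed
  moreover have "(*v) g ` F q \<subseteq> (*v) g ` F p" if "p \<le> q" for p q
    using F that by (intro image_mono) (auto simp: same_gr_def antimono_def)
  moreover have "gr_ind F HW k p = gr_ind HF HW k p" for k p using F by (simp add: same_gr_def)
  ultimately show ?thesis
    using F by (simp add: same_gr_def antimono_def subspace_mv_image image_gr_HF[OF g])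
qed

subsection \<open>Limits and holomorphy of charts\<close>

lemma chart_tendsto:
  assumes "\<And>p. subspace_tendsto (\<lambda>s. F s p) (F0 p) A" and "\<forall>\<^sub>F s in A. same_gr (F s)" and "same_gr F0"
  shows "((\<lambda>s. chart (F s)) \<longlongrightarrow> chart F0) A"
  unfolding chart_def
proof (intro tendsto_sum tendsto_mat_mult tendsto_const proj_tendsto assms(1))
  fix x
  show "\<forall>\<^sub>F s in A. complementary (F s (fst x)) (EF (fst x))"
    using assms(2) by eventually_elim (rule same_gr_complementary)
  show "complementary (F0 (fst x)) (EF (fst x))" by (rule same_gr_complementary[OF assms(3)])
qed

definition hol_filtration :: "(complex \<Rightarrow> 'n filtration) \<Rightarrow> complex set \<Rightarrow> bool" where
  "hol_filtration F S \<longleftrightarrow> (\<forall>s\<in>S. \<forall>p. \<exists>r>0. ball s r \<subseteq> S \<and> (\<exists>(B :: complex \<Rightarrow> complex^'n^'n) J.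
     hol_mat B (ball s r) \<and> (\<forall>t\<in>ball s r. invertible (B t) \<and> F t p = (*v) (B t) ` coord_subspace J)))"

lemma hol_filtrationE:
  assumes F: "hol_filtration F S" and s: "s \<in> S"
  obtains r and B :: "complex \<Rightarrow> complex^'n^'n" and J where "0 < r" "ball s r \<subseteq> S" "hol_mat B (ball s r)"
    "\<forall>t\<in>ball s r. invertible (B t) \<and> F t p = (*v) (B t) ` coord_subspace J"
proof -
  obtain r where r: "0 < r \<and> ball s r \<subseteq> S \<and> (\<exists>(B :: complex \<Rightarrow> complex^'n^'n) J. hol_mat B (ball s r) \<and>
      (\<forall>t\<in>ball s r. invertible (B t) \<and> F t p = (*v) (B t) ` coord_subspace J))"
    using F[unfolded hol_filtration_def, rule_format, OF s, of p] by (rule exE)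
  then have "\<exists>(B :: complex \<Rightarrow> complex^'n^'n) J. hol_mat B (ball s r) \<and>
      (\<forall>t\<in>ball s r. invertible (B t) \<and> F t p = (*v) (B t) ` coord_subspace J)" by (elim conjE)
  then obtain B :: "complex \<Rightarrow> complex^'n^'n" where "\<exists>J. hol_mat B (ball s r) \<and>
      (\<forall>t\<in>ball s r. invertible (B t) \<and> F t p = (*v) (B t) ` coord_subspace J)" by (rule exE)
  then obtain J where "hol_mat B (ball s r) \<and>
      (\<forall>t\<in>ball s r. invertible (B t) \<and> F t p = (*v) (B t) ` coord_subspace J)" by (rule exE)
  with r show thesis by (intro that[of r B J]) simp_all
qed

lemma chart_hol:
  assumes F: "hol_filtration F S" and g: "\<And>s. s \<in> S \<Longrightarrow> same_gr (F s)"
  shows "hol_mat (\<lambda>t. chart (F t)) S"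
  unfolding hol_mat_def
proof (intro allI)
  fix i j
  have eq: "(\<lambda>t. chart (F t) $ i $ j) = (\<lambda>t. \<Sum>x\<in>R. (proj (F t (fst x)) (EF (fst x)) ** pr x) $ i $ j)"
    by (simp add: chart_def)
  show "(\<lambda>t. chart (F t) $ i $ j) holomorphic_on S"
    unfolding eq
  proof (rule holomorphic_on_sum)
    fix x
    show "(\<lambda>t. (proj (F t (fst x)) (EF (fst x)) ** pr x) $ i $ j) holomorphic_on S" (is "?f holomorphic_on S")
      unfolding holomorphic_on_def
    proof
      fix s assume s: "s \<in> S"
      obtain r and B :: "complex \<Rightarrow> complex^'n^'n" and J where r: "0 < r" "ball s r \<subseteq> S" "hol_mat B (ball s r)"
        "\<forall>t\<in>ball s r. invertible (B t) \<and> F t (fst x) = (*v) (B t) ` coord_subspace J"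
        using F s by (rule hol_filtrationE[where p = "fst x"])
      have c: "complementary (F t (fst x)) (EF (fst x))" if "t \<in> ball s r" for t
        using that r(2) by (intro same_gr_complementary g) blast
      have "hol_mat (\<lambda>t. proj (F t (fst x)) (EF (fst x))) (ball s r)"
        by (rule proj_hol[OF r(3) _ r(1) _ c]) (use r(4) in simp_all)
      then have "hol_mat (\<lambda>t. proj (F t (fst x)) (EF (fst x)) ** pr x) (ball s r)"
        by (intro hol_mat_mult hol_mat_const)
      then have "?f holomorphic_on ball s r" unfolding hol_mat_def by blast
      then have "?f field_differentiable at s"
        by (rule holomorphic_on_imp_differentiable_at[OF _ open_ball]) (simp add: r(1))
      then show "?f field_differentiable at s within S" by (rule field_differentiable_at_within)
    qed
  qed
qed

end

section \<open>A frame adapted to a mixed Hodge structure\<close>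

text \<open>The real orthogonal complement of a complex subspace is also its Hermitian orthogonal complement. So it is
  a complex subspace, and it is invariant under conjugation if the subspace is.\<close>

definition perp :: "(complex^'n) set \<Rightarrow> (complex^'n) set" where
  "perp A = {x. \<forall>y\<in>A. inner x y = 0}"

lemma inner_scale: "inner (c *s x) y = inner x (cnj c *s (y::complex^'n))"
  unfolding inner_vec_def by (intro sum.cong refl) (simp add: inner_complex_def algebra_simps)

lemma inner_cnjv: "inner (cnjv x) (cnjv y) = inner x y"
  unfolding inner_vec_def by (simp add: inner_complex_def)

lemma subspace_real:
  fixes A :: "(complex^'n) set"
  assumes A: "vec.subspace A"
  shows "subspace A"
  unfolding subspace_def
proof (intro conjI ballI allI)
  show "c *\<^sub>R x \<in> A" if "x \<in> A" for c x
  proof -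
    have "c *\<^sub>R x = of_real c *s x"
      unfolding vec_eq_iff vector_scaleR_component vector_smult_component by (simp add: scaleR_conv_of_real)
    then show ?thesis using vec.subspace_scale[OF A that] by simp
  qed
qed (use vec.subspace_0[OF A] vec.subspace_add[OF A] in auto)

lemma complementary_perp:
  fixes A :: "(complex^'n) set"
  assumes A: "vec.subspace A"
  shows "complementary A (perp A)"
  unfolding complementary_def
proof (intro conjI allI)
  show "vec.subspace (perp A)"
    unfolding vec.subspace_def
  proof (intro conjI ballI allI)
    show "0 \<in> perp A" by (simp add: perp_def)
    show "x + y \<in> perp A" if "x \<in> perp A" "y \<in> perp A" for x y
      using that by (simp add: perp_def inner_add_left)
    show "c *s x \<in> perp A" if "x \<in> perp A" for c x
      using that vec.subspace_scale[OF A] by (simp add: perp_def inner_scale)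
  qed
  have "x = 0" if "x \<in> A" "x \<in> perp A" for x
  proof -
    have "inner x x = 0" using that unfolding perp_def by blast
    then show ?thesis by simp
  qed
  moreover have "0 \<in> A \<inter> perp A" using vec.subspace_0[OF A] by (simp add: perp_def)
  ultimately show "A \<inter> perp A = {0}" by blast
  fix v
  have rA: "span A = A" using subspace_real[OF A] by (simp add: span_eq_iff)
  obtain y z where "y \<in> span A" "\<And>w. w \<in> span A \<Longrightarrow> orthogonal z w" "v = y + z"
    using orthogonal_subspace_decomp_exists[of A v] by blast
  then show "\<exists>a\<in>A. v - a \<in> perp A"
    unfolding rA by (intro bexI[of _ y]) (simp_all add: perp_def orthogonal_def)
qed (rule A)

lemma cnjv_perp: "cnjv ` A = A \<Longrightarrow> v \<in> perp A \<Longrightarrow> cnjv v \<in> perp A"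
  unfolding perp_def
proof (intro CollectI ballI)
  fix y assume *: "cnjv ` A = A" "v \<in> {x. \<forall>y\<in>A. inner x y = 0}" "y \<in> A"
  then have "cnjv y \<in> A" using cnjv_image_iff by blast
  then have "inner v (cnjv y) = 0" using * by blast
  then show "inner (cnjv v) y = 0" using inner_cnjv[of v "cnjv y"] by simp
qed

lemma proj_fix: "complementary A B \<Longrightarrow> v \<in> A \<Longrightarrow> proj A B *v v = v"
  by (rule proj_eqI) (auto simp: complementary_def vec.subspace_0)

lemma proj_zero: "complementary A B \<Longrightarrow> v \<in> B \<Longrightarrow> proj A B *v v = 0"
  by (rule proj_eqI) (auto simp: complementary_def vec.subspace_0)

locale mhs =
  fixes F W :: "'n::finite filtration"
  assumes mhs: "mixed_hodge_structure F W"
begin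

lemma sW: "vec.subspace (W k)" and W_mono: "j \<le> k \<Longrightarrow> W j \<subseteq> W k"
  using mhs unfolding mixed_hodge_structure_def increasing_filtration_def by (auto dest: monoD)

lemma sF: "vec.subspace (F p)" and F_anti: "p \<le> q \<Longrightarrow> F q \<subseteq> F p"
  using mhs unfolding mixed_hodge_structure_def decreasing_filtration_def by (auto dest: antimonoD)

lemma cW: "cnjv ` W k = W k"
  using mhs unfolding mixed_hodge_structure_def by blast

subsection \<open>A real splitting of the weight filtration\<close>

definition qW :: "int \<Rightarrow> complex^'n^'n" where "qW k = proj (W k) (perp (W k))"
definition wW :: "int \<Rightarrow> complex^'n^'n" where "wW k = qW k - qW (k - 1)"

lemmas cp = complementary_perp[OF sW]

lemma q_in: "qW k *v v \<in> W k" unfolding qW_def by (rule proj_in[OF cp])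
lemma q_fix: "v \<in> W k \<Longrightarrow> qW k *v v = v" unfolding qW_def by (rule proj_fix[OF cp])

lemma q_q1: "j \<le> k \<Longrightarrow> qW k ** qW j = qW j"
  using q_fix q_in W_mono by (simp add: matrix_eq flip: matrix_vector_mul_assoc) blast

lemma q_q2: assumes "j \<le> k" shows "qW j ** qW k = qW j"
proof -
  have "qW j *v (v - qW k *v v) = 0" for v
  proof -
    have "v - qW k *v v \<in> perp (W k)" unfolding qW_def by (rule proj_diff[OF cp])
    then have "v - qW k *v v \<in> perp (W j)" using W_mono[OF assms] by (auto simp: perp_def)
    then show ?thesis unfolding qW_def[of j] by (rule proj_zero[OF cp])
  qed
  then have "qW j *v v = qW j *v (qW k *v v)" for v by (simp add: vec.diff)
  then show ?thesis by (simp add: matrix_eq flip: matrix_vector_mul_assoc)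
qed

lemma q_q: "qW j ** qW k = qW (min j k)"
  using q_q1[of k j] q_q2[of j k] by (cases "j \<le> k") (auto simp: min_def)

lemma cnjm_q: "cnjm (qW k) = qW k"
proof -
  have e: "cnjm (qW k) *v v = cnjv (qW k *v cnjv v)" for v by (simp add: cnjv_mv)
  have "qW k = cnjm (qW k)"
    unfolding qW_def
  proof (rule proj_unique[OF cp], unfold qW_def[symmetric] e)
    fix v
    show "cnjv (qW k *v cnjv v) \<in> W k" using q_in cW by (metis imageI)
    have "cnjv v - qW k *v cnjv v \<in> perp (W k)" unfolding qW_def by (rule proj_diff[OF cp])
    then have "cnjv (cnjv v - qW k *v cnjv v) \<in> perp (W k)" by (rule cnjv_perp[OF cW])
    then show "v - cnjv (qW k *v cnjv v) \<in> perp (W k)" by (simp add: cnjv_diff)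
  qed
  then show ?thesis by simp
qed

lemma w_w: "wW j ** wW k = (if j = k then wW k else 0)"
proof -
  consider "j = k" | "k < j" | "j < k" by linarith
  then show ?thesis
  proof cases
    case 1
    have "min k (k - 1) = k - 1" "min (k - 1) k = k - 1" by auto
    then show ?thesis using 1 by (simp add: wW_def mat_algebra q_q)
  next
    case 2
    then have "min j k = k" "min j (k - 1) = k - 1" "min (j - 1) k = k" "min (j - 1) (k - 1) = k - 1" by auto
    then show ?thesis using 2 by (simp add: wW_def mat_algebra q_q)
  next
    case 3
    then have "min j k = j" "min j (k - 1) = j" "min (j - 1) k = j - 1" "min (j - 1) (k - 1) = j - 1" by auto
    then show ?thesis using 3 by (simp add: wW_def mat_algebra q_q)
  qed
qed

lemma cnjm_w: "cnjm (wW k) = wW k" by (simp add: wW_def cnjm_diff cnjm_q)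

lemma w_in: "wW k *v v \<in> W k"
proof -
  have "qW (k - 1) *v v \<in> W k" using q_in[of "k - 1"] W_mono[of "k - 1" k] by auto
  then show ?thesis unfolding wW_def using q_in[of k] by (simp add: algebra_simps vec.subspace_diff[OF sW])
qed

lemma w_diff: "v \<in> W k \<Longrightarrow> v - wW k *v v \<in> W (k - 1)"
  using q_fix[of v k] q_in[of "k - 1" v] by (simp add: wW_def algebra_simps)

lemma w_zero: "v \<in> W (k - 1) \<Longrightarrow> wW k *v v = 0"
  using q_fix[of v k] q_fix[of v "k - 1"] W_mono[of "k - 1" k] by (auto simp: wW_def algebra_simps)

lemma w_low: "v \<in> W k \<Longrightarrow> k < j \<Longrightarrow> wW j *v v = 0"
  using w_zero[of v j] W_mono[of k "j - 1"] by auto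

subsection \<open>The projections to the Hodge components\<close>

abbreviation X :: "int \<Rightarrow> int \<Rightarrow> (complex^'n) set" where "X k p \<equiv> gr_ind F W k p"

lemma sX: "vec.subspace (X k p)"
proof -
  have "{x + y |x y. x \<in> F p \<inter> W k \<and> y \<in> W (k - 1)} = X k p"
    unfolding gr_ind_def set_plus_def by auto
  then show ?thesis
    using vec.subspace_sums[OF vec.subspace_inter[OF sF sW] sW, of p k "k - 1"] by simp
qed

lemma X_sub: "X k p \<subseteq> W k" and W_sub: "W (k - 1) \<subseteq> X k p"
proof -
  have "a + b \<in> W k" if "a \<in> F p \<inter> W k" "b \<in> W (k - 1)" for a b
    using that W_mono[of "k - 1" k] vec.subspace_add[OF sW] by auto
  then show "X k p \<subseteq> W k" unfolding gr_ind_def by (auto elim!: setplusE)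
  have "0 + b \<in> X k p" if "b \<in> W (k - 1)" for b
    unfolding gr_ind_def using that vec.subspace_0[OF sF] vec.subspace_0[OF sW] by (intro set_plus_intro) auto
  then show "W (k - 1) \<subseteq> X k p" by auto
qed

lemma X_anti: "p \<le> q \<Longrightarrow> X k q \<subseteq> X k p"
  unfolding gr_ind_def using F_anti by (intro set_plus_mono2) auto

lemma X_opp: "X k p + cnjv ` X k (k - p + 1) = W k" "X k p \<inter> cnjv ` X k (k - p + 1) = W (k - 1)"
  using mhs unfolding mixed_hodge_structure_def by blast+

lemma w_X: "v \<in> X k p \<Longrightarrow> wW k *v v \<in> X k p"
proof -
  assume v: "v \<in> X k p"
  then have "v - wW k *v v \<in> X k p" using w_diff X_sub W_sub by blast
  then have "v - (v - wW k *v v) \<in> X k p" by (rule vec.subspace_diff[OF sX v])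
  then show ?thesis by simp
qed

text \<open>\<open>e k p\<close> projects the weight \<open>k\<close> summand to \<open>F\<^sup>p\<close> along the conjugate of \<open>F\<^sup>k\<^sup>-\<^sup>p\<^sup>+\<^sup>1\<close>, with graded pieces identified with
  summands. These projections form a decreasing chain, conjugation exchanges them with their
  complements, and so the differences of consecutive ones are the projections to the Hodge components.\<close>

definition eA :: "int \<Rightarrow> int \<Rightarrow> (complex^'n) set" where "eA k p = {v \<in> X k p. wW k *v v = v}"
definition eB :: "int \<Rightarrow> int \<Rightarrow> (complex^'n) set" where "eB k p = {v. wW k *v v \<in> cnjv ` X k (k - p + 1)}"
definition e :: "int \<Rightarrow> int \<Rightarrow> complex^'n^'n" where "e k p = proj (eA k p) (eB k p)"

lemma ww_vec: "wW k *v (wW k *v v) = wW k *v v"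
  by (simp add: matrix_vector_mul_assoc w_w)

lemma e_compl: "complementary (eA k p) (eB k p)"
  unfolding complementary_def
proof (intro conjI allI)
  have sc: "vec.subspace (cnjv ` X k (k - p + 1))" by (rule subspace_cnjv[OF sX])
  show sA: "vec.subspace (eA k p)"
    using sX[of k p] unfolding eA_def vec.subspace_def by (simp add: algebra_simps mv_scale)
  show sB: "vec.subspace (eB k p)"
  proof -
    obtain C where C: "C = cnjv ` X k (k - p + 1)" by blast
    show ?thesis
      using sc unfolding eB_def C[symmetric] vec.subspace_def
      by (simp add: matrix_vector_right_distrib mv_scale)
  qed
  have "v = 0" if "v \<in> eA k p" "v \<in> eB k p" for v
  proof -
    have "v \<in> X k p \<inter> cnjv ` X k (k - p + 1)" using that by (simp add: eA_def eB_def)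
    then have "v \<in> W (k - 1)" by (simp only: X_opp)
    then have "wW k *v v = 0" by (rule w_zero)
    then show ?thesis using that by (simp add: eA_def)
  qed
  moreover have "0 \<in> eA k p \<inter> eB k p" using vec.subspace_0[OF sA] vec.subspace_0[OF sB] by blast
  ultimately show "eA k p \<inter> eB k p = {0}" by blast
  fix v
  have "wW k *v v \<in> X k p + cnjv ` X k (k - p + 1)" unfolding X_opp by (rule w_in)
  then obtain a b where ab: "a \<in> X k p" "b \<in> cnjv ` X k (k - p + 1)" "wW k *v v = a + b" by (rule setplusE)
  have bw: "wW k *v b \<in> cnjv ` X k (k - p + 1)"
    using w_X[of "cnjv b" k "k - p + 1"] ab(2) by (simp add: cnjv_image_iff cnjv_mv cnjm_w)
  have "wW k *v (v - wW k *v a) = wW k *v (wW k *v v) - wW k *v a"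
    by (simp add: vec.diff ww_vec)
  also have "\<dots> = wW k *v b" by (simp add: ab(3) vec.add)
  finally have "v - wW k *v a \<in> eB k p" using bw by (simp add: eB_def)
  moreover have "wW k *v a \<in> eA k p" using w_X[OF ab(1)] by (simp add: eA_def ww_vec)
  ultimately show "\<exists>a\<in>eA k p. v - a \<in> eB k p" by blast
qed

lemma eA_anti: "p \<le> q \<Longrightarrow> eA k q \<subseteq> eA k p" using X_anti by (auto simp: eA_def)
lemma eB_mono: "p \<le> q \<Longrightarrow> eB k p \<subseteq> eB k q"
  using X_anti[of "k - q + 1" "k - p + 1" k] by (auto simp: eB_def)

lemma e_in: "e k p *v v \<in> eA k p" unfolding e_def by (rule proj_in[OF e_compl])
lemma e_diff: "v - e k p *v v \<in> eB k p" unfolding e_def by (rule proj_diff[OF e_compl])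
lemma e_fix: "v \<in> eA k p \<Longrightarrow> e k p *v v = v" unfolding e_def by (rule proj_fix[OF e_compl])
lemma e_zero: "v \<in> eB k p \<Longrightarrow> e k p *v v = 0" unfolding e_def by (rule proj_zero[OF e_compl])

lemma e_e1: "p \<le> q \<Longrightarrow> e k p ** e k q = e k q"
  using e_fix e_in eA_anti by (simp add: matrix_eq flip: matrix_vector_mul_assoc) blast

lemma e_e2: assumes "p \<le> q" shows "e k q ** e k p = e k q"
proof -
  have "e k q *v (v - e k p *v v) = 0" for v
    using e_diff eB_mono[OF assms] by (intro e_zero) blast
  then have "e k q *v v = e k q *v (e k p *v v)" for v by (simp add: vec.diff)
  then show ?thesis by (simp add: matrix_eq flip: matrix_vector_mul_assoc)
qed

lemma e_e: "e k p ** e k q = e k (max p q)"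
  using e_e1[of p q k] e_e2[of q p k] by (cases "p \<le> q") (auto simp: max_def)

lemma w_e: "wW k ** e k p = e k p"
  using e_in by (simp add: matrix_eq eA_def flip: matrix_vector_mul_assoc)

lemma e_w: "e k p ** wW k = e k p"
proof -
  have "e k p *v (v - wW k *v v) = 0" for v
  proof (rule e_zero)
    have "wW k *v (v - wW k *v v) = 0" by (simp add: vec.diff ww_vec)
    then show "v - wW k *v v \<in> eB k p"
      using vec.subspace_0[OF subspace_cnjv[OF sX]] by (simp add: eB_def)
  qed
  then have "e k p *v v = e k p *v (wW k *v v)" for v by (simp add: vec.diff)
  then show ?thesis by (simp add: matrix_eq flip: matrix_vector_mul_assoc)
qed

lemma e_e_diff: "j \<noteq> k \<Longrightarrow> e j p ** e k q = 0"
proof -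
  assume "j \<noteq> k"
  have "e j p ** e k q = (e j p ** wW j) ** (wW k ** e k q)" by (simp add: w_e e_w)
  also have "\<dots> = e j p ** (wW j ** wW k) ** e k q" by (simp add: matrix_mul_assoc)
  finally show ?thesis using \<open>j \<noteq> k\<close> by (simp add: w_w)
qed

lemma cnjm_e: "cnjm (e k p) = wW k - e k (k - p + 1)"
proof -
  have "e k p = cnjm (wW k - e k (k - p + 1))" unfolding e_def[of k p]
  proof (rule proj_unique[OF e_compl])
    fix v :: "complex^'n"
    let ?u = "cnjv v" and ?e = "e k (k - p + 1)"
    have c: "cnjm (wW k - ?e) *v v = cnjv (wW k *v ?u - ?e *v ?u)"
      by (simp add: cnjm_diff cnjm_w cnjv_diff cnjv_mv algebra_simps)
    have "wW k *v (?u - ?e *v ?u) \<in> cnjv ` X k p" using e_diff[of ?u k "k - p + 1"] by (simp add: eB_def)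
    moreover have we: "wW k *v (?u - ?e *v ?u) = wW k *v ?u - ?e *v ?u"
      by (simp add: vec.diff matrix_vector_mul_assoc w_e)
    ultimately have "cnjm (wW k - ?e) *v v \<in> X k p" by (simp add: c cnjv_image_iff)
    moreover have "wW k *v (cnjm (wW k - ?e) *v v) = cnjm (wW k - ?e) *v v"
    proof -
      have "wW k *v cnjv x = cnjv (wW k *v x)" for x by (simp add: cnjv_mv cnjm_w)
      then show ?thesis unfolding c we[symmetric] by (simp add: ww_vec)
    qed
    ultimately show "cnjm (wW k - ?e) *v v \<in> eA k p" by (simp add: eA_def)
    have "wW k *v (v - cnjm (wW k - ?e) *v v) = cnjv (wW k *v ?u - wW k *v (wW k *v ?u - ?e *v ?u))"
      by (simp add: c vec.diff cnjv_diff cnjv_mv cnjm_w)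
    also have "\<dots> = cnjv (?e *v ?u)" by (simp add: vec.diff ww_vec matrix_vector_mul_assoc w_e w_w)
    finally show "v - cnjm (wW k - ?e) *v v \<in> eB k p"
      using e_in[of k "k - p + 1" ?u] by (simp add: eB_def eA_def)
  qed
  then show ?thesis by simp
qed

definition hpr :: "int \<times> int \<Rightarrow> complex^'n^'n" where "hpr x = e (wt x) (fst x) - e (wt x) (fst x + 1)"

lemma hpr_hpr: "hpr x ** hpr y = (if x = y then hpr x else 0)"
proof (cases "wt x = wt y")
  case False
  then show ?thesis by (auto simp: hpr_def mat_algebra e_e_diff)
next
  case True
  then have "x = y \<longleftrightarrow> fst x = fst y" by (auto simp: wt_def prod_eq_iff)
  note xy = this
  consider "fst x = fst y" | "fst x < fst y" | "fst y < fst x" by linarith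
  then show ?thesis
  proof cases
    case 1
    have "max (fst y) (fst y + 1) = fst y + 1" "max (fst y + 1) (fst y) = fst y + 1" by auto
    then show ?thesis using 1 xy by (simp add: hpr_def mat_algebra e_e True)
  next
    case 2
    then have "max (fst x) (fst y) = fst y" "max (fst x) (fst y + 1) = fst y + 1"
      "max (fst x + 1) (fst y) = fst y" "max (fst x + 1) (fst y + 1) = fst y + 1" by auto
    then show ?thesis using 2 xy by (simp add: hpr_def mat_algebra e_e True)
  next
    case 3
    then have "max (fst x) (fst y) = fst x" "max (fst x) (fst y + 1) = fst x"
      "max (fst x + 1) (fst y) = fst x + 1" "max (fst x + 1) (fst y + 1) = fst x + 1" by auto
    then show ?thesis using 3 xy by (simp add: hpr_def mat_algebra e_e True)
  qed
qed

lemma cnjm_hpr: "cnjm (hpr x) = hpr (prod.swap x)"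
proof -
  have "wt x - fst x + 1 = snd x + 1" "wt x - (fst x + 1) + 1 = snd x" by (auto simp: wt_def)
  then show ?thesis by (simp add: hpr_def cnjm_diff cnjm_e)
qed

lemma e_top: "F p = {0} \<Longrightarrow> e k p = 0"
proof -
  assume p: "F p = {0}"
  have "X k p \<subseteq> W (k - 1)" unfolding gr_ind_def p by (auto elim!: setplusE)
  then have "e k p *v v = 0" for v using e_in[of k p v] w_zero by (auto simp: eA_def)
  then show ?thesis by (simp add: matrix_eq)
qed

lemma e_fix_w: "v \<in> X k p \<Longrightarrow> e k p *v v = wW k *v v"
proof -
  assume v: "v \<in> X k p"
  have "e k p *v v = e k p *v (wW k *v v)" by (simp add: matrix_vector_mul_assoc e_w)
  also have "\<dots> = wW k *v v" by (rule e_fix) (simp add: eA_def w_X[OF v] ww_vec)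
  finally show ?thesis .
qed

lemma e_bot: "F p = UNIV \<Longrightarrow> e k p = wW k"
proof -
  assume p: "F p = UNIV"
  have "X k p = W k" using X_sub[of k p] vec.subspace_0[OF sW, of "k - 1"] unfolding gr_ind_def p
    by (auto simp: set_plus_def) (metis add.right_neutral)
  have "e k p *v v = wW k *v v" for v
  proof -
    have "e k p *v v = e k p *v (wW k *v v)" by (simp add: matrix_vector_mul_assoc e_w)
    also have "\<dots> = wW k *v (wW k *v v)" by (rule e_fix_w) (simp add: \<open>X k p = W k\<close> w_in)
    finally show ?thesis by (simp add: ww_vec)
  qed
  then show ?thesis by (simp add: matrix_eq)
qed

lemma sum_telescope_int:
  fixes f :: "int \<Rightarrow> 'a::ab_group_add"
  shows "a \<le> b \<Longrightarrow> (\<Sum>i\<in>{a..<b}. f i - f (i + 1)) = f a - f b"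
proof (induction b rule: int_ge_induct)
  case (step i)
  then have "{a..<i + 1} = insert i {a..<i}" by auto
  then show ?case using step by simp
qed simp

text \<open>Outside of a bounded range of indices, \<open>e k p\<close> is constant in \<open>p\<close> or zero. Inside, the projections \<open>hpr\<close>
  telescope to the identity, first over \<open>p\<close> and then over the weights.\<close>

theorem frame_exists:
  "\<exists>R. bigraded_frame hpr R \<and> (\<forall>k. W k = bigraded_frame.HW hpr k) \<and>
     (\<forall>k p. gr_ind F W k p = gr_ind (bigraded_frame.HF hpr) (bigraded_frame.HW hpr) k p)"
proof -
  obtain a b where a: "F a = UNIV" and b: "F b = {0}"
    using mhs unfolding mixed_hodge_structure_def decreasing_filtration_def by blast
  have iW: "increasing_filtration W" using mhs unfolding mixed_hodge_structure_def by (elim conjE)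
  obtain c where c: "W c = {0}" using iW unfolding increasing_filtration_def by (elim conjE exE)
  obtain d where d: "W d = UNIV" using iW unfolding increasing_filtration_def by (elim conjE exE)
  have Fa: "F p = UNIV" if "p \<le> a" for p using F_anti[OF that] a by auto
  have Fb: "F p = {0}" if "b \<le> p" for p using F_anti[OF that] b vec.subspace_0[OF sF, of p] by auto
  have Wc: "W k = {0}" if "k \<le> c" for k using W_mono[OF that] c vec.subspace_0[OF sW, of k] by auto
  have Wd: "W k = UNIV" if "d \<le> k" for k using W_mono[OF that] d by auto
  have ne: "(UNIV :: (complex^'n) set) \<noteq> {0}"
  proof
    assume "(UNIV :: (complex^'n) set) = {0}"
    then have "(1::complex^'n) = 0" by blast
    then show False by (simp add: vec_eq_iff)
  qed
  have ab: "a \<le> b"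
  proof (rule ccontr)
    assume "\<not> a \<le> b"
    then show False using Fa[of b] b ne by simp
  qed
  have cd: "c \<le> d"
  proof (rule ccontr)
    assume "\<not> c \<le> d"
    then show False using Wd[of c] c ne by simp
  qed
  define R where "R = (\<lambda>(k, p). (p, k - p)) ` ({c + 1..<d + 1} \<times> {a..<b})"
  have q0: "qW k = 0" if "k \<le> c" for k using q_in[of k] Wc[OF that] by (simp add: matrix_eq)
  have q1: "qW k = mat 1" if "d \<le> k" for k using q_fix[of _ k] Wd[OF that] by (simp add: matrix_eq)
  have w0: "wW k = 0" if "k \<notin> {c + 1..<d + 1}" for k
    using that q0[of k] q0[of "k - 1"] q1[of k] q1[of "k - 1"] by (cases "k \<le> c") (auto simp: wW_def)
  have out: "hpr x = 0" if x: "x \<notin> R" for x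
  proof (cases "wt x \<in> {c + 1..<d + 1}")
    case False
    then have "e (wt x) p = 0" for p using w_e[of "wt x" p] w0 by simp
    then show ?thesis by (simp add: hpr_def)
  next
    case True
    have "fst x \<notin> {a..<b}"
    proof
      assume "fst x \<in> {a..<b}"
      then have "x \<in> R" unfolding R_def using True
        by (intro image_eqI[of _ _ "(wt x, fst x)"]) (auto simp: wt_def prod_eq_iff)
      then show False using x by simp
    qed
    then have "fst x < a \<or> b \<le> fst x" by auto
    then show ?thesis
    proof
      assume "fst x < a"
      then show ?thesis using e_bot[OF Fa[of "fst x"]] e_bot[OF Fa[of "fst x + 1"]] by (simp add: hpr_def)
    next
      assume "b \<le> fst x"
      then show ?thesis using e_top[OF Fb[of "fst x"]] e_top[OF Fb[of "fst x + 1"]] by (simp add: hpr_def)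
    qed
  qed
  have "(\<Sum>x\<in>R. hpr x) = (\<Sum>(k, p)\<in>{c + 1..<d + 1} \<times> {a..<b}. e k p - e k (p + 1))"
    unfolding R_def by (subst sum.reindex) (auto simp: inj_on_def hpr_def case_prod_beta)
  also have "\<dots> = (\<Sum>k\<in>{c + 1..<d + 1}. \<Sum>p\<in>{a..<b}. e k p - e k (p + 1))"
    by (simp add: sum.cartesian_product)
  also have "\<dots> = (\<Sum>k\<in>{c + 1..<d + 1}. wW k)"
    using sum_telescope_int[OF ab, of "e _"] e_bot[OF a] e_top[OF b] by simp
  also have "\<dots> = - (\<Sum>k\<in>{c + 1..<d + 1}. qW (k - 1) - qW (k + 1 - 1))"
    by (simp add: wW_def sum_negf[symmetric])
  also have "(\<Sum>k\<in>{c + 1..<d + 1}. qW (k - 1) - qW (k + 1 - 1)) = qW (c + 1 - 1) - qW (d + 1 - 1)"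
    using cd by (intro sum_telescope_int) simp
  also have "- (qW (c + 1 - 1) - qW (d + 1 - 1)) = mat 1" using q0[of c] q1[of d] by simp
  finally have sum: "(\<Sum>x\<in>R. hpr x) = mat 1" .
  have frame: "bigraded_frame hpr R"
    by unfold_locales (auto simp: R_def[symmetric] out hpr_hpr sum cnjm_hpr, simp add: R_def)
  interpret fr: bigraded_frame hpr R by (rule frame)
  have hw: "hpr x *v (wW (wt x) *v v) = hpr x *v v" for x v
    by (simp add: matrix_vector_mul_assoc hpr_def mat_algebra e_w)
  have hin: "hpr x *v v \<in> X (wt x) (fst x)" for x v
  proof -
    have "e (wt x) (fst x) *v v \<in> X (wt x) (fst x)" using e_in[of "wt x" "fst x" v] by (simp add: eA_def)
    moreover have "e (wt x) (fst x + 1) *v v \<in> X (wt x) (fst x)"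
      using e_in[of "wt x" "fst x + 1" v] X_anti[of "fst x" "fst x + 1" "wt x"] by (auto simp: eA_def)
    ultimately have "e (wt x) (fst x) *v v - e (wt x) (fst x + 1) *v v \<in> X (wt x) (fst x)"
      by (rule vec.subspace_diff[OF sX])
    then show ?thesis by (simp add: hpr_def algebra_simps)
  qed
  have WHW: "W k = fr.HW k" for k
  proof
    show "W k \<subseteq> fr.HW k"
    proof
      fix v assume v: "v \<in> W k"
      have "hpr x *v v = 0" if "k < wt x" for x
        using hw[of x v] w_low[OF v that] by simp
      then show "v \<in> fr.HW k" by (auto simp: fr.HW_def fr.sec_def)
    qed
    show "fr.HW k \<subseteq> W k"
    proof
      fix v assume v: "v \<in> fr.HW k"
      have "(\<Sum>x\<in>R. hpr x *v v) \<in> W k"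
      proof (rule vec.subspace_sum[OF sW])
        fix x
        show "hpr x *v v \<in> W k"
        proof (cases "wt x \<le> k")
          case True
          then show ?thesis using hin[of x v] X_sub W_mono by blast
        next
          case False
          then have "hpr x *v v = 0" using v by (auto simp: fr.HW_def fr.sec_def)
          then show ?thesis using vec.subspace_0[OF sW] by simp
        qed
      qed
      then show "v \<in> W k" by (simp flip: fr.vec_decomp)
    qed
  qed
  have XG: "X k p = gr_ind fr.HF fr.HW k p" for k p
    unfolding fr.gr_HF
  proof
    show "X k p \<subseteq> fr.sec ({x. p \<le> fst x \<and> wt x = k} \<union> {x. wt x < k})"
    proof
      fix v assume v: "v \<in> X k p"
      have "hpr x *v v = 0" if "x \<notin> {x. p \<le> fst x \<and> wt x = k} \<union> {x. wt x < k}" for x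
      proof (cases "k < wt x")
        case True
        then show ?thesis using v X_sub[of k p] WHW[of k] by (auto simp: fr.HW_def fr.sec_def)
      next
        case False
        then have x: "wt x = k" "fst x < p" using that by auto
        then have "v \<in> X k (fst x)" "v \<in> X k (fst x + 1)" using v X_anti[of "fst x" p k] X_anti[of "fst x + 1" p k] by auto
        then show ?thesis using x(1) by (simp add: hpr_def algebra_simps e_fix_w)
      qed
      then show "v \<in> fr.sec ({x. p \<le> fst x \<and> wt x = k} \<union> {x. wt x < k})" by (simp add: fr.sec_def)
    qed
    show "fr.sec ({x. p \<le> fst x \<and> wt x = k} \<union> {x. wt x < k}) \<subseteq> X k p"
    proof
      fix v assume v: "v \<in> fr.sec ({x. p \<le> fst x \<and> wt x = k} \<union> {x. wt x < k})"
      have "(\<Sum>x\<in>R. hpr x *v v) \<in> X k p"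
      proof (rule vec.subspace_sum[OF sX])
        fix x
        consider "p \<le> fst x \<and> wt x = k" | "wt x < k" | "x \<notin> {x. p \<le> fst x \<and> wt x = k} \<union> {x. wt x < k}" by auto
        then show "hpr x *v v \<in> X k p"
        proof cases
          case 1
          then show ?thesis using hin[of x v] X_anti[of p "fst x" k] by auto
        next
          case 2
          then have "hpr x *v v \<in> W (k - 1)" using hin[of x v] X_sub[of "wt x" "fst x"] W_mono[of "wt x" "k - 1"] by auto
          then show ?thesis using W_sub by blast
        next
          case 3
          then have "hpr x *v v = 0" using v by (simp add: fr.sec_def)
          then show ?thesis using vec.subspace_0[OF sX] by simp
        qed
      qed
      then show "v \<in> X k p" by (simp flip: fr.vec_decomp)
    qed
  qed
  show ?thesis using frame WHW XG by blast
qed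

end

section \<open>The relative weight filtration\<close>

lemma gr_ind_self:
  assumes W: "increasing_filtration (W :: 'n::finite filtration)"
  shows "gr_ind W W k j = (if k \<le> j then W k else W (k - 1))"
proof -
  have s: "vec.subspace (W i)" for i using W by (simp add: increasing_filtration_def)
  have m: "W i \<subseteq> W j" if "i \<le> j" for i j using W that by (auto simp: increasing_filtration_def dest: monoD)
  have add: "A + B = A" if "B \<subseteq> A" "vec.subspace A" "0 \<in> B" for A B :: "(complex^'n) set"
  proof
    show "A + B \<subseteq> A" using that vec.subspace_add[OF that(2)] by (auto elim!: setplusE)
    show "A \<subseteq> A + B"
    proof
      fix a assume "a \<in> A"
      then have "a + 0 \<in> A + B" using that(3) by (rule set_plus_intro)
      then show "a \<in> A + B" by simp
    qed
  qed
  show ?thesis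
  proof (cases "k \<le> j")
    case True
    have "W j \<inter> W k = W k" using m[OF True] by blast
    then show ?thesis using True add[OF m[of "k - 1" k] s] vec.subspace_0[OF s] by (simp add: gr_ind_def)
  next
    case False
    then have "W j \<inter> W k = W j" using m[of j k] by auto
    moreover have "W j + W (k - 1) = W (k - 1)"
      using add[OF m[of j "k - 1"] s] False vec.subspace_0[OF s] by (simp add: add.commute)
    ultimately show ?thesis using False by (simp add: gr_ind_def)
  qed
qed

text \<open>As \<open>N\<close> acts trivially on the graded pieces, the monodromy weight filtration there has a
  single jump, so that \<open>W\<close> is the only candidate for the relative weight filtration.\<close>

lemma relative_weight_filtration_iff:
  fixes W :: "'n::finite filtration"
  assumes W: "increasing_filtration W" and N: "\<And>k. (*v) N ` W k \<subseteq> W (k - 1)"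
  shows "(\<exists>M. relative_weight_filtration N W M) \<longleftrightarrow> (\<forall>k. (*v) N ` W k \<subseteq> W (k - 2))"
proof
  have s: "vec.subspace (W i)" for i using W by (simp add: increasing_filtration_def)
  have m: "W i \<subseteq> W j" if "i \<le> j" for i j using W that by (auto simp: increasing_filtration_def dest: monoD)
  have Npow: "matpow N l *v v \<in> W (k - 1)" if "1 \<le> l" "v \<in> W k" for l v k
    using that
  proof (induction l rule: dec_induct)
    case base
    then show ?case using N by auto
  next
    case (step l)
    then have "matpow N l *v v \<in> W (k - 1)" by simp
    then have "N *v (matpow N l *v v) \<in> W (k - 1 - 1)" using N by blast
    then show ?case using m[of "k - 1 - 1" "k - 1"] by (auto simp: matpow_Suc matrix_vector_mul_assoc)
  qed
  {
    assume N2: "\<forall>k. (*v) N ` W k \<subseteq> W (k - 2)"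
    have "monodromy_weight_filtration N (W k) (W (k - 1)) (\<lambda>l. gr_ind W W k (l + k))" for k
    proof -
      have g: "gr_ind W W k (l + k) = (if 0 \<le> l then W k else W (k - 1))" for l
        by (simp add: gr_ind_self[OF W])
      have N1: "(*v) N ` W (k - 1) \<subseteq> W (k - 1)" using N[of "k - 1"] m[of "k - 1 - 1" "k - 1"] by simp
      show ?thesis
        unfolding monodromy_weight_filtration_def g
      proof (intro conjI allI)
        show "vec.subspace (if 0 \<le> l then W k else W (k - 1))" for l :: int by (simp add: s)
        show "mono (\<lambda>l::int. if 0 \<le> l then W k else W (k - 1))" using m[of "k - 1" k] by (auto simp: mono_def)
        show "\<exists>a::int. (if 0 \<le> a then W k else W (k - 1)) = W (k - 1)" by (rule exI[of _ "- 1"]) simp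
        show "\<exists>b::int. (if 0 \<le> b then W k else W (k - 1)) = W k" by (rule exI[of _ 0]) simp
        show "W (k - 1) \<subseteq> (if 0 \<le> l then W k else W (k - 1))"
          "(if 0 \<le> l then W k else W (k - 1)) \<subseteq> W k" for l :: int
          using m[of "k - 1" k] by auto
        show "(*v) N ` (if 0 \<le> l then W k else W (k - 1)) \<subseteq> (if 0 \<le> l - 2 then W k else W (k - 1))" for l :: int
        proof (cases "0 \<le> l")
          case True
          then show ?thesis using N[of k] m[of "k - 1" k] by (cases "0 \<le> l - 2") auto
        next
          case False
          then show ?thesis using N1 by simp
        qed
        fix l :: nat
        show "\<forall>v\<in>if 0 \<le> int l then W k else W (k - 1). matpow N l *v v \<in> (if 0 \<le> - int l - 1 then W k else W (k - 1)) \<longrightarrow>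
            v \<in> (if 0 \<le> int l - 1 then W k else W (k - 1))"
          by (cases l) auto
        show "\<forall>w\<in>if 0 \<le> - int l then W k else W (k - 1). \<exists>v\<in>if 0 \<le> int l then W k else W (k - 1).
            w - matpow N l *v v \<in> (if 0 \<le> - int l - 1 then W k else W (k - 1))"
        proof (cases l)
          case 0
          then show ?thesis using vec.subspace_0[OF s[of "k - 1"]] by simp (metis diff_self)
        next
          case (Suc n)
          then show ?thesis using vec.subspace_0[OF s[of k]] by (auto intro!: bexI[of _ 0])
        qed
      qed
    qed
    then have "relative_weight_filtration N W W"
      using W N2 by (simp add: relative_weight_filtration_def)
    then show "\<exists>M. relative_weight_filtration N W M" by blast
  }
  assume "\<exists>M. relative_weight_filtration N W M"
  then obtain M where M: "relative_weight_filtration N W M" by blast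
  have iM: "increasing_filtration M" and NM: "\<And>k. (*v) N ` M k \<subseteq> M (k - 2)"
    and mw: "\<And>k. monodromy_weight_filtration N (W k) (W (k - 1)) (\<lambda>l. gr_ind M W k (l + k))"
    using M by (auto simp: relative_weight_filtration_def)
  have sM: "vec.subspace (M i)" for i using iM by (simp add: increasing_filtration_def)
  have mM: "M i \<subseteq> M j" if "i \<le> j" for i j using iM that by (auto simp: increasing_filtration_def dest: monoD)
  have gr: "gr_ind M W k k = W k" "gr_ind M W k (k - 1) = W (k - 1)" for k
  proof -
    define L where "L l = gr_ind M W k (l + k)" for l
    have mono: "mono L" and ex: "\<exists>a. L a = W (k - 1)" "\<exists>b. L b = W k"
      and sub: "\<And>l. W (k - 1) \<subseteq> L l" "\<And>l. L l \<subseteq> W k"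
      and inj: "\<And>l v. v \<in> L (int l) \<Longrightarrow> matpow N l *v v \<in> L (- int l - 1) \<Longrightarrow> v \<in> L (int l - 1)"
      and surj: "\<And>l w. w \<in> L (- int l) \<Longrightarrow> \<exists>v \<in> L (int l). w - matpow N l *v v \<in> L (- int l - 1)"
      using mw[of k] unfolding monodromy_weight_filtration_def L_def[symmetric] by blast+
    have "\<forall>l. vec.subspace (L l)"
      using mw[of k] unfolding monodromy_weight_filtration_def L_def[symmetric] by (rule conjunct1)
    then have sL: "vec.subspace (L l)" for l by (rule spec)
    have up: "L (int l) \<subseteq> L 0" for l
    proof (induction l)
      case (Suc l)
      have "v \<in> L (int l)" if v: "v \<in> L (int (Suc l))" for v
      proof -
        have "matpow N (Suc l) *v v \<in> W (k - 1)" using v sub(2) by (intro Npow) auto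
        then have "matpow N (Suc l) *v v \<in> L (- int (Suc l) - 1)" using sub(1) by blast
        from inj[OF v this] show ?thesis by simp
      qed
      then show ?case using Suc by blast
    qed simp
    have down: "L (- 1) \<subseteq> L (- 1 - int l)" for l
    proof (induction l)
      case (Suc l)
      have "w \<in> L (- 1 - int (Suc l))" if w: "w \<in> L (- int (Suc l))" for w
      proof -
        obtain v where v: "v \<in> L (int (Suc l))" "w - matpow N (Suc l) *v v \<in> L (- int (Suc l) - 1)"
          using surj[OF w] by blast
        have "matpow N (Suc l) *v v \<in> W (k - 1)" using v sub(2) by (intro Npow) auto
        then have "matpow N (Suc l) *v v \<in> L (- int (Suc l) - 1)" using sub(1) by blast
        from vec.subspace_add[OF sL v(2) this] show ?thesis by (simp add: algebra_simps)
      qed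
      then have "L (- 1 - int l) \<subseteq> L (- 1 - int (Suc l))" by (auto simp: algebra_simps)
      then show ?case using Suc by blast
    qed simp
    obtain b where b: "L b = W k" using ex by blast
    have "W k \<subseteq> L (int (nat b))" using b monoD[OF mono, of b "int (nat b)"] by simp
    then have "L 0 = W k" using up sub(2) by blast
    then show "gr_ind M W k k = W k" by (simp add: L_def)
    obtain a where a: "L a = W (k - 1)" using ex by blast
    have "L (- 1 - int (nat (- a))) \<subseteq> L a" by (rule monoD[OF mono]) simp
    then have "L (- 1) = W (k - 1)" using down[of "nat (- a)"] a sub(1) by blast
    then show "gr_ind M W k (k - 1) = W (k - 1)" by (simp add: L_def)
  qed
  obtain c where c: "W c = {0}" using W unfolding increasing_filtration_def by (elim conjE exE)
  obtain d where d: "W d = UNIV" using W unfolding increasing_filtration_def by (elim conjE exE)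
  have WM: "W k \<subseteq> M k" for k
  proof (cases "c \<le> k")
    case True
    then show ?thesis
    proof (induction k rule: int_ge_induct)
      case base
      then show ?case using c vec.subspace_0[OF sM] by auto
    next
      case (step i)
      show ?case
      proof
        fix v assume "v \<in> W (i + 1)"
        then have "v \<in> gr_ind M W (i + 1) (i + 1)" by (simp add: gr)
        then obtain a b where "a \<in> M (i + 1) \<inter> W (i + 1)" "b \<in> W (i + 1 - 1)" "v = a + b"
          unfolding gr_ind_def by (rule setplusE)
        moreover have "b \<in> M (i + 1)" using calculation(2) step(2) mM[of i "i + 1"] by auto
        ultimately show "v \<in> M (i + 1)" using vec.subspace_add[OF sM] by blast
      qed
    qed
  next
    case False
    then have "W k \<subseteq> {0}" using m[of k c] c by auto
    then show ?thesis using vec.subspace_0[OF sM] by blast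
  qed
  have MW1: "M (k - 1) \<inter> W k \<subseteq> W (k - 1)" for k
  proof
    fix v assume "v \<in> M (k - 1) \<inter> W k"
    then have "v + 0 \<in> gr_ind M W k (k - 1)"
      unfolding gr_ind_def using vec.subspace_0[OF s] by (intro set_plus_intro)
    then show "v \<in> W (k - 1)" by (simp add: gr)
  qed
  have MW: "M j \<inter> W (j + int n) \<subseteq> W j" for j n
  proof (induction n)
    case (Suc n)
    have "M j \<subseteq> M (j + int n)" by (rule mM) simp
    then have "M j \<inter> W (j + int (Suc n)) \<subseteq> W (j + int n)" using MW1[of "j + int (Suc n)"] by (auto simp: algebra_simps)
    then show ?case using Suc by blast
  qed simp
  have MWj: "M j \<subseteq> W j" for j
  proof -
    have "W d \<subseteq> W (j + int (nat (d - j)))" by (rule m) simp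
    then show ?thesis using MW[of j "nat (d - j)"] d by auto
  qed
  have "W k = M k" for k using WM MWj by blast
  then show "\<forall>k. (*v) N ` W k \<subseteq> W (k - 2)" using NM by simp
qed

section \<open>Limits of gradings and filtrations\<close>

lemma closed_vec_subspace: "vec.subspace A \<Longrightarrow> closed (A :: (complex^'n) set)"
  by (intro closed_subspace subspace_real)

lemma dim_set_plus:
  fixes A B :: "(complex^'n) set"
  assumes "vec.subspace A" "vec.subspace B"
  shows "vec.dim (A + B) + vec.dim (A \<inter> B) = vec.dim A + vec.dim B"
proof -
  have "{x + y |x y. x \<in> A \<and> y \<in> B} = A + B" by (auto simp: set_plus_def)
  then show ?thesis using vec.dim_sums_Int[OF assms] by simp
qed

lemma seq_to_0: "filterlim (\<lambda>i. complex_of_real (1 / real (Suc i))) (at 0) sequentially"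
proof -
  have "(\<lambda>i. 1 / real (Suc i)) \<longlonglongrightarrow> 0" using LIMSEQ_Suc[OF lim_1_over_n] by simp
  then have "(\<lambda>i. complex_of_real (1 / real (Suc i))) \<longlonglongrightarrow> complex_of_real 0" by (rule tendsto_of_real)
  moreover have "complex_of_real (1 / real (Suc i)) \<noteq> 0" for i by (simp only: of_real_eq_0_iff) simp
  ultimately show ?thesis unfolding filterlim_at of_real_0 by (intro conjI always_eventually allI) blast+
qed

text \<open>Otherwise a complement \<open>K\<close> of \<open>E0 \<inter> U \<inter> G\<close> is too large to meet the spaces \<open>E s \<inter> U\<close> in \<open>0\<close>,
  and a limit of unit vectors in these intersections lies in \<open>K \<inter> E0 \<inter> U \<inter> G = 0\<close>.\<close>

lemma limit_Int_subset:
  fixes E :: "complex \<Rightarrow> (complex^'n) set"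
  assumes lim: "subspace_tendsto E E0 (at 0)"
    and sub: "vec.subspace E0" "vec.subspace U" "vec.subspace G"
    and ev: "\<forall>\<^sub>F s in at 0. vec.subspace (E s) \<and> E s \<inter> U \<subseteq> G \<and> vec.dim (E s \<inter> U) = vec.dim (E0 \<inter> U)"
  shows "E0 \<inter> U \<subseteq> G"
proof (rule ccontr)
  assume no: "\<not> E0 \<inter> U \<subseteq> G"
  define Z where "Z = E0 \<inter> U \<inter> G"
  have sZ: "vec.subspace Z" and sEU: "vec.subspace (E0 \<inter> U)"
    unfolding Z_def using sub by (auto intro!: vec.subspace_inter)
  have "Z \<subset> E0 \<inter> U" using no by (auto simp: Z_def)
  then have dZ: "vec.dim Z < vec.dim (E0 \<inter> U)"
    by (intro vec.dim_psubset) (simp add: vec.span_eq_iff[THEN iffD2] sZ sEU)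
  define K where "K = perp Z"
  have c: "complementary Z K" unfolding K_def by (rule complementary_perp[OF sZ])
  have sK: "vec.subspace K" using c by (simp add: complementary_def)
  have "Z + K = UNIV"
  proof -
    have "v \<in> Z + K" for v
    proof -
      obtain a where "a \<in> Z" "v - a \<in> K" using c unfolding complementary_def by blast
      then have "a + (v - a) \<in> Z + K" by (rule set_plus_intro)
      then show ?thesis by simp
    qed
    then show ?thesis by blast
  qed
  moreover have "Z \<inter> K = {0}" using c by (simp add: complementary_def)
  ultimately have dK: "CARD('n) = vec.dim Z + vec.dim K"
    using dim_set_plus[OF sZ sK] vec_dim_card[where 'a=complex and 'n='n] by simp
  obtain B :: "complex \<Rightarrow> complex^'n^'n" and B0 J where B: "(B \<longlongrightarrow> B0) (at 0)" "invertible B0"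
    "E0 = (*v) B0 ` coord_subspace J" "\<forall>\<^sub>F s in at 0. E s = (*v) (B s) ` coord_subspace J"
    using lim unfolding subspace_tendsto_def by blast
  define P where "P s v \<longleftrightarrow> norm v = 1 \<and> v \<in> U \<and> v \<in> G \<and> v \<in> K \<and> invertible (B s) \<and> matrix_inv (B s) *v v \<in> coord_subspace J" for s v
  have "\<forall>\<^sub>F s in at 0. \<exists>v. P s v"
    using ev B(4) tendsto_mat_inv(1)[OF B(1,2)]
  proof eventually_elim
    case (elim s)
    have sE: "vec.subspace (E s \<inter> U)" using elim sub by (auto intro: vec.subspace_inter)
    have "vec.dim ((E s \<inter> U) + K) \<le> CARD('n)" by (rule dim_subset_UNIV_cart_gen)
    then have "vec.dim ((E s \<inter> U) \<inter> K) \<noteq> 0"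
      using dim_set_plus[OF sE sK] elim(1) dK dZ by linarith
    then obtain v where v: "v \<in> E s" "v \<in> U" "v \<in> K" "v \<noteq> 0" by auto
    define w where "w = complex_of_real (inverse (norm v)) *s v"
    have "w = inverse (norm v) *\<^sub>R v"
      unfolding w_def vec_eq_iff vector_scaleR_component vector_smult_component by (simp add: scaleR_conv_of_real)
    then have nw: "norm w = 1" using v(4) by simp
    have w: "w \<in> E s \<inter> U" "w \<in> K"
      using vec.subspace_scale[OF sE, of v] vec.subspace_scale[OF sK v(3)] v unfolding w_def by auto
    then have "matrix_inv (B s) *v w \<in> coord_subspace J" using elim(2,3) image_mat_inv_iff[of "B s" w] by auto
    then show ?case using nw w elim unfolding P_def by blast
  qed
  define \<sigma> where "\<sigma> i = complex_of_real (1 / real (Suc i))" for i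
  have \<sigma>: "filterlim \<sigma> (at 0) sequentially" using seq_to_0 by (simp add: \<sigma>_def[abs_def])
  have "\<forall>\<^sub>F i in sequentially. \<exists>v. P (\<sigma> i) v"
    using eventually_compose_filterlim[OF \<open>\<forall>\<^sub>F s in at 0. \<exists>v. P s v\<close> \<sigma>] .
  then obtain n0 where n0: "\<And>i. n0 \<le> i \<Longrightarrow> \<exists>v. P (\<sigma> i) v" by (auto simp: eventually_sequentially)
  then have "\<forall>i. \<exists>v. P (\<sigma> (i + n0)) v" by simp
  from choice[OF this] obtain v where v: "\<And>i. P (\<sigma> (i + n0)) (v i)" by blast
  have "compact (sphere (0 :: complex^'n) 1)" by simp
  moreover have "\<forall>i. v i \<in> sphere 0 1" using v by (simp add: P_def)
  ultimately obtain l r where l: "l \<in> sphere 0 1" "strict_mono r" "(v \<circ> r) \<longlonglongrightarrow> l"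
    unfolding compact_def by blast
  have mem: "l \<in> A" if "vec.subspace A" "\<And>i. v i \<in> A" for A
    using closed_sequentially[OF closed_vec_subspace[OF that(1)] _ l(3)] that(2) by simp
  have lUGK: "l \<in> U" "l \<in> G" "l \<in> K" using mem sub sK v unfolding P_def by blast+
  have "filterlim (\<lambda>i. \<sigma> (r i + n0)) (at 0) sequentially"
    using filterlim_compose[OF \<sigma> filterlim_add_const_nat_at_top[of n0, THEN filterlim_compose, OF filterlim_subseq[OF l(2)]]]
    by simp
  then have "(\<lambda>i. B (\<sigma> (r i + n0))) \<longlonglongrightarrow> B0" using B(1) filterlim_compose by blast
  then have "(\<lambda>i. matrix_inv (B (\<sigma> (r i + n0)))) \<longlonglongrightarrow> matrix_inv B0" by (rule tendsto_mat_inv(2)[OF _ B(2)])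
  from tendsto_mat_vec[OF this l(3)]
  have lim2: "(\<lambda>i. matrix_inv (B (\<sigma> (r i + n0))) *v v (r i)) \<longlonglongrightarrow> matrix_inv B0 *v l" by (simp add: o_def)
  have "matrix_inv B0 *v l \<in> coord_subspace J"
    unfolding coord_subspace_def
  proof (intro CollectI allI impI)
    fix j assume "j \<notin> J"
    then have "(matrix_inv (B (\<sigma> (r i + n0))) *v v (r i)) $ j = 0" for i
      using v[of "r i"] unfolding P_def coord_subspace_def by blast
    then have "(\<lambda>i. 0) \<longlonglongrightarrow> (matrix_inv B0 *v l) $ j" using tendsto_vec_nth[OF lim2, of j] by simp
    then show "(matrix_inv B0 *v l) $ j = 0" by (simp add: LIMSEQ_const_iff)
  qed
  then have "l \<in> E0" unfolding B(3) image_mat_inv_iff[OF B(2)] .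
  then have "l \<in> Z \<inter> K" using lUGK by (simp add: Z_def)
  then have "l = 0" using complementary_Int[OF c] by blast
  then show False using l(1) by simp
qed

context bigraded_frame
begin

lemma dim_Int_HW:
  assumes F: "\<And>p. vec.subspace (F p)" and F': "\<And>p. vec.subspace (F' p)"
    and eq: "\<And>k. vec.dim (gr_ind F HW k p) = vec.dim (gr_ind F' HW k p)"
  shows "vec.dim (F p \<inter> HW k) = vec.dim (F' p \<inter> HW k)"
proof -
  obtain k0 where k0: "\<And>k. k \<le> k0 \<Longrightarrow> HW k = {0}" using HW_low by blast
  have zero: "vec.dim (F p \<inter> HW k) = vec.dim (F' p \<inter> HW k)" if "k \<le> k0" for k
    using k0[OF that] vec.subspace_0[OF F] vec.subspace_0[OF F'] by simp
  have dimf: "vec.dim (gr_ind H HW k p) + vec.dim (H p \<inter> HW (k - 1)) = vec.dim (H p \<inter> HW k) + vec.dim (HW (k - 1))"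
    if H: "\<And>p. vec.subspace (H p)" for H :: "'n filtration" and k
  proof -
    have "HW (k - 1) \<subseteq> HW k" unfolding HW_def by (rule sec_mono) auto
    then have "H p \<inter> HW k \<inter> HW (k - 1) = H p \<inter> HW (k - 1)" by blast
    then show ?thesis
      using dim_set_plus[OF vec.subspace_inter[OF H subspace_HW] subspace_HW, of p k "k - 1"] by (simp add: gr_ind_def)
  qed
  show ?thesis
  proof (cases "k \<le> k0")
    case False
    then have "k0 \<le> k" by simp
    then show ?thesis
    proof (induction k rule: int_ge_induct)
      case (step i)
      then show ?case using dimf[of F "i + 1", OF F] dimf[of F' "i + 1", OF F'] eq[of "i + 1"] by simp
    qed (simp add: zero)
  qed (rule zero)
qed

text \<open>The prescribed dimensions of the graded pieces prevent the dimension of \<open>F p \<inter> HW k\<close> from jumping in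
  the limit. Hence every vector of \<open>Finf p \<inter> HW k\<close> is confined to the constant space
  \<open>gr_ind HF HW k p\<close>.\<close>

lemma limit_same_gr:
  fixes F :: "complex \<Rightarrow> 'n filtration"
  assumes Finf: "decreasing_filtration Finf"
    and dims: "\<And>k p. vec.dim (gr_ind Finf HW k p) = vec.dim (gr_ind HF HW k p)"
    and lim: "\<And>p. subspace_tendsto (\<lambda>s. F s p) (Finf p) (at 0)"
    and ev: "\<forall>\<^sub>F s in at 0. same_gr (F s)"
  shows "same_gr Finf"
proof -
  have sI: "vec.subspace (Finf p)" for p using Finf by (simp add: decreasing_filtration_def)
  have sG: "vec.subspace (gr_ind HF HW k p)" for k p unfolding gr_HF by (rule subspace_sec)
  have WG: "HW (k - 1) \<subseteq> gr_ind HF HW k p" for k p unfolding gr_HF HW_def by (rule sec_mono) auto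
  have "gr_ind Finf HW k p = gr_ind HF HW k p" for k p
  proof -
    have "Finf p \<inter> HW k \<subseteq> gr_ind HF HW k p"
    proof (rule limit_Int_subset[OF lim sI subspace_HW sG])
      show "\<forall>\<^sub>F s in at 0. vec.subspace (F s p) \<and> F s p \<inter> HW k \<subseteq> gr_ind HF HW k p \<and>
          vec.dim (F s p \<inter> HW k) = vec.dim (Finf p \<inter> HW k)"
        using ev
      proof eventually_elim
        case (elim s)
        have sF: "vec.subspace (F s p)" for p using elim by (simp add: same_gr_def)
        have gr: "gr_ind (F s) HW k p = gr_ind HF HW k p" for k using elim by (simp add: same_gr_def)
        have "v \<in> gr_ind HF HW k p" if "v \<in> F s p \<inter> HW k" for v
        proof -
          have "v + 0 \<in> gr_ind (F s) HW k p"
            unfolding gr_ind_def using that vec.subspace_0[OF subspace_HW] by (intro set_plus_intro)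
          then show ?thesis by (simp add: gr)
        qed
        moreover have "vec.dim (F s p \<inter> HW k) = vec.dim (Finf p \<inter> HW k)"
          using dims gr by (intro dim_Int_HW sF sI) simp
        ultimately show ?case using sF by blast
      qed
    qed
    note FG = this
    have "gr_ind Finf HW k p \<subseteq> gr_ind HF HW k p"
    proof
      fix v assume "v \<in> gr_ind Finf HW k p"
      then obtain a b where ab: "a \<in> Finf p \<inter> HW k" "b \<in> HW (k - 1)" "v = a + b"
        unfolding gr_ind_def by (rule setplusE)
      then have "a \<in> gr_ind HF HW k p" "b \<in> gr_ind HF HW k p" using FG WG by blast+
      then show "v \<in> gr_ind HF HW k p" unfolding ab(3) by (rule vec.subspace_add[OF sG])
    qed
    moreover have "vec.subspace (gr_ind Finf HW k p)"
    proof -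
      have "{x + y |x y. x \<in> Finf p \<inter> HW k \<and> y \<in> HW (k - 1)} = gr_ind Finf HW k p"
        unfolding gr_ind_def set_plus_def by auto
      then show ?thesis
        using vec.subspace_sums[OF vec.subspace_inter[OF sI subspace_HW] subspace_HW, of p k "k - 1"] by simp
    qed
    ultimately show ?thesis using dims sG by (intro vec.subspace_dim_equal) auto
  qed
  then show ?thesis using Finf by (simp add: same_gr_def decreasing_filtration_def)
qed

subsection \<open>Gradings\<close>

lemma pr_YR: "pr x *v (YR *v v) = of_int (wt x) *s (pr x *v v)"
proof -
  have "pr x *v (YR *v v) = (\<Sum>y\<in>R. if y = x then of_int (wt x) *s (pr x *v v) else 0)"
    unfolding YR_def sum_mat_vec vec.sum
    by (rule sum.cong) (auto simp: mat_scalar_vec mv_scale pr_pr_vec)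
  then show ?thesis using finR pr_out[of x] by (cases "x \<in> R") (auto simp: sum.delta)
qed

lemma int_eigenspace_YR: "int_eigenspace YR j = sec {x. wt x = j}"
proof
  show "int_eigenspace YR j \<subseteq> sec {x. wt x = j}"
  proof
    fix v assume "v \<in> int_eigenspace YR j"
    then have "YR *v v = of_int j *s v" by (simp add: int_eigenspace_def)
    then have "pr x *v (YR *v v) = pr x *v (of_int j *s v)" for x by (simp only:)
    then have e: "of_int (wt x) *s (pr x *v v) = of_int j *s (pr x *v v)" for x
      by (simp only: pr_YR mv_scale)
    have "pr x *v v = 0" if "wt x \<noteq> j" for x using that e[of x] by (simp add: vec.scale_cancel_right)
    then show "v \<in> sec {x. wt x = j}" by (simp add: sec_def)
  qed
  show "sec {x. wt x = j} \<subseteq> int_eigenspace YR j"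
  proof
    fix v assume v: "v \<in> sec {x. wt x = j}"
    have "YR *v v = of_int j *s v"
    proof (rule vec_eqI)
      fix x show "pr x *v (YR *v v) = pr x *v (of_int j *s v)"
        using v by (cases "wt x = j") (auto simp: pr_YR mv_scale sec_def)
    qed
    then show "v \<in> int_eigenspace YR j" by (simp add: int_eigenspace_def)
  qed
qed

lemma grading_of_conj:
  assumes g: "UT NegT g"
  shows "grading_of (g ** YR ** matrix_inv g) HW"
proof -
  have ig: "invertible g" by (rule UT_inv(1)[OF add_closed_types(1) g])
  let ?Y = "g ** YR ** matrix_inv g"
  have eig: "int_eigenspace ?Y j = (*v) g ` sec {x. wt x = j}" for j
  proof -
    have "?Y *v v = of_int j *s v \<longleftrightarrow> YR *v (matrix_inv g *v v) = of_int j *s (matrix_inv g *v v)" for v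
    proof -
      have "?Y *v v = g *v (YR *v (matrix_inv g *v v))" by (simp add: matrix_vector_mul_assoc matrix_mul_assoc)
      moreover have "of_int j *s v = g *v (of_int j *s (matrix_inv g *v v))" by (simp add: mv_scale mat_inv_vec[OF ig])
      ultimately show ?thesis using inj_invertible[OF ig] by (metis injD)
    qed
    then have "v \<in> int_eigenspace ?Y j \<longleftrightarrow> matrix_inv g *v v \<in> int_eigenspace YR j" for v
      by (simp add: int_eigenspace_def)
    then show ?thesis using image_mat_inv_iff[OF ig] by (auto simp: int_eigenspace_YR)
  qed
  have span: "vec.span (\<Union>j\<in>J. int_eigenspace ?Y j) = (*v) g ` sec {x. wt x \<in> J}" for J
  proof
    show "vec.span (\<Union>j\<in>J. int_eigenspace ?Y j) \<subseteq> (*v) g ` sec {x. wt x \<in> J}"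
    proof (rule vec.span_minimal)
      show "(\<Union>j\<in>J. int_eigenspace ?Y j) \<subseteq> (*v) g ` sec {x. wt x \<in> J}"
        unfolding eig by (intro UN_least image_mono sec_mono) auto
    qed (rule subspace_mv_image[OF subspace_sec])
    have "(*v) g ` sec {x. wt x \<in> J} = vec.span (\<Union>{(*v) g ` sec {(a, b)} | a b. a + b \<in> J})"
      unfolding span_image_sec by (simp add: wt_def)
    also have "\<dots> \<subseteq> vec.span (\<Union>j\<in>J. int_eigenspace ?Y j)"
    proof (rule vec.span_mono, intro Union_least, elim CollectE exE conjE, hypsubst)
      fix a b assume ab: "a + b \<in> J"
      have "(*v) g ` sec {(a, b)} \<subseteq> (*v) g ` sec {x. wt x = a + b}" by (intro image_mono sec_mono) simp
      then show "(*v) g ` sec {(a, b)} \<subseteq> (\<Union>j\<in>J. int_eigenspace ?Y j)" unfolding eig using ab by blast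
    qed
    finally show "(*v) g ` sec {x. wt x \<in> J} \<subseteq> vec.span (\<Union>j\<in>J. int_eigenspace ?Y j)" .
  qed
  have "(*v) g ` sec UNIV = UNIV" using UT_sec[OF add_closed_types(1) g, of UNIV] by (simp add: sec_UNIV)
  moreover have "HW k = (*v) g ` sec {x. wt x \<in> {..k}}" for k
    using image_HW[OF g, of k] by (simp add: HW_def)
  ultimately show ?thesis
    unfolding grading_of_def span using span[of UNIV] by simp
qed

lemma tendsto_blk: "(A \<longlongrightarrow> A0) F \<Longrightarrow> ((\<lambda>s. blk (A s) x y) \<longlongrightarrow> blk A0 x y) F"
  unfolding blk_def by (intro tendsto_mat_mult tendsto_const)

lemma UT_limit:
  assumes "(g \<longlongrightarrow> g0) F" "\<forall>\<^sub>F s in F. UT S (g s)" "F \<noteq> bot"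
  shows "UT S g0"
  unfolding UT_def supp_def
proof (intro allI impI, rule ccontr)
  fix x y assume nz: "blk (g0 - mat 1) x y \<noteq> 0" and t: "x - y \<notin> S"
  have "((\<lambda>s. g s - mat 1) \<longlongrightarrow> g0 - mat 1) F" by (intro tendsto_diff tendsto_const assms(1))
  then have "((\<lambda>s. blk (g s - mat 1) x y) \<longlongrightarrow> blk (g0 - mat 1) x y) F" by (rule tendsto_blk)
  moreover have "\<forall>\<^sub>F s in F. blk (g s - mat 1) x y = 0"
    using assms(2) by eventually_elim (use t in \<open>auto simp: UT_def supp_def\<close>)
  ultimately have "((\<lambda>s. 0) \<longlongrightarrow> blk (g0 - mat 1) x y) F"
    by (rule Lim_transform_eventually)
  then show False using nz assms(3) by (simp add: tendsto_const_iff)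
qed

text \<open>The unipotent matrix \<open>g\<close> is determined by \<open>Y = g YR g\<^sup>-\<^sup>1\<close>: the block of \<open>Y g = g YR\<close> of
  degree \<open>-d\<close> expresses \<open>d\<close> times the block of \<open>g\<close> by blocks of \<open>Y\<close> and blocks of \<open>g\<close> of smaller \<open>d\<close>.\<close>

lemma conj_grading_converges:
  assumes Y: "((\<lambda>s. g s ** YR ** matrix_inv (g s)) \<longlongrightarrow> Y0) F"
    and g: "\<forall>\<^sub>F s in F. UT NegT (g s)"
  shows "\<exists>g0. (g \<longlongrightarrow> g0) F"
proof -
  define Y where "Y s = g s ** YR ** matrix_inv (g s)" for s
  have YRx: "blk YR x y = (if x = y then mat (of_int (wt x)) ** pr x else 0)" for x y
  proof -
    have "blk YR x y *v v = (if x = y then mat (of_int (wt x)) ** pr x else 0) *v v" for v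
      by (simp add: blk_def mat_vec pr_YR pr_pr_vec matrix_vector_mul_assoc[symmetric])
    then show ?thesis by (simp add: matrix_eq)
  qed
  have sYR: "supp {0} YR" unfolding supp_def by (auto simp: YRx)
  have gYR: "blk (A ** YR) x y = mat (of_int (wt y)) ** blk A x y" for A x y
  proof -
    have "blk (A ** YR) x y = (\<Sum>z\<in>R. if z = y then mat (of_int (wt y)) ** blk A x y else 0)"
      unfolding blk_mult by (rule sum.cong) (auto simp: YRx mat_scalar_left pr_blk)
    then show ?thesis using finR blk_out[of x y A] by (cases "y \<in> R") (auto simp: sum.delta)
  qed
  have step: "blk (g s) x y = mat (1 / of_int (wt y - wt x)) ** (\<Sum>z\<in>{z\<in>R. wt x < wt z}. blk (Y s) x z ** blk (g s) z y)"
    if gs: "UT NegT (g s)" and xy: "wt x < wt y" for s x y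
  proof -
    have ig: "invertible (g s)" by (rule UT_inv(1)[OF add_closed_types(1) gs])
    have Yg: "Y s ** g s = g s ** YR" by (simp add: Y_def mat_inv_left'[OF ig])
    define D where "D = ((g s - mat 1) ** YR - YR ** (g s - mat 1)) ** matrix_inv (g s)"
    have "Y s = YR + D"
      by (simp add: D_def Y_def mat_algebra mat_inv_right'[OF ig])
    moreover have "supp NegT D"
    proof -
      have n: "supp NegT (g s - mat 1)" using gs by (simp add: UT_def)
      have n1: "supp NegT ((g s - mat 1) ** YR)" by (rule supp_mult[OF n sYR]) simp
      have n2: "supp NegT (YR ** (g s - mat 1))" by (rule supp_mult[OF sYR n]) simp
      have n3: "supp (insert 0 NegT) (matrix_inv (g s))"
      proof -
        have "supp (insert 0 NegT) (matrix_inv (g s) - mat 1)"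
          using UT_inv(2)[OF add_closed_types(1) gs] by (auto simp: UT_def intro: supp_mono)
        from supp_add[OF this supp_one[of "insert 0 NegT"]] show ?thesis by simp
      qed
      show ?thesis
        unfolding D_def by (rule supp_mult[OF supp_diff[OF n1 n2] n3]) (auto simp: NegT_def)
    qed
    ultimately have Yb: "blk (Y s) x z = (if z = x then mat (of_int (wt x)) ** pr x else 0)" if "\<not> wt x < wt z" for z
    proof -
      have "x - z \<notin> NegT" using that by (simp add: NegT_def)
      then have "blk D x z = 0" using \<open>supp NegT D\<close> unfolding supp_def by blast
      then show ?thesis using \<open>Y s = YR + D\<close> by (simp add: blk_add YRx)
    qed
    let ?S = "\<Sum>z\<in>{z\<in>R. wt x < wt z}. blk (Y s) x z ** blk (g s) z y"
    have "mat (of_int (wt y)) ** blk (g s) x y = blk (Y s ** g s) x y" by (simp add: Yg gYR)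
    also have "\<dots> = (\<Sum>z\<in>R. blk (Y s) x z ** blk (g s) z y)" by (rule blk_mult)
    also have "\<dots> = ?S + (\<Sum>z\<in>{z\<in>R. \<not> wt x < wt z}. blk (Y s) x z ** blk (g s) z y)"
      using finR by (subst sum.union_disjoint[symmetric]) (auto intro!: sum.cong)
    also have "(\<Sum>z\<in>{z\<in>R. \<not> wt x < wt z}. blk (Y s) x z ** blk (g s) z y)
        = (\<Sum>z\<in>{z\<in>R. \<not> wt x < wt z}. if z = x then mat (of_int (wt x)) ** blk (g s) x y else 0)"
      by (rule sum.cong) (auto simp: Yb pr_blk simp flip: matrix_mul_assoc)
    also have "\<dots> = mat (of_int (wt x)) ** blk (g s) x y"
      using finR blk_out[of x y] by (cases "x \<in> R") (auto simp: sum.delta)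
    finally have "mat (of_int (wt y)) ** blk (g s) x y - mat (of_int (wt x)) ** blk (g s) x y = ?S" by simp
    then have S: "?S = mat (of_int (wt y - wt x)) ** blk (g s) x y"
      by (simp add: vec_eq_iff mat_scalar_nth algebra_simps)
    have "(of_int (wt y - wt x) :: complex) \<noteq> 0" using xy by (simp only: of_int_eq_0_iff)
    then show ?thesis unfolding S by (simp only: matrix_mul_assoc mat_mat) simp
  qed
  have conv: "\<exists>L. ((\<lambda>s. blk (g s) x y) \<longlongrightarrow> L) F" if "wt y - wt x \<le> int n" for n x y
    using that
  proof (induction n arbitrary: x y)
    case 0
    have "\<forall>\<^sub>F s in F. (if x = y then pr x else 0) = blk (g s) x y"
      using g
    proof eventually_elim
      case (elim s)
      have "x - y \<notin> NegT" using 0 by (simp add: NegT_def)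
      from UT_blk[OF elim this] show ?case by simp
    qed
    from Lim_transform_eventually[OF tendsto_const this] show ?case by blast
  next
    case (Suc n)
    show ?case
    proof (cases "wt y - wt x \<le> int n")
      case True
      then show ?thesis by (rule Suc.IH)
    next
      case False
      then have xy: "wt x < wt y" by simp
      have "\<exists>L. \<forall>z\<in>{z\<in>R. wt x < wt z}. ((\<lambda>s. blk (g s) z y) \<longlongrightarrow> L z) F"
        using Suc.IH Suc.prems by (intro bchoice) auto
      then obtain L where L: "\<And>z. z \<in> R \<Longrightarrow> wt x < wt z \<Longrightarrow> ((\<lambda>s. blk (g s) z y) \<longlongrightarrow> L z) F" by auto
      have "((\<lambda>s. mat (1 / of_int (wt y - wt x)) ** (\<Sum>z\<in>{z\<in>R. wt x < wt z}. blk (Y s) x z ** blk (g s) z y))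
        \<longlongrightarrow> mat (1 / of_int (wt y - wt x)) ** (\<Sum>z\<in>{z\<in>R. wt x < wt z}. blk Y0 x z ** L z)) F"
        using L Y by (intro tendsto_mat_mult tendsto_const tendsto_sum tendsto_blk) (auto simp: Y_def)
      moreover have "\<forall>\<^sub>F s in F. mat (1 / of_int (wt y - wt x)) ** (\<Sum>z\<in>{z\<in>R. wt x < wt z}. blk (Y s) x z ** blk (g s) z y) = blk (g s) x y"
        using g by eventually_elim (rule step[OF _ xy, symmetric])
      ultimately have "((\<lambda>s. blk (g s) x y) \<longlongrightarrow> mat (1 / of_int (wt y - wt x)) ** (\<Sum>z\<in>{z\<in>R. wt x < wt z}. blk Y0 x z ** L z)) F"
        by (rule Lim_transform_eventually)
      then show ?thesis by blast
    qed
  qed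
  have "\<exists>L. ((\<lambda>s. blk (g s) x y) \<longlongrightarrow> L) F" for x y
    by (rule conv[of _ _ "nat (wt y - wt x)"]) simp
  then obtain L where L: "\<And>x y. ((\<lambda>s. blk (g s) x y) \<longlongrightarrow> L x y) F" by metis
  have "((\<lambda>s. \<Sum>x\<in>R. \<Sum>y\<in>R. blk (g s) x y) \<longlongrightarrow> (\<Sum>x\<in>R. \<Sum>y\<in>R. L x y)) F"
    by (intro tendsto_sum L)
  then have "(g \<longlongrightarrow> (\<Sum>x\<in>R. \<Sum>y\<in>R. L x y)) F" by (simp flip: mat_decomp)
  then show ?thesis by blast
qed

end

section \<open>Rapid decay\<close>

text \<open>Decay faster than every power of \<open>y\<close>, and polynomial dependence on \<open>y\<close>. The products of functions of
  these two kinds decay rapidly.\<close>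

definition rapid :: "('a \<Rightarrow> real) \<Rightarrow> 'a filter \<Rightarrow> ('a \<Rightarrow> complex^'n^'n) \<Rightarrow> bool" where
  "rapid y A f \<longleftrightarrow> (\<forall>m. ((\<lambda>s. mat (of_real (y s) ^ m) ** f s) \<longlongrightarrow> 0) A)"

definition polyn :: "('a \<Rightarrow> real) \<Rightarrow> ('a \<Rightarrow> complex^'n^'n) \<Rightarrow> bool" where
  "polyn y f \<longleftrightarrow> (\<exists>(n::nat) L. \<forall>s. f s = (\<Sum>k\<le>n. mat (of_real (y s) ^ k) ** L k))"

lemma rapidD: "rapid y A f \<Longrightarrow> ((\<lambda>s. mat (of_real (y s) ^ m) ** f s) \<longlongrightarrow> 0) A"
  by (simp add: rapid_def)

lemma rapid_cong:
  assumes "\<forall>\<^sub>F s in A. f s = g s" "rapid y A f"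
  shows "rapid y A g"
  unfolding rapid_def
proof
  fix m
  have "\<forall>\<^sub>F s in A. mat (of_real (y s) ^ m) ** f s = mat (of_real (y s) ^ m) ** g s"
    using assms(1) by eventually_elim simp
  with rapidD[OF assms(2)] show "((\<lambda>s. mat (of_real (y s) ^ m) ** g s) \<longlongrightarrow> 0) A"
    by (rule Lim_transform_eventually)
qed

lemma rapid_zero:
  assumes "\<forall>\<^sub>F s in A. f s = 0"
  shows "rapid y A f"
proof (rule rapid_cong)
  show "rapid y A (\<lambda>s. 0)" by (simp add: rapid_def)
  show "\<forall>\<^sub>F s in A. 0 = f s" using assms by eventually_elim simp
qed

lemma rapid_add:
  assumes "rapid y A f" "rapid y A g"
  shows "rapid y A (\<lambda>s. f s + g s)"
  unfolding rapid_def matrix_add_ldistrib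
proof
  fix m
  show "((\<lambda>s. mat (of_real (y s) ^ m) ** f s + mat (of_real (y s) ^ m) ** g s) \<longlongrightarrow> 0) A"
    using tendsto_add[OF rapidD[OF assms(1), of m] rapidD[OF assms(2), of m]] by simp
qed

lemma rapid_uminus:
  assumes "rapid y A f"
  shows "rapid y A (\<lambda>s. - f s)"
  unfolding rapid_def mat_uminus_mult
proof
  fix m
  show "((\<lambda>s. - (mat (of_real (y s) ^ m) ** f s)) \<longlongrightarrow> 0) A"
    using tendsto_minus[OF rapidD[OF assms, of m]] by simp
qed

lemma rapid_diff: "rapid y A f \<Longrightarrow> rapid y A g \<Longrightarrow> rapid y A (\<lambda>s. f s - g s)"
  using rapid_add[OF _ rapid_uminus, of y A f g] by simp

lemma rapid_sum: "(\<And>i. i \<in> I \<Longrightarrow> rapid y A (f i)) \<Longrightarrow> rapid y A (\<lambda>s. \<Sum>i\<in>I. f i s)"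
proof (induction I rule: infinite_finite_induct)
  case (insert x F)
  then show ?case using rapid_add[of y A "f x" "\<lambda>s. \<Sum>i\<in>F. f i s"] by simp
qed (simp_all add: rapid_zero)

lemma rapid_mult_right: "rapid y A f \<Longrightarrow> (g \<longlongrightarrow> g0) A \<Longrightarrow> rapid y A (\<lambda>s. f s ** g s)"
  unfolding rapid_def
proof
  fix m assume *: "\<forall>m. ((\<lambda>s. mat (of_real (y s) ^ m) ** f s) \<longlongrightarrow> 0) A" "(g \<longlongrightarrow> g0) A"
  have "((\<lambda>s. (mat (of_real (y s) ^ m) ** f s) ** g s) \<longlongrightarrow> 0 ** g0) A"
    using * by (intro tendsto_mat_mult) auto
  then show "((\<lambda>s. mat (of_real (y s) ^ m) ** (f s ** g s)) \<longlongrightarrow> 0) A" by (simp add: matrix_mul_assoc)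
qed

lemma rapid_mult_left: "rapid y A f \<Longrightarrow> (g \<longlongrightarrow> g0) A \<Longrightarrow> rapid y A (\<lambda>s. g s ** f s)"
  unfolding rapid_def
proof
  fix m assume *: "\<forall>m. ((\<lambda>s. mat (of_real (y s) ^ m) ** f s) \<longlongrightarrow> 0) A" "(g \<longlongrightarrow> g0) A"
  have "((\<lambda>s. g s ** (mat (of_real (y s) ^ m) ** f s)) \<longlongrightarrow> g0 ** 0) A"
    using * by (intro tendsto_mat_mult) auto
  then show "((\<lambda>s. mat (of_real (y s) ^ m) ** (g s ** f s)) \<longlongrightarrow> 0) A" by (simp only: mat_scalar_left mat_zero_mult)
qed

lemma rapid_tendsto: "rapid y A f \<Longrightarrow> (f \<longlongrightarrow> 0) A"
  using rapidD[of y A f 0] by simp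

lemma rapid_cnjm: "rapid y A f \<Longrightarrow> rapid y A (\<lambda>s. cnjm (f s))"
  unfolding rapid_def
proof
  fix m assume *: "\<forall>m. ((\<lambda>s. mat (of_real (y s) ^ m) ** f s) \<longlongrightarrow> 0) A"
  then have "((\<lambda>s. cnjm (mat (of_real (y s) ^ m) ** f s)) \<longlongrightarrow> cnjm 0) A" by (intro tendsto_cnjm) blast
  then show "((\<lambda>s. mat (of_real (y s) ^ m) ** cnjm (f s)) \<longlongrightarrow> 0) A" by (simp add: cnjm_mult)
qed

lemma rapid_power: "rapid y A f \<Longrightarrow> rapid y A (\<lambda>s. mat (of_real (y s) ^ k) ** f s)"
  unfolding rapid_def
proof
  fix m assume *: "\<forall>m. ((\<lambda>s. mat (of_real (y s) ^ m) ** f s) \<longlongrightarrow> 0) A"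
  have "mat (of_real (y s) ^ m) ** (mat (of_real (y s) ^ k) ** f s) = mat (of_real (y s) ^ (m + k)) ** f s" for s
    by (simp add: matrix_mul_assoc mat_mat power_add)
  then show "((\<lambda>s. mat (of_real (y s) ^ m) ** (mat (of_real (y s) ^ k) ** f s)) \<longlongrightarrow> 0) A" using * by simp
qed

lemma rapid_polyn_left:
  assumes p: "polyn y p" and f: "rapid y A f"
  shows "rapid y A (\<lambda>s. p s ** f s)"
proof -
  obtain n and L :: "nat \<Rightarrow> complex^'b^'b" where L: "\<And>s. p s = (\<Sum>k\<le>n. mat (of_real (y s) ^ k) ** L k)"
    using p unfolding polyn_def by blast
  have "p s ** f s = (\<Sum>k\<le>n. mat (of_real (y s) ^ k) ** (L k ** f s))" for s
    by (simp add: L mat_sum_mult matrix_mul_assoc)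
  moreover have "rapid y A (\<lambda>s. \<Sum>k\<le>n. mat (of_real (y s) ^ k) ** (L k ** f s))"
    by (intro rapid_sum rapid_power rapid_mult_left[OF f tendsto_const])
  ultimately show ?thesis by simp
qed

lemma rapid_polyn_right:
  assumes p: "polyn y p" and f: "rapid y A f"
  shows "rapid y A (\<lambda>s. f s ** p s)"
proof -
  obtain n and L :: "nat \<Rightarrow> complex^'b^'b" where L: "\<And>s. p s = (\<Sum>k\<le>n. mat (of_real (y s) ^ k) ** L k)"
    using p unfolding polyn_def by blast
  have "f s ** p s = (\<Sum>k\<le>n. mat (of_real (y s) ^ k) ** (f s ** L k))" for s
    by (simp only: L mat_mult_sum mat_scalar_left)
  moreover have "rapid y A (\<lambda>s. \<Sum>k\<le>n. mat (of_real (y s) ^ k) ** (f s ** L k))"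
    by (intro rapid_sum rapid_power rapid_mult_right[OF f tendsto_const])
  ultimately show ?thesis by simp
qed

lemma mat_scalar_mid: "(C::complex^'n^'n) ** (mat a ** L) ** D = mat a ** (C ** L ** D)"
  by (subst mat_scalar_left) (simp only: matrix_mul_assoc)

lemma tendsto_mat: "(f \<longlongrightarrow> c) A \<Longrightarrow> ((\<lambda>s. mat (f s) :: complex^'n^'n) \<longlongrightarrow> mat c) A"
proof -
  assume f: "(f \<longlongrightarrow> c) A"
  have "((\<lambda>s. (mat (f s) :: complex^'n^'n) $ i $ j) \<longlongrightarrow> (mat c :: complex^'n^'n) $ i $ j) A" for i j
    by (cases "i = j") (simp_all add: mat_def f)
  then show ?thesis unfolding tendsto_mat_iff by blast
qed

lemma polyn_mult:
  fixes C D :: "complex^'n^'n"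
  shows "polyn y p \<Longrightarrow> polyn y (\<lambda>s. C ** p s ** D)"
proof -
  assume "polyn y p"
  then obtain n L where L: "\<And>s. p s = (\<Sum>k\<le>n. mat (of_real (y s) ^ k) ** L k)" unfolding polyn_def by blast
  have "C ** p s ** D = (\<Sum>k\<le>n. mat (of_real (y s) ^ k) ** (C ** L k ** D))" for s
    by (simp only: L mat_mult_sum mat_sum_mult mat_scalar_mid)
  then show ?thesis unfolding polyn_def by (intro exI[of _ n] exI[of _ "\<lambda>k. C ** L k ** D"]) blast
qed

lemma polyn_minus: "polyn y p \<Longrightarrow> polyn y (\<lambda>s. p s - C)"
proof -
  assume "polyn y p"
  then obtain n L where L: "\<And>s. p s = (\<Sum>k\<le>n. mat (of_real (y s) ^ k) ** L k)" unfolding polyn_def by blast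
  have "(\<Sum>k\<le>n. mat (of_real (y s) ^ k) ** (if k = 0 then C else 0)) = (\<Sum>k\<in>{0}. mat (of_real (y s) ^ k) ** C)" for s
    by (rule sum.mono_neutral_cong_right) auto
  then have "p s - C = (\<Sum>k\<le>n. mat (of_real (y s) ^ k) ** (L k - (if k = 0 then C else 0)))" for s
    by (simp add: L mat_diff_ldistrib sum_subtractf)
  then show ?thesis unfolding polyn_def
    by (intro exI[of _ n] exI[of _ "\<lambda>k. L k - (if k = 0 then C else 0)"]) blast
qed

lemma polyn_mexp:
  fixes X :: "complex^'n^'n"
  assumes X: "nilpotent X"
  shows "polyn y (\<lambda>s. mexp (mat (c * of_real (y s)) ** X))"
proof -
  have "mexp (mat (c * of_real (y s)) ** X) =
      (\<Sum>k\<le>CARD('n). mat (of_real (y s) ^ k) ** (mat (c ^ k / fact k) ** matpow X k))" for s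
    by (simp add: mexp_scalar[OF X] fps_ev_def matrix_mul_assoc mat_mat power_mult_distrib mult.commute)
  then show ?thesis unfolding polyn_def
    by (intro exI[of _ "CARD('n)"] exI[of _ "\<lambda>k. mat (c ^ k / fact k) ** matpow X k"]) blast
qed

lemma matpow_conj:
  assumes g: "invertible (g :: complex^'n^'n)"
  shows "matpow (matrix_inv g ** N ** g) k = matrix_inv g ** matpow N k ** g"
proof (induction k)
  case (Suc k)
  have "matpow (matrix_inv g ** N ** g) (Suc k) = matrix_inv g ** N ** (g ** matrix_inv g) ** matpow N k ** g"
    by (simp only: matpow_Suc Suc matrix_mul_assoc)
  then show ?case by (simp add: mat_inv_right[OF g] matpow_Suc matrix_mul_assoc)
qed (simp add: mat_inv_left[OF g])

lemma mexp_conj: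
  assumes g: "invertible (g :: complex^'n^'n)" and N: "nilpotent N"
  shows "mexp (mat c ** (matrix_inv g ** N ** g)) = matrix_inv g ** mexp (mat c ** N) ** g"
proof -
  have nil: "nilpotent (matrix_inv g ** N ** g)"
  proof -
    obtain m where "matpow N m = 0" using N unfolding nilpotent_def by blast
    then have "matpow (matrix_inv g ** N ** g) m = 0" by (simp add: matpow_conj[OF g])
    then show ?thesis unfolding nilpotent_def by blast
  qed
  show ?thesis
    unfolding mexp_scalar[OF nil] mexp_scalar[OF N] fps_ev_def matpow_conj[OF g]
    by (simp only: mat_mult_sum mat_sum_mult mat_scalar_mid)
qed

subsection \<open>Decay of holomorphic functions at the puncture\<close>

text \<open>The function \<open>- ln |s| / (2 \<pi>)\<close> is the imaginary part of \<open>lift s\<close>.\<close>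

lemma filterlim_minus_ln_norm: "filterlim (\<lambda>s::complex. - ln (norm s) / (2 * pi)) at_top (at 0)"
proof -
  have n: "filterlim (\<lambda>s::complex. norm s) (at_right 0) (at 0)"
    unfolding filterlim_at by (auto simp: eventually_at intro!: tendsto_eq_intros exI[of _ 1])
  have "filterlim (\<lambda>s::complex. ln (norm s)) at_bot (at 0)" by (rule filterlim_compose[OF ln_at_0 n])
  then have "filterlim (\<lambda>s::complex. - ln (norm s)) at_top (at 0)" by (simp add: filterlim_uminus_at_top)
  then show ?thesis
    using filterlim_tendsto_pos_mult_at_top[OF tendsto_const[of "1 / (2 * pi)"], of "\<lambda>s::complex. - ln (norm s)" "at 0"] by simp
qed

lemma ln_power_times_tendsto_0:
  "((\<lambda>s::complex. of_real (- ln (norm s) / (2 * pi)) ^ m * s) \<longlongrightarrow> 0) (at 0)"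
proof -
  let ?y = "\<lambda>s::complex. - ln (norm s) / (2 * pi)"
  have "((\<lambda>t::real. t ^ m / exp t) \<longlongrightarrow> 0) at_top" by (rule tendsto_power_div_exp_0)
  moreover have "filterlim (\<lambda>s::complex. - ln (norm s)) at_top (at 0)"
    using filterlim_tendsto_pos_mult_at_top[OF tendsto_const[of "2 * pi"] _ filterlim_minus_ln_norm] by simp
  ultimately have "((\<lambda>s::complex. (- ln (norm s)) ^ m / exp (- ln (norm s))) \<longlongrightarrow> 0) (at 0)"
    by (rule filterlim_compose)
  from tendsto_mult[OF tendsto_const[of "1 / (2 * pi) ^ m"] tendsto_rabs[OF this]]
  have lim: "((\<lambda>s::complex. 1 / (2 * pi) ^ m * \<bar>(- ln (norm s)) ^ m / exp (- ln (norm s))\<bar>) \<longlongrightarrow> 0) (at 0)" by simp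
  have "\<forall>\<^sub>F s::complex in at 0. s \<noteq> 0" by (simp add: eventually_at_filter)
  then have ev: "\<forall>\<^sub>F s::complex in at 0. 1 / (2 * pi) ^ m * \<bar>(- ln (norm s)) ^ m / exp (- ln (norm s))\<bar> = norm (of_real (?y s) ^ m * s)"
  proof eventually_elim
    case (elim s)
    have "norm (complex_of_real (?y s) ^ m * s) = \<bar>?y s\<bar> ^ m * norm s"
      by (simp only: norm_mult norm_power norm_of_real)
    then show ?case using elim by (simp add: exp_minus power_divide abs_mult power_abs field_simps)
  qed
  have "((\<lambda>s::complex. norm (complex_of_real (?y s) ^ m * s)) \<longlongrightarrow> 0) (at 0)"
    by (rule Lim_transform_eventually[OF lim ev])
  then show ?thesis by (rule tendsto_norm_zero_cancel)
qed

text \<open>The singularity is removable, so that \<open>f - c\<close> is \<open>s\<close> times a bounded function.\<close>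

lemma removable_decay:
  fixes f :: "complex \<Rightarrow> complex"
  assumes f: "f holomorphic_on ball 0 1 - {0}" and lim: "(f \<longlongrightarrow> c) (at 0)"
  shows "((\<lambda>s. of_real (- ln (norm s) / (2 * pi)) ^ m * (f s - c)) \<longlongrightarrow> 0) (at 0)"
    "((\<lambda>s. s * deriv f s) \<longlongrightarrow> 0) (at 0)"
proof -
  define F where "F s = (if s = 0 then c else f s)" for s
  have F: "F holomorphic_on ball 0 1"
    unfolding F_def using f lim by (intro removable_singularity) auto
  have dF: "(F has_field_derivative deriv F 0) (at 0)"
    using holomorphic_derivI[OF F open_ball, of 0] by simp
  have q: "((\<lambda>s. (F s - F 0) / (s - 0)) \<longlongrightarrow> deriv F 0) (at 0)"
    using dF by (simp add: has_field_derivative_iff)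
  have "((\<lambda>s. of_real (- ln (norm s) / (2 * pi)) ^ m * s * ((F s - F 0) / (s - 0))) \<longlongrightarrow> 0 * deriv F 0) (at 0)"
    by (rule tendsto_mult[OF ln_power_times_tendsto_0 q])
  moreover have "\<forall>\<^sub>F s in at 0. of_real (- ln (norm s) / (2 * pi)) ^ m * s * ((F s - F 0) / (s - 0))
      = of_real (- ln (norm s) / (2 * pi)) ^ m * (f s - c)"
    unfolding eventually_at_filter by (rule always_eventually) (auto simp: F_def)
  ultimately show "((\<lambda>s. of_real (- ln (norm s) / (2 * pi)) ^ m * (f s - c)) \<longlongrightarrow> 0) (at 0)"
    using Lim_transform_eventually by fastforce
  have "deriv F holomorphic_on ball 0 1" by (rule holomorphic_deriv[OF F open_ball])
  then have "continuous_on (ball 0 1) (deriv F)" by (rule holomorphic_on_imp_continuous_on)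
  then have "isCont (deriv F) 0" by (simp add: continuous_on_eq_continuous_at)
  then have "((\<lambda>s. s * deriv F s) \<longlongrightarrow> 0 * deriv F 0) (at 0)"
    by (intro tendsto_mult) (auto simp: isCont_def)
  moreover have "\<forall>\<^sub>F s in at 0. s * deriv F s = s * deriv f s"
  proof -
    have "\<forall>\<^sub>F s::complex in at 0. s \<noteq> 0" by (simp add: eventually_at_filter)
    then show ?thesis
    proof eventually_elim
      case (elim s)
      have "\<forall>\<^sub>F t in nhds s. t \<in> - {0}" using elim by (intro eventually_nhds_in_open) auto
      then have "\<forall>\<^sub>F t in nhds s. F t = f t" by eventually_elim (simp add: F_def)
      then show ?case by (simp add: deriv_cong_ev)
    qed
  qed
  ultimately show "((\<lambda>s. s * deriv f s) \<longlongrightarrow> 0) (at 0)"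
    using Lim_transform_eventually by fastforce
qed

lemma hol_mat_rapid:
  fixes u :: "complex \<Rightarrow> complex^'n^'n"
  assumes "hol_mat u (ball 0 1 - {0})" "(u \<longlongrightarrow> u0) (at 0)"
  shows "rapid (\<lambda>s. - ln (norm s) / (2 * pi)) (at 0) (\<lambda>s. u s - u0)"
  unfolding rapid_def tendsto_mat_iff
proof (intro allI)
  fix m i j
  have "((\<lambda>s. of_real (- ln (norm s) / (2 * pi)) ^ m * (u s $ i $ j - u0 $ i $ j)) \<longlongrightarrow> 0) (at 0)"
    using assms by (intro removable_decay) (auto simp: hol_mat_def tendsto_mat_iff)
  then show "((\<lambda>s. (mat (of_real (- ln (norm s) / (2 * pi)) ^ m) ** (u s - u0)) $ i $ j) \<longlongrightarrow> 0 $ i $ j) (at 0)"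
    by (simp add: mat_scalar_nth)
qed

section \<open>Unipotent matrices near the puncture\<close>

context bigraded_frame
begin

lemma mexp_UT:
  assumes X: "supp S X" and S: "add_closed S"
  shows "UT S (mexp (mat c ** X))"
proof -
  have nil: "nilpotent X" using supp_nilpotent[OF X] S by (simp add: add_closed_def)
  have "{..CARD('n)} = insert 0 {1..CARD('n)}" by auto
  then have "mexp (mat c ** X) - mat 1 = (\<Sum>k\<in>{1..CARD('n)}. mat (fps_nth (fps_exp c) k) ** matpow X k)"
    by (simp add: mexp_scalar[OF nil] fps_ev_def)
  moreover have "supp S (matpow X k)" if "k \<in> {1..CARD('n)}" for k
    using supp_matpow[OF X S, of "k - 1"] that by simp
  ultimately show ?thesis unfolding UT_def by (auto intro!: supp_sum supp_scalar)
qed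

lemma blk_mult_deg1:
  assumes A: "UT NegT A" and B: "UT NegT B" and xy: "wt (x - y) = - 1"
  shows "blk (A ** B) x y = blk A x y + blk B x y"
proof -
  have "supp {d. wt d \<le> - 2} ((A - mat 1) ** (B - mat 1))"
    using A B unfolding UT_def by (rule supp_mult) (auto simp: NegT_def)
  then have z: "blk ((A - mat 1) ** (B - mat 1)) x y = 0" using xy unfolding supp_def by force
  have ne: "x \<noteq> y" using xy by auto
  have "A ** B = (A - mat 1) ** (B - mat 1) + A + B - mat 1" by (simp add: mat_algebra)
  then have "blk (A ** B) x y = blk ((A - mat 1) ** (B - mat 1) + A + B - mat 1) x y" by (simp only:)
  also have "\<dots> = blk A x y + blk B x y" using ne by (simp only: blk_add blk_diff z blk_one) simp
  finally show ?thesis .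
qed

lemma blk_mexp_deg1:
  assumes N: "supp NegT N" and xy: "wt (x - y) = - 1"
  shows "blk (mexp (mat c ** N)) x y = mat c ** blk N x y"
proof -
  have nil: "nilpotent N" by (rule supp_nilpotent[OF N]) simp
  have ne: "x \<noteq> y" using xy by auto
  have "1 \<le> CARD('n)" by (simp add: Suc_le_eq)
  then have "{..CARD('n)} = insert 0 (insert 1 {2..CARD('n)})" by auto
  then have "mexp (mat c ** N) = mat 1 + mat c ** N + (\<Sum>k\<in>{2..CARD('n)}. mat (fps_nth (fps_exp c) k) ** matpow N k)"
    by (simp add: mexp_scalar[OF nil] fps_ev_def add.assoc)
  moreover have "blk (\<Sum>k\<in>{2..CARD('n)}. mat (fps_nth (fps_exp c) k) ** matpow N k) x y = 0"
  proof -
    have "supp {d. wt d \<le> - 2} (matpow N k)" if "2 \<le> k" for k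
    proof -
      have k: "k = Suc (Suc (k - 2))" using that by simp
      show ?thesis
        by (subst k, subst matpow_Suc, rule supp_mult[OF N supp_matpow[OF N add_closed_types(1)]]) (auto simp: NegT_def)
    qed
    then have "supp {d. wt d \<le> - 2} (\<Sum>k\<in>{2..CARD('n)}. mat (fps_nth (fps_exp c) k) ** matpow N k)"
      by (intro supp_sum supp_scalar) auto
    then show ?thesis using xy unfolding supp_def by force
  qed
  ultimately show ?thesis using ne by (simp add: blk_add blk_one blk_scalar)
qed

text \<open>In degree \<open>-1\<close> a Deligne splitting is real. So the imaginary part of \<open>g\<close> there is \<open>y\<close> times
  the component of \<open>N\<close>, which therefore has to vanish when \<open>g\<close> stays bounded.\<close>

lemma weight_drop:
  fixes y :: "'a \<Rightarrow> real"
  assumes N: "supp NegT N" and g: "(g \<longlongrightarrow> g0) A" and Ug: "\<forall>\<^sub>F s in A. UT NegT (g s)"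
    and y: "filterlim y at_top A" and A: "A \<noteq> bot"
    and lam: "\<forall>\<^sub>F s in A. UT LamT (matrix_inv (g s) ** mexp (mat (- 2 * \<i> * of_real (y s)) ** N) ** cnjm (g s))"
  shows "supp {d. wt d \<le> - 2} N"
  unfolding supp_def
proof (intro allI impI)
  fix x z assume nz: "blk N x z \<noteq> 0"
  have "x - z \<in> NegT" using N nz unfolding supp_def by blast
  moreover have "wt (x - z) \<noteq> - 1"
  proof
    assume xz: "wt (x - z) = - 1"
    have nil: "nilpotent N" by (rule supp_nilpotent[OF N]) simp
    have ne: "x \<noteq> z" using xz by auto
    have ypos: "\<forall>\<^sub>F s in A. 0 < y s" using y by (simp add: filterlim_at_top_dense)
    have ev: "\<forall>\<^sub>F s in A. mat (1 / (2 * \<i> * of_real (y s))) ** blk (cnjm (g s) - g s) x z = blk N x z"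
      using Ug lam ypos
    proof eventually_elim
      case (elim s)
      let ?c = "2 * \<i> * of_real (y s) :: complex"
      define l where "l = matrix_inv (g s) ** mexp (mat (- ?c) ** N) ** cnjm (g s)"
      have l: "UT LamT l" using elim(2) by (simp add: l_def)
      have ig: "invertible (g s)" by (rule UT_inv(1)[OF add_closed_types(1) elim(1)])
      have E: "mexp (mat ?c ** N) ** mexp (mat (- ?c) ** N) = mat 1"
        using mexp_add[OF nil, of ?c "- ?c"] mexp_0[OF nil] by simp
      have "mexp (mat ?c ** N) ** (g s ** l) = mexp (mat ?c ** N) ** (g s ** matrix_inv (g s)) ** mexp (mat (- ?c) ** N) ** cnjm (g s)"
        by (simp only: l_def matrix_mul_assoc)
      also have "\<dots> = cnjm (g s)" by (simp add: mat_inv_right[OF ig] E)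
      finally have cg: "cnjm (g s) = mexp (mat ?c ** N) ** (g s ** l)" by simp
      have lN: "UT NegT l" using l by (rule UT_LamT_NegT)
      have "x - z \<notin> LamT" using xz by (auto simp: LamT_def wt_def)
      then have lz: "blk l x z = 0" using UT_blk[OF l] ne by simp
      have "blk (cnjm (g s)) x z = blk (mexp (mat ?c ** N)) x z + (blk (g s) x z + blk l x z)"
        unfolding cg blk_mult_deg1[OF mexp_UT[OF N add_closed_types(1)] UT_mult[OF add_closed_types(1) elim(1) lN] xz]
          blk_mult_deg1[OF elim(1) lN xz] ..
      then have "blk (cnjm (g s) - g s) x z = mat ?c ** blk N x z"
        by (simp add: blk_diff lz blk_mexp_deg1[OF N xz])
      moreover have "?c \<noteq> 0" using elim(3) by simp
      ultimately show ?case by (simp add: matrix_mul_assoc mat_mat)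
    qed
    have "((\<lambda>s. blk (cnjm (g s) - g s) x z) \<longlongrightarrow> blk (cnjm g0 - g0) x z) A"
      by (intro tendsto_blk tendsto_diff tendsto_cnjm g)
    moreover have "((\<lambda>s. mat (1 / (2 * \<i> * of_real (y s))) :: complex^'n^'n) \<longlongrightarrow> mat 0) A"
    proof -
      have "((\<lambda>s. inverse (y s)) \<longlongrightarrow> 0) A" by (rule tendsto_inverse_0_at_top[OF y])
      then have "((\<lambda>s. 1 / (2 * \<i>) * of_real (inverse (y s)) :: complex) \<longlongrightarrow> 1 / (2 * \<i>) * of_real 0) A"
        by (intro tendsto_mult tendsto_const tendsto_of_real)
      moreover have "1 / (2 * \<i>) * of_real (inverse (y s)) = (1 / (2 * \<i> * of_real (y s)) :: complex)" for s
        by (simp only: divide_inverse inverse_mult_distrib of_real_inverse mult_1_left)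
      ultimately have "((\<lambda>s. 1 / (2 * \<i> * of_real (y s)) :: complex) \<longlongrightarrow> 0) A"
        by (simp only: of_real_0 mult_zero_right)
      then show ?thesis by (rule tendsto_mat)
    qed
    ultimately have "((\<lambda>s. mat (1 / (2 * \<i> * of_real (y s))) ** blk (cnjm (g s) - g s) x z) \<longlongrightarrow> mat 0 ** blk (cnjm g0 - g0) x z) A"
      by (intro tendsto_mat_mult)
    from Lim_transform_eventually[OF this ev] have "mat 0 ** blk (cnjm g0 - g0) x z = blk N x z"
      using A by (simp add: tendsto_const_iff)
    then show False using nz by (simp add: vec_eq_iff mat_scalar_nth)
  qed
  ultimately show "x - z \<in> {d. wt d \<le> - 2}" by (simp add: NegT_def)
qed

text \<open>A horizontal real nilpotent \<open>N\<close> that drops weights by two is a morphism of type \<open>(-1,-1)\<close>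
  of the limit: in each degree, the part of \<open>\<nu>\<close> outside of \<open>LamT\<close> agrees with its
  conjugate up to terms built from lower degrees, but their types exclude each other.\<close>

lemma horizontal_supp_LamT:
  assumes n2: "supp {d. wt d \<le> - 2} \<nu>" and hor: "\<And>p v. v \<in> HF p \<Longrightarrow> \<nu> *v v \<in> HF (p - 1)"
    and lam: "UT LamT l" and eq: "l ** cnjm \<nu> = \<nu> ** l"
  shows "supp LamT \<nu>"
proof -
  have n1: "supp {d. - 1 \<le> fst d} \<nu>"
  proof (rule sec_image_supp)
    fix v y assume "v \<in> sec {y}"
    then have "v \<in> HF (fst y)" unfolding HF_def by (rule sec_mono[THEN subsetD, rotated]) simp
    from hor[OF this] show "\<nu> *v v \<in> sec {x. x - y \<in> {d. - 1 \<le> fst d}}"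
      unfolding HF_def by (rule sec_mono[THEN subsetD, rotated]) auto
  qed
  have "x - y \<in> LamT" if "blk \<nu> x y \<noteq> 0" "wt y - wt x \<le> int n" for n x y
    using that
  proof (induction n arbitrary: x y)
    case 0
    then have "x - y \<in> {d. wt d \<le> - 2}" using n2 unfolding supp_def by blast
    then show ?case using 0 by simp
  next
    case (Suc n)
    show ?case
    proof (rule ccontr)
      assume t: "x - y \<notin> LamT"
      have "x - y \<in> {d. wt d \<le> - 2}" "x - y \<in> {d. - 1 \<le> fst d}"
        using n1 n2 Suc.prems unfolding supp_def by blast+
      then have xy: "wt (x - y) \<le> - 2" "0 \<le> fst (x - y)"
        using t by (auto simp: LamT_def wt_def)
      have LC: "s + t \<in> LamT" if "s \<in> LamT" "t \<in> LamT" for s t using that by (auto simp: LamT_def)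
      have lm: "blk (l - mat 1) a b = 0" if "a - b \<notin> LamT" for a b
        using lam that unfolding UT_def supp_def by blast
      have "blk (\<nu> ** (l - mat 1)) x y = 0"
        unfolding blk_mult
      proof (intro sum.neutral ballI)
        fix z
        show "blk \<nu> x z ** blk (l - mat 1) z y = 0"
        proof (cases "z - y \<in> LamT")
          case True
          have "x - z \<notin> LamT"
          proof
            assume "x - z \<in> LamT"
            from LC[OF this True] show False using t by simp
          qed
          moreover have "wt z - wt x \<le> int n" using True Suc.prems by (auto simp: LamT_def wt_def)
          ultimately have "blk \<nu> x z = 0" using Suc.IH by blast
          then show ?thesis by simp
        qed (simp add: lm)
      qed
      moreover have "blk ((l - mat 1) ** cnjm \<nu>) x y = 0"
        unfolding blk_mult
      proof (intro sum.neutral ballI)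
        fix z
        show "blk (l - mat 1) x z ** blk (cnjm \<nu>) z y = 0"
        proof (cases "x - z \<in> LamT")
          case True
          have "z - y \<notin> LamT"
          proof
            assume "z - y \<in> LamT"
            from LC[OF True this] show False using t by simp
          qed
          then have "prod.swap z - prod.swap y \<notin> LamT" by (auto simp: LamT_def swap_diff)
          moreover have "wt (prod.swap y) - wt (prod.swap z) \<le> int n" using True Suc.prems by (auto simp: LamT_def wt_def)
          ultimately have "blk \<nu> (prod.swap z) (prod.swap y) = 0" using Suc.IH by blast
          then show ?thesis by (simp add: blk_cnj)
        qed (simp add: lm)
      qed
      moreover have "blk (cnjm \<nu>) x y = 0"
      proof -
        have "prod.swap x - prod.swap y \<notin> {d. - 1 \<le> fst d}" using xy by (auto simp: swap_diff wt_def)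
        then have "blk \<nu> (prod.swap x) (prod.swap y) = 0" using n1 unfolding supp_def by blast
        then show ?thesis by (simp add: blk_cnj)
      qed
      moreover have "\<nu> = cnjm \<nu> + (l - mat 1) ** cnjm \<nu> - \<nu> ** (l - mat 1)"
        using eq by (simp add: mat_algebra)
      then have "blk \<nu> x y = blk (cnjm \<nu> + (l - mat 1) ** cnjm \<nu> - \<nu> ** (l - mat 1)) x y" by (simp only: )
      ultimately show False using Suc.prems by (simp only: blk_add blk_diff) simp
    qed
  qed
  note main = this
  show ?thesis
    unfolding supp_def using main[of _ _ "nat (wt _ - wt _)"] by (metis int_nat_eq linorder_linear nat_int)
qed

lemma rapid_blk: "rapid y A f \<Longrightarrow> rapid y A (\<lambda>s. blk (f s) a b)"
  unfolding blk_def by (rule rapid_mult_right[OF rapid_mult_left[OF _ tendsto_const] tendsto_const])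

lemma rapid_blk_mult:
  "(\<And>z. z \<in> R \<Longrightarrow> rapid y A (\<lambda>s. blk (f s) a z ** blk (g s) z b)) \<Longrightarrow> rapid y A (\<lambda>s. blk (f s ** g s) a b)"
  unfolding blk_mult by (rule rapid_sum)

text \<open>By induction on the degree, \<open>h - 1\<close> and \<open>lam - l\<close> decay rapidly: in \<open>h lam = u\<^sup>-\<^sup>1 l conj(u) conj(h)\<close>
  they are compared with the trivial solution for \<open>u = 1\<close>, and the terms of the highest degree
  have different types.\<close>

theorem splitting_converges:
  assumes u: "rapid y A (\<lambda>s. u s - mat 1)" "\<forall>\<^sub>F s in A. UT NegT (u s)"
    and h: "\<forall>\<^sub>F s in A. UT StabT (h s)" and lam: "\<forall>\<^sub>F s in A. UT LamT (lam s)"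
    and l: "polyn y l" "\<And>s. UT LamT (l s)"
    and eq: "\<forall>\<^sub>F s in A. h s ** lam s = matrix_inv (u s) ** l s ** cnjm (u s) ** cnjm (h s)"
  shows "(h \<longlongrightarrow> mat 1) A"
proof -
  define \<rho> where "\<rho> s = matrix_inv (u s) ** l s ** cnjm (u s) - l s" for s
  define X where "X s = h s - mat 1" for s
  define M where "M s = lam s - l s" for s
  have u1: "(u \<longlongrightarrow> mat 1) A"
    using tendsto_add[OF rapid_tendsto[OF u(1)] tendsto_const[of "mat 1"]] by simp
  have ui: "((\<lambda>s. matrix_inv (u s)) \<longlongrightarrow> mat 1) A" using tendsto_mat_inv(2)[OF u1 invertible_mat_1] by (simp add: mat_inv_mat_1)
  have r1: "rapid y A (\<lambda>s. matrix_inv (u s) - mat 1)"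
  proof (rule rapid_cong[OF _ rapid_uminus[OF rapid_mult_left[OF u(1) ui]]])
    show "\<forall>\<^sub>F s in A. - (matrix_inv (u s) ** (u s - mat 1)) = matrix_inv (u s) - mat 1"
      using tendsto_mat_inv(1)[OF u1 invertible_mat_1] by eventually_elim (simp add: mat_algebra mat_inv_left)
  qed
  have r2: "rapid y A (\<lambda>s. cnjm (u s) - mat 1)" using rapid_cnjm[OF u(1)] by (simp add: cnjm_diff)
  have cu: "((\<lambda>s. cnjm (u s)) \<longlongrightarrow> mat 1) A" using tendsto_cnjm[OF u1] by simp
  have rho: "rapid y A \<rho>"
  proof -
    have "rapid y A (\<lambda>s. (matrix_inv (u s) - mat 1) ** l s ** cnjm (u s) + l s ** (cnjm (u s) - mat 1))"
      by (intro rapid_add rapid_mult_right[OF rapid_polyn_right[OF l(1) r1] cu] rapid_polyn_left[OF l(1) r2])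
    then show ?thesis by (simp add: \<rho>_def[abs_def] mat_algebra)
  qed
  have lN: "UT NegT (l s)" for s using l(2) by (rule UT_LamT_NegT)
  have srho: "\<forall>\<^sub>F s in A. supp NegT (\<rho> s)"
    using u(2)
  proof eventually_elim
    case (elim s)
    have "UT NegT (matrix_inv (u s) ** l s ** cnjm (u s))"
      using UT_inv(2)[OF add_closed_types(1) elim] lN UT_cnj[OF elim] unfolding swap_NegT
      by (intro UT_mult add_closed_types)
    then have "supp NegT ((matrix_inv (u s) ** l s ** cnjm (u s) - mat 1) - (l s - mat 1))"
      using lN[of s] unfolding UT_def by (rule supp_diff)
    then show ?case by (simp add: \<rho>_def)
  qed
  have sX: "\<forall>\<^sub>F s in A. supp StabT (X s)" using h by (simp add: X_def UT_def)
  have sM: "\<forall>\<^sub>F s in A. supp LamT (M s)"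
    using lam
  proof eventually_elim
    case (elim s)
    have "supp LamT ((lam s - mat 1) - (l s - mat 1))" using elim l(2)[of s] unfolding UT_def by (rule supp_diff)
    then show ?case by (simp add: M_def)
  qed
  have zero: "\<forall>\<^sub>F s in A. blk (f s) a b = 0" if "\<forall>\<^sub>F s in A. supp S (f s)" "a - b \<notin> S" for S f a b
    using that(1) by eventually_elim (use that(2) in \<open>auto simp: supp_def\<close>)
  have lz: "blk (l s - mat 1) a b = 0" if "a - b \<notin> LamT" for s a b
    using l(2)[of s] that unfolding UT_def supp_def by blast
  have lp: "polyn y (\<lambda>s. blk (l s - mat 1) a b)" for a b
    unfolding blk_def by (intro polyn_mult polyn_minus l(1))
  have id: "\<forall>\<^sub>F s in A. \<rho> s + \<rho> s ** cnjm (X s) - X s ** (l s - mat 1) - X s ** M s + (l s - mat 1) ** cnjm (X s)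
      = M s + X s - cnjm (X s)"
    using eq
  proof eventually_elim
    case (elim s)
    have e: "(mat 1 + X s) ** (l s + M s) = (l s + \<rho> s) ** (mat 1 + cnjm (X s))"
      using elim by (simp add: X_def M_def \<rho>_def cnjm_diff)
    have "(mat 1 + X s) ** (l s + M s) = l s + M s + X s ** l s + X s ** M s"
      "(l s + \<rho> s) ** (mat 1 + cnjm (X s)) = l s + \<rho> s + l s ** cnjm (X s) + \<rho> s ** cnjm (X s)"
      by (simp_all add: mat_algebra)
    with e have eM: "M s = \<rho> s + l s ** cnjm (X s) + \<rho> s ** cnjm (X s) - X s ** l s - X s ** M s"
      by (simp add: algebra_simps)
    have "\<rho> s + \<rho> s ** cnjm (X s) - X s ** (l s - mat 1) - X s ** M s + (l s - mat 1) ** cnjm (X s)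
      = (\<rho> s + l s ** cnjm (X s) + \<rho> s ** cnjm (X s) - X s ** l s - X s ** M s) + X s - cnjm (X s)"
      by (simp add: mat_algebra)
    also have "\<dots> = M s + X s - cnjm (X s)" by (simp only: eM[symmetric])
    finally show ?case .
  qed
  have main: "rapid y A (\<lambda>s. blk (X s) a b) \<and> rapid y A (\<lambda>s. blk (M s) a b)" if "wt b - wt a \<le> int n" for n a b
    using that
  proof (induction n arbitrary: a b)
    case 0
    have t: "a - b \<notin> StabT" "a - b \<notin> LamT" using 0 by (auto simp: StabT_def LamT_def wt_def)
    from rapid_zero[OF zero[OF sX t(1)]] rapid_zero[OF zero[OF sM t(2)]] show ?case by (intro conjI)
  next
    case (Suc n)
    have CX: "rapid y A (\<lambda>s. blk (cnjm (X s)) c d)" if "wt d - wt c \<le> int n" for c d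
      unfolding blk_cnj using that by (intro rapid_cnjm conjunct1[OF Suc.IH]) simp
    have zl: "rapid y A (\<lambda>s. f s ** g s)" if "\<forall>\<^sub>F s in A. f s = 0" for f g :: "_ \<Rightarrow> complex^'n^'n"
      by (rule rapid_zero) (use that in \<open>eventually_elim, simp\<close>)
    have zr: "rapid y A (\<lambda>s. f s ** g s)" if "\<forall>\<^sub>F s in A. g s = 0" for f g :: "_ \<Rightarrow> complex^'n^'n"
      by (rule rapid_zero) (use that in \<open>eventually_elim, simp\<close>)
    have t1: "rapid y A (\<lambda>s. blk (\<rho> s ** cnjm (X s)) a b)"
    proof (rule rapid_blk_mult)
      fix z
      show "rapid y A (\<lambda>s. blk (\<rho> s) a z ** blk (cnjm (X s)) z b)"
      proof (cases "wt b - wt z \<le> int n")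
        case True
        from rapid_mult_right[OF rapid_blk[OF rho] rapid_tendsto[OF CX[OF True]]] show ?thesis .
      next
        case False
        then have "a - z \<notin> NegT" using Suc.prems by (auto simp: NegT_def)
        from zl[OF zero[OF srho this]] show ?thesis .
      qed
    qed
    have t2: "rapid y A (\<lambda>s. blk (X s ** (l s - mat 1)) a b)"
    proof (rule rapid_blk_mult)
      fix z
      show "rapid y A (\<lambda>s. blk (X s) a z ** blk (l s - mat 1) z b)"
      proof (cases "wt z - wt a \<le> int n")
        case True
        from rapid_polyn_right[OF lp conjunct1[OF Suc.IH[OF True]]] show ?thesis .
      next
        case False
        then have "z - b \<notin> LamT" using Suc.prems by (auto simp: LamT_def wt_def)
        then show ?thesis by (intro zr always_eventually allI lz)
      qed
    qed
    have t3: "rapid y A (\<lambda>s. blk (X s ** M s) a b)"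
    proof (rule rapid_blk_mult)
      fix z
      show "rapid y A (\<lambda>s. blk (X s) a z ** blk (M s) z b)"
      proof (cases "wt z - wt a \<le> int n")
        case True
        show ?thesis
        proof (cases "wt b - wt z \<le> int n")
          case True2: True
          from rapid_mult_right[OF conjunct1[OF Suc.IH[OF True]] rapid_tendsto[OF conjunct2[OF Suc.IH[OF True2]]]]
          show ?thesis .
        next
          case False
          then have "a - z \<notin> StabT" using Suc.prems by (auto simp: StabT_def)
          from zl[OF zero[OF sX this]] show ?thesis .
        qed
      next
        case False
        then have "z - b \<notin> LamT" using Suc.prems by (auto simp: LamT_def wt_def)
        from zr[OF zero[OF sM this]] show ?thesis .
      qed
    qed
    have t4: "rapid y A (\<lambda>s. blk ((l s - mat 1) ** cnjm (X s)) a b)"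
    proof (rule rapid_blk_mult)
      fix z
      show "rapid y A (\<lambda>s. blk (l s - mat 1) a z ** blk (cnjm (X s)) z b)"
      proof (cases "wt b - wt z \<le> int n")
        case True
        from rapid_polyn_left[OF lp CX[OF True]] show ?thesis .
      next
        case False
        then have "a - z \<notin> LamT" using Suc.prems by (auto simp: LamT_def wt_def)
        then show ?thesis by (intro zl always_eventually allI lz)
      qed
    qed
    have "rapid y A (\<lambda>s. blk (\<rho> s) a b + blk (\<rho> s ** cnjm (X s)) a b - blk (X s ** (l s - mat 1)) a b
        - blk (X s ** M s) a b + blk ((l s - mat 1) ** cnjm (X s)) a b)"
      by (intro rapid_add rapid_diff t1 t2 t3 t4 rapid_blk[OF rho])
    moreover have "\<forall>\<^sub>F s in A. blk (\<rho> s) a b + blk (\<rho> s ** cnjm (X s)) a b - blk (X s ** (l s - mat 1)) a b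
        - blk (X s ** M s) a b + blk ((l s - mat 1) ** cnjm (X s)) a b
        = blk (M s) a b + blk (X s) a b - cnjm (blk (X s) (prod.swap a) (prod.swap b))"
      using id by eventually_elim (simp only: blk_add[symmetric] blk_diff[symmetric] blk_cnj[symmetric])
    ultimately have tot: "rapid y A (\<lambda>s. blk (M s) a b + blk (X s) a b - cnjm (blk (X s) (prod.swap a) (prod.swap b)))"
      by (rule rapid_cong[rotated])
    consider "a - b \<in> LamT" | "a - b \<in> StabT" | "a - b \<notin> LamT" "a - b \<notin> StabT" by blast
    then show ?case
    proof cases
      case 1
      then have "a - b \<notin> StabT" "prod.swap a - prod.swap b \<notin> StabT" by (auto simp: LamT_def StabT_def swap_diff)
      note z = zero[OF sX this(1)] zero[OF sX this(2)]
      have "\<forall>\<^sub>F s in A. blk (M s) a b + blk (X s) a b - cnjm (blk (X s) (prod.swap a) (prod.swap b)) = blk (M s) a b"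
        using z by eventually_elim simp
      from rapid_cong[OF this tot] rapid_zero[OF z(1)] show ?thesis by (intro conjI)
    next
      case 2
      then have "a - b \<notin> LamT" "prod.swap a - prod.swap b \<notin> StabT"
        by (auto simp: LamT_def StabT_def swap_diff wt_def)
      note z = zero[OF sM this(1)] zero[OF sX this(2)]
      have "\<forall>\<^sub>F s in A. blk (M s) a b + blk (X s) a b - cnjm (blk (X s) (prod.swap a) (prod.swap b)) = blk (X s) a b"
        using z by eventually_elim simp
      from rapid_cong[OF this tot] rapid_zero[OF z(1)] show ?thesis by (intro conjI)
    next
      case 3
      from rapid_zero[OF zero[OF sX 3(2)]] rapid_zero[OF zero[OF sM 3(1)]] show ?thesis by (intro conjI)
    qed
  qed
  have Xr: "rapid y A (\<lambda>s. blk (X s) a b)" for a b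
    by (rule conjunct1[OF main[of _ _ "nat (wt b - wt a)"]]) simp
  have "rapid y A (\<lambda>s. \<Sum>a\<in>R. \<Sum>b\<in>R. blk (X s) a b)" by (intro rapid_sum Xr)
  then have "rapid y A X" by (simp flip: mat_decomp)
  from tendsto_add[OF rapid_tendsto[OF this] tendsto_const[of "mat 1"]] show ?thesis by (simp add: X_def)
qed

end

section \<open>The universal covering of the punctured disk\<close>

definition uhp :: "complex set" where "uhp = {z. 0 < Im z}"

lemma norm_cover: "norm (cover z) = exp (- 2 * pi * Im z)"
  by (simp add: cover_def)

lemma cover_punctured_disk: "z \<in> uhp \<Longrightarrow> cover z \<in> punctured_disk"
  using norm_cover[of z] by (simp add: uhp_def punctured_disk_def) (simp add: cover_def)

lemma cover_lt_1: "norm (cover z) < 1 \<Longrightarrow> z \<in> uhp"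
  by (simp add: norm_cover uhp_def zero_less_mult_iff)

lemma cover_plus_1: "cover (z + 1) = cover z"
proof -
  have "cover (z + 1) = exp (2 * of_real pi * \<i> * z) * exp (2 * of_real pi * \<i>)"
    by (simp add: cover_def ring_distribs exp_add)
  then show ?thesis by (simp add: cover_def)
qed

lemma cover_eqD: "cover a = cover b \<Longrightarrow> \<exists>n::int. a = b + of_int n"
proof -
  assume "cover a = cover b"
  then obtain n :: int where "2 * of_real pi * \<i> * a = 2 * of_real pi * \<i> * b + (of_int (2 * n) * pi) * \<i>"
    unfolding cover_def exp_eq by blast
  then have "(2 * of_real pi * \<i>) * a = (2 * of_real pi * \<i>) * (b + of_int n)" by (simp add: algebra_simps)
  then have "a = b + of_int n" by simp
  then show ?thesis by blast
qed

lemma cover_lift: "s \<noteq> 0 \<Longrightarrow> cover (lift s) = s"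
  by (simp add: cover_def lift_def)

lemma Im_lift: "s \<noteq> 0 \<Longrightarrow> Im (lift s) = - ln (norm s) / (2 * pi)"
proof -
  assume s: "s \<noteq> 0"
  have "Ln s = 2 * of_real pi * \<i> * lift s" by (simp add: lift_def)
  then have "Re (Ln s) = - (2 * pi * Im (lift s))" by simp
  then show ?thesis using s by (simp add: field_simps)
qed

lemma lift_uhp: "s \<in> punctured_disk \<Longrightarrow> lift s \<in> uhp"
  using cover_lift[of s] cover_lt_1[of "lift s"] by (simp add: punctured_disk_def)

lemma convex_uhp: "convex uhp"
  unfolding uhp_def by (rule convex_halfspace_Im_gt)

lemma continuous_cover: "continuous_on A cover"
  unfolding cover_def by (intro continuous_intros)

lemma path_cover:
  assumes "a \<in> uhp" "b \<in> uhp"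
  shows "path (cover \<circ> linepath a b)" "path_image (cover \<circ> linepath a b) \<subseteq> punctured_disk"
    "pathstart (cover \<circ> linepath a b) = cover a" "pathfinish (cover \<circ> linepath a b) = cover b"
proof -
  show "path (cover \<circ> linepath a b)" by (rule path_continuous_image[OF path_linepath continuous_cover])
  have "closed_segment a b \<subseteq> uhp" using assms convex_uhp by (simp add: closed_segment_subset)
  then show "path_image (cover \<circ> linepath a b) \<subseteq> punctured_disk"
    unfolding path_image_compose path_image_linepath using cover_punctured_disk by blast
qed (simp_all add: pathstart_compose pathfinish_compose)

lemma open_punctured_disk: "open punctured_disk"
  unfolding punctured_disk_def by (intro open_Diff) auto

text \<open>The branch of the inverse of \<open>cover\<close> at \<open>cover z = s\<close>.\<close>

definition branch :: "complex \<Rightarrow> complex \<Rightarrow> complex \<Rightarrow> complex" where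
  "branch z s t = z + Ln (t / s) / (2 * of_real pi * \<i>)"

lemma cover_branch: "s \<noteq> 0 \<Longrightarrow> t \<noteq> 0 \<Longrightarrow> cover z = s \<Longrightarrow> cover (branch z s t) = t"
proof -
  assume *: "s \<noteq> 0" "t \<noteq> 0" "cover z = s"
  have "2 * of_real pi * \<i> * branch z s t = 2 * of_real pi * \<i> * z + Ln (t / s)"
    by (simp add: branch_def ring_distribs)
  then have "cover (branch z s t) = cover z * exp (Ln (t / s))" by (simp add: cover_def exp_add)
  then show ?thesis using * by simp
qed

lemma Re_near: "t \<in> ball s (norm s) \<Longrightarrow> 0 < Re (t / s)"
proof -
  assume t: "t \<in> ball s (norm s)"
  then have s: "s \<noteq> 0" by auto
  have "norm (1 - t / s) = norm (s - t) / norm s" using s by (simp add: norm_divide[symmetric] field_simps)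
  also have "\<dots> < 1" using t s by (simp add: dist_norm divide_less_eq)
  finally have "Re (1 - t / s) < 1" using complex_Re_le_cmod[of "1 - t / s"] by linarith
  then show ?thesis by simp
qed

lemma branch_holomorphic: "branch z s holomorphic_on ball s (norm s)"
proof -
  have "t / s \<notin> \<real>\<^sub>\<le>\<^sub>0" if "t \<in> ball s (norm s)" for t
    using Re_near[OF that] by (auto simp: complex_nonpos_Reals_iff)
  moreover have "s \<noteq> 0 \<or> ball s (norm s) = {}" by auto
  ultimately show ?thesis
    unfolding branch_def[abs_def] by (cases "s = 0") (auto intro!: holomorphic_intros)
qed

lemma branch_deriv: "s \<noteq> 0 \<Longrightarrow> ((\<lambda>t. branch z s t - z) has_field_derivative 1 / (2 * of_real pi * \<i> * s)) (at s)"
proof -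
  assume s: "s \<noteq> 0"
  have "((\<lambda>t. Ln (t / s) / (2 * of_real pi * \<i>)) has_field_derivative (inverse (s / s) * (1 / s)) / (2 * of_real pi * \<i>)) (at s)"
    using s by (auto intro!: derivative_eq_intros simp: field_simps)
  then show ?thesis using s by (simp add: branch_def field_simps)
qed

text \<open>Both paths stay in the convex set of the points \<open>w\<close> of the disk with \<open>Re (w / s) > 0\<close>, which does not
  contain \<open>0\<close>.\<close>

lemma homotopic_branch:
  assumes s: "s \<in> punctured_disk" and z: "cover z = s" and t: "t \<in> ball s (norm s)" "t \<in> punctured_disk"
  shows "homotopic_paths punctured_disk (cover \<circ> linepath z (branch z s t)) (linepath s t)"
proof -
  have s0: "s \<noteq> 0" and t0: "t \<noteq> 0" and n: "norm s < 1" "norm t < 1"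
    using s t by (auto simp: punctured_disk_def)
  have zu: "z \<in> uhp" using n z by (intro cover_lt_1) simp
  have cb: "cover (branch z s t) = t" by (rule cover_branch[OF s0 t0 z])
  have bu: "branch z s t \<in> uhp" using n cb by (intro cover_lt_1) simp
  define C where "C = (\<lambda>w. w / s) -` {w. 0 < Re w} \<inter> ball 0 1"
  have "convex C" unfolding C_def
    by (intro convex_Int convex_linear_vimage convex_halfspace_Re_gt convex_ball
        bounded_linear.linear bounded_linear_divide)
  have CD: "C \<subseteq> punctured_disk" by (auto simp: C_def punctured_disk_def)
  have im: "cover (linepath z (branch z s t) x) \<in> C" if x: "x \<in> {0..1}" for x
  proof -
    have lp: "linepath z (branch z s t) x = z + of_real x * (Ln (t / s) / (2 * of_real pi * \<i>))"
      unfolding linepath_def branch_def scaleR_conv_of_real by (simp add: algebra_simps)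
    have "2 * of_real pi * \<i> * linepath z (branch z s t) x = 2 * of_real pi * \<i> * z + of_real x * Ln (t / s)"
      unfolding lp by (simp add: ring_distribs)
    then have c: "cover (linepath z (branch z s t) x) = s * exp (of_real x * Ln (t / s))"
      using z by (simp add: cover_def exp_add)
    have "\<bar>Im (Ln (t / s))\<bar> < pi / 2" using Re_near[OF t(1)] by (rule Re_Ln_pos_lt_imp)
    moreover have "\<bar>x * Im (Ln (t / s))\<bar> \<le> \<bar>Im (Ln (t / s))\<bar>" using x by (simp add: abs_mult mult_left_le_one_le)
    ultimately have "\<bar>Im (of_real x * Ln (t / s))\<bar> < pi / 2" by simp
    then have "0 < cos (Im (of_real x * Ln (t / s)))" by (intro cos_gt_zero_pi) (auto simp: abs_less_iff)
    then have "0 < Re (exp (of_real x * Ln (t / s)))" by (simp add: Re_exp)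
    moreover have "linepath z (branch z s t) x \<in> uhp"
    proof -
      have "linepath z (branch z s t) x \<in> closed_segment z (branch z s t)"
        using x by (auto simp: closed_segment_def linepath_def)
      then show ?thesis using closed_segment_subset[OF zu bu convex_uhp] by blast
    qed
    then have "cover (linepath z (branch z s t) x) \<in> ball 0 1"
      using cover_punctured_disk by (auto simp: punctured_disk_def)
    ultimately show ?thesis using s0 unfolding C_def c by simp
  qed
  have sC: "s \<in> C" and tC: "t \<in> C" using s0 n Re_near[OF t(1)] by (auto simp: C_def)
  show ?thesis
  proof (rule homotopic_paths_linear)
    show "path (cover \<circ> linepath z (branch z s t))" by (rule path_cover[OF zu bu])
    show "pathstart (linepath s t) = pathstart (cover \<circ> linepath z (branch z s t))"
      "pathfinish (linepath s t) = pathfinish (cover \<circ> linepath z (branch z s t))"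
      using path_cover(3,4)[OF zu bu] z cb by simp_all
    fix x :: real assume x: "x \<in> {0..1}"
    have "linepath s t x \<in> C"
    proof -
      have "linepath s t x \<in> closed_segment s t" using x by (auto simp: closed_segment_def linepath_def)
      then show ?thesis using closed_segment_subset[OF sC tC \<open>convex C\<close>] by blast
    qed
    then have "closed_segment ((cover \<circ> linepath z (branch z s t)) x) (linepath s t x) \<subseteq> C"
      using im[OF x] \<open>convex C\<close> by (intro closed_segment_subset) auto
    then show "closed_segment ((cover \<circ> linepath z (branch z s t)) x) (linepath s t x) \<subseteq> punctured_disk"
      using CD by blast
  qed simp
qed

section \<open>Variations over the punctured disk\<close>

locale variation =
  fixes P :: "(real \<Rightarrow> complex) \<Rightarrow> complex ^ 'n ^ 'n"
    and W F :: "complex \<Rightarrow> int \<Rightarrow> (complex ^ 'n) set"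
    and Q :: "complex \<Rightarrow> int \<Rightarrow> complex ^ 'n \<Rightarrow> complex ^ 'n \<Rightarrow> complex"
    and z0 :: complex
  assumes V: "gp_vmhs punctured_disk P W F Q"
    and C: "constant_graded punctured_disk P W F"
    and z0: "z0 \<in> uhp"
begin

abbreviation "D \<equiv> punctured_disk"

lemma local_system: "rational_local_system D P"
  using V unfolding gp_vmhs_def by (elim conjE)

lemma P_inv: "path \<gamma> \<Longrightarrow> path_image \<gamma> \<subseteq> D \<Longrightarrow> invertible (P \<gamma>)"
  using local_system unfolding rational_local_system_def by blast

lemma P_real: "path \<gamma> \<Longrightarrow> path_image \<gamma> \<subseteq> D \<Longrightarrow> cnjm (P \<gamma>) = P \<gamma>"
proof -
  assume "path \<gamma>" "path_image \<gamma> \<subseteq> D"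
  then have "P \<gamma> $ i $ j \<in> \<rat>" for i j using local_system unfolding rational_local_system_def by blast
  moreover have "cnj x = x" if "x \<in> \<rat>" for x
    using that by (elim Rats_cases') simp
  ultimately show ?thesis by (simp add: vec_eq_iff)
qed

lemma P_homotopic: "homotopic_paths D \<gamma> \<gamma>' \<Longrightarrow> P \<gamma> = P \<gamma>'"
  using local_system unfolding rational_local_system_def by blast

lemma P_join: "path \<gamma> \<Longrightarrow> path_image \<gamma> \<subseteq> D \<Longrightarrow> path \<gamma>' \<Longrightarrow> path_image \<gamma>' \<subseteq> D \<Longrightarrow>
    pathfinish \<gamma> = pathstart \<gamma>' \<Longrightarrow> P (\<gamma> +++ \<gamma>') = P \<gamma>' ** P \<gamma>"
  using local_system unfolding rational_local_system_def by blast

lemma P_refl: assumes "s \<in> D" shows "P (linepath s s) = mat 1"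
proof -
  let ?c = "linepath s s"
  have c: "path ?c" "path_image ?c \<subseteq> D" using assms by auto
  have "?c = (\<lambda>_. s)" by (simp add: linepath_refl)
  then have "?c +++ ?c = ?c" by (simp add: joinpaths_def)
  then have "P ?c ** P ?c = P ?c" using P_join[OF c c] by simp
  then show ?thesis using P_inv[OF c] mat_inv_left' mat_inv_right'
    by (metis mat_inv_right)
qed

lemma P_reverse:
  assumes "path \<gamma>" "path_image \<gamma> \<subseteq> D"
  shows "P (reversepath \<gamma>) ** P \<gamma> = mat 1"
proof -
  have "pathstart \<gamma> \<in> D" using assms(2) pathstart_in_path_image by blast
  have "P (reversepath \<gamma>) ** P \<gamma> = P (\<gamma> +++ reversepath \<gamma>)"
    using assms by (intro P_join[symmetric]) auto
  also have "\<dots> = P (linepath (pathstart \<gamma>) (pathstart \<gamma>))"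
    by (intro P_homotopic homotopic_paths_rinv assms)
  finally show ?thesis using P_refl[OF \<open>pathstart \<gamma> \<in> D\<close>] by simp
qed

abbreviation Tr :: "complex \<Rightarrow> complex ^ 'n ^ 'n" where "Tr \<equiv> translate P z0"

lemma Tr_inv: "z \<in> uhp \<Longrightarrow> invertible (Tr z)"
  unfolding translate_def using path_cover[OF z0] by (intro P_inv)

lemma Tr_real: "z \<in> uhp \<Longrightarrow> cnjm (Tr z) = Tr z"
  unfolding translate_def using path_cover[OF z0] by (intro P_real)

text \<open>The upper half-plane is convex, so that the direct segment is homotopic to the broken line.\<close>

lemma Tr_compose:
  assumes a: "a \<in> uhp" and b: "b \<in> uhp"
  shows "Tr b = P (cover \<circ> linepath a b) ** Tr a"
proof -
  let ?g = "linepath z0 a +++ linepath a b"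
  have sub: "closed_segment x y \<subseteq> uhp" if "x \<in> uhp" "y \<in> uhp" for x y
    using closed_segment_subset[OF that convex_uhp] .
  have gi: "path_image ?g \<subseteq> uhp" using sub[OF z0 a] sub[OF a b] by (simp add: path_image_join)
  have "homotopic_paths uhp ?g (linepath z0 b)"
  proof (rule homotopic_paths_linear)
    fix x :: real assume x: "x \<in> {0..1}"
    have "?g x \<in> uhp" using gi x by (auto simp: path_image_def)
    moreover have "linepath z0 b x \<in> uhp"
      using sub[OF z0 b] x by (force simp: closed_segment_def linepath_def)
    ultimately show "closed_segment (?g x) (linepath z0 b x) \<subseteq> uhp" by (rule sub)
  qed auto
  then have "homotopic_paths D (cover \<circ> ?g) (cover \<circ> linepath z0 b)"
    by (rule homotopic_paths_continuous_image[OF _ continuous_cover]) (use cover_punctured_disk in auto)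
  then have "Tr b = P (cover \<circ> ?g)" unfolding translate_def by (rule P_homotopic[symmetric])
  also have "\<dots> = P ((cover \<circ> linepath z0 a) +++ (cover \<circ> linepath a b))" by (simp only: path_compose_join)
  also have "\<dots> = P (cover \<circ> linepath a b) ** Tr a"
    unfolding translate_def using path_cover[OF z0 a] path_cover[OF a b] by (intro P_join) auto
  finally show ?thesis .
qed

lemma z0_plus_1: "z0 + 1 \<in> uhp" using z0 by (simp add: uhp_def)

lemma Tr_plus_1: "z \<in> uhp \<Longrightarrow> Tr (z + 1) = Tr z ** monodromy P z0"
proof -
  assume z: "z \<in> uhp"
  then have z1: "z + 1 \<in> uhp" by (simp add: uhp_def)
  have "cover (linepath (z0 + 1) (z + 1) x) = cover (linepath z0 z x)" for x
  proof -
    have "linepath (z0 + 1) (z + 1) x = linepath z0 z x + 1"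
      unfolding linepath_def scaleR_conv_of_real by (simp add: algebra_simps)
    then show ?thesis by (simp add: cover_plus_1)
  qed
  then have "cover \<circ> linepath (z0 + 1) (z + 1) = cover \<circ> linepath z0 z" by (simp add: fun_eq_iff)
  then show ?thesis using Tr_compose[OF z0_plus_1 z1] by (simp add: translate_def monodromy_def)
qed

lemma Tr_branch:
  assumes s: "s \<in> D" and z: "cover z = s" and t: "t \<in> ball s (norm s)" "t \<in> D"
  shows "P (linepath t s) ** Tr (branch z s t) = Tr z" "path (linepath t s)" "path_image (linepath t s) \<subseteq> D"
proof -
  have n: "norm s < 1" "norm t < 1" "s \<noteq> 0" "t \<noteq> 0" using s t by (auto simp: punctured_disk_def)
  have zu: "z \<in> uhp" using n z by (intro cover_lt_1) simp
  have bu: "branch z s t \<in> uhp" using cover_branch[OF n(3,4) z] n by (intro cover_lt_1) simp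
  have hom: "homotopic_paths D (cover \<circ> linepath z (branch z s t)) (linepath s t)"
    by (rule homotopic_branch[OF s z t])
  have st: "path_image (linepath s t) \<subseteq> D" using homotopic_paths_imp_subset[OF hom] by blast
  have "P (linepath t s) ** P (linepath s t) = mat 1" using P_reverse[OF path_linepath st] by simp
  moreover have "Tr (branch z s t) = P (linepath s t) ** Tr z"
    using Tr_compose[OF zu bu] P_homotopic[OF hom] by simp
  ultimately show "P (linepath t s) ** Tr (branch z s t) = Tr z" by (simp add: matrix_mul_assoc)
  show "path (linepath t s)" by simp
  show "path_image (linepath t s) \<subseteq> D" using st by (simp add: closed_segment_commute)
qed

lemma mhs_at: "s \<in> D \<Longrightarrow> mixed_hodge_structure (F s) (W s)"
  using V unfolding gp_vmhs_def by blast

lemma Tr_W: "z \<in> uhp \<Longrightarrow> (*v) (Tr z) ` W (cover z0) k = W (cover z) k"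
proof -
  assume z: "z \<in> uhp"
  have "\<forall>\<gamma>. path \<gamma> \<and> path_image \<gamma> \<subseteq> D \<longrightarrow> (\<forall>k. (*v) (P \<gamma>) ` W (pathstart \<gamma>) k = W (pathfinish \<gamma>) k)"
    using V unfolding gp_vmhs_def by (elim conjE)
  from this[rule_format, of "cover \<circ> linepath z0 z"] path_cover[OF z0 z]
  show ?thesis by (simp add: translate_def)
qed

lemma Tr_gr: "z \<in> uhp \<Longrightarrow> (*v) (Tr z) ` gr_ind (F (cover z0)) (W (cover z0)) k p = gr_ind (F (cover z)) (W (cover z)) k p"
proof -
  assume z: "z \<in> uhp"
  from C[unfolded constant_graded_def, rule_format, of "cover \<circ> linepath z0 z" k] path_cover[OF z0 z]
  show ?thesis by (simp add: translate_def)
qed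

lemma monodromy_W: "v \<in> W (cover z0) k \<Longrightarrow> monodromy P z0 *v v - v \<in> W (cover z0) (k - 1)"
proof -
  assume v: "v \<in> W (cover z0) k"
  from C[unfolded constant_graded_def, rule_format, of "cover \<circ> linepath z0 (z0 + 1)" k]
    path_cover[OF z0 z0_plus_1] v
  show ?thesis by (simp add: monodromy_def translate_def cover_plus_1)
qed

lemma monodromy_real: "cnjm (monodromy P z0) = monodromy P z0"
  unfolding monodromy_def by (rule Tr_real[OF z0_plus_1])

end

section \<open>Frames of subspaces\<close>

text \<open>A basis of \<open>S\<close> extended to a basis of the whole space.\<close>

lemma subspace_coord_frame:
  fixes S :: "(complex^'n) set"
  assumes S: "vec.subspace S"
  shows "\<exists>(C :: complex^'n^'n) J. invertible C \<and> S = (*v) C ` coord_subspace J"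
proof -
  obtain B where B: "B \<subseteq> S" "vec.independent B" "S \<subseteq> vec.span B" using vec.basis_exists[of S] by metis
  obtain B' where B': "B \<subseteq> B'" "vec.independent B'" "UNIV \<subseteq> vec.span B'"
    using vec.maximal_independent_subset_extend[OF subset_UNIV B(2)] by metis
  have "card B' = CARD('n)"
    using vec.basis_card_eq_dim[OF subset_UNIV B'(3,2)] vec_dim_card[where 'a=complex and 'n='n] by simp
  moreover have "finite B'" by (rule vec.finiteI_independent[OF B'(2)])
  ultimately obtain b :: "'n \<Rightarrow> complex^'n" where b: "bij_betw b UNIV B'"
    using finite_same_card_bij[of "UNIV :: 'n set" B'] by auto
  have rb: "range b = B'" using b by (simp add: bij_betw_def)
  define M :: "complex^'n^'n" where "M = (\<chi> i j. b j $ i)"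
  have col: "column j M = b j" for j by (simp add: column_def M_def vec_eq_iff)
  have "columns M = B'" unfolding columns_def col using rb by auto
  then have "\<exists>N. M ** N = mat 1" using matrix_right_invertible_span_columns[of M] B'(3) by auto
  then have iM: "invertible M" using invertible_right_inverse by blast
  define J where "J = {j. b j \<in> B}"
  have Mv: "M *v v = (\<Sum>j\<in>UNIV. v $ j *s b j)" for v by (simp add: matrix_mult_sum col)
  have "S = (*v) M ` coord_subspace J"
  proof
    have "B \<subseteq> (*v) M ` coord_subspace J"
    proof
      fix w assume w: "w \<in> B"
      then obtain j where j: "w = b j" using B'(1) rb by blast
      have "M *v axis j 1 = (\<Sum>i\<in>UNIV. if i = j then b i else 0)"
        unfolding Mv by (rule sum.cong) (auto simp: axis_def)
      then have "M *v axis j 1 = w" by (simp add: j)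
      moreover have "axis j 1 \<in> coord_subspace J"
        using w j by (auto simp: coord_subspace_def J_def axis_def)
      ultimately show "w \<in> (*v) M ` coord_subspace J" by blast
    qed
    moreover have "vec.subspace (coord_subspace J :: (complex^'n) set)"
      by (auto simp: vec.subspace_def coord_subspace_def)
    then have "vec.subspace ((*v) M ` coord_subspace J)" by (rule subspace_mv_image)
    ultimately show "S \<subseteq> (*v) M ` coord_subspace J"
      using B(3) vec.span_minimal by blast
    show "(*v) M ` coord_subspace J \<subseteq> S"
    proof clarify
      fix v :: "complex^'n" assume v: "v \<in> coord_subspace J"
      show "M *v v \<in> S"
        unfolding Mv
      proof (rule vec.subspace_sum[OF S])
        fix j
        show "v $ j *s b j \<in> S"
        proof (cases "j \<in> J")
          case True
          then have "b j \<in> S" using B(1) by (auto simp: J_def)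
          then show ?thesis by (rule vec.subspace_scale[OF S])
        next
          case False
          then have "v $ j = 0" using v by (simp add: coord_subspace_def)
          then show ?thesis using vec.subspace_0[OF S] by simp
        qed
      qed
    qed
  qed
  then show ?thesis using iM by blast
qed

lemma subspace_tendsto_moving:
  fixes g :: "'a \<Rightarrow> complex^'n^'n"
  assumes g: "(g \<longlongrightarrow> g0) A" "invertible g0" and S: "vec.subspace S"
    and E: "\<forall>\<^sub>F s in A. E s = (*v) (g s) ` S"
  shows "subspace_tendsto E ((*v) g0 ` S) A"
proof -
  obtain M :: "complex^'n^'n" and J where M: "invertible M" "S = (*v) M ` coord_subspace J"
    using subspace_coord_frame[OF S] by blast
  have "((\<lambda>s. g s ** M) \<longlongrightarrow> g0 ** M) A" by (intro tendsto_mat_mult g tendsto_const)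
  moreover have "invertible (g0 ** M)" using g(2) M(1) by (rule invertible_mult)
  moreover have "(*v) g0 ` S = (*v) (g0 ** M) ` coord_subspace J" by (simp only: M(2) image_mat_mult)
  moreover have "\<forall>\<^sub>F s in A. E s = (*v) (g s ** M) ` coord_subspace J"
    using E by eventually_elim (simp only: M(2) image_mat_mult)
  ultimately show ?thesis unfolding subspace_tendsto_def
    by (intro exI[of _ "\<lambda>s. g s ** M"] exI[of _ "g0 ** M"] exI[of _ J] conjI)
qed

lemma subspace_tendsto_image:
  fixes K :: "complex^'n^'n"
  assumes E: "subspace_tendsto E E0 A" and K: "invertible K"
  shows "subspace_tendsto (\<lambda>s. (*v) K ` E s) ((*v) K ` E0) A"
proof -
  obtain B :: "_ \<Rightarrow> complex^'n^'n" and B0 J where B: "(B \<longlongrightarrow> B0) A" "invertible B0"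
    "E0 = (*v) B0 ` coord_subspace J" "\<forall>\<^sub>F s in A. E s = (*v) (B s) ` coord_subspace J"
    using E unfolding subspace_tendsto_def by blast
  have "((\<lambda>s. K ** B s) \<longlongrightarrow> K ** B0) A" by (intro tendsto_mat_mult B tendsto_const)
  moreover have "invertible (K ** B0)" using K B(2) by (rule invertible_mult)
  moreover have "(*v) K ` E0 = (*v) (K ** B0) ` coord_subspace J" by (simp only: B(3) image_mat_mult)
  moreover have "\<forall>\<^sub>F s in A. (*v) K ` E s = (*v) (K ** B s) ` coord_subspace J"
    using B(4) by eventually_elim (simp only: image_mat_mult)
  ultimately show ?thesis unfolding subspace_tendsto_def
    by (intro exI[of _ "\<lambda>s. K ** B s"] exI[of _ "K ** B0"] exI[of _ J] conjI)
qed

lemma gr_ind_image: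
  fixes K :: "complex^'n^'n"
  assumes K: "invertible K"
  shows "gr_ind (\<lambda>p. (*v) K ` F p) (\<lambda>k. (*v) K ` W k) k p = (*v) K ` gr_ind F W k p"
  unfolding gr_ind_def image_set_plus image_Int[OF inj_invertible[OF K]] ..

lemma deriv_mat_vec:
  fixes A :: "complex \<Rightarrow> complex^'n^'n"
  assumes A: "\<And>i j. ((\<lambda>t. A t $ i $ j) has_field_derivative A' $ i $ j) (at s)"
    and v: "\<And>j. ((\<lambda>t. v t $ j) has_field_derivative v' $ j) (at s)"
  shows "((\<lambda>t. (A t *v v t) $ i) has_field_derivative (A' *v v s + A s *v v') $ i) (at s)"
proof -
  have "((\<lambda>t. \<Sum>j\<in>UNIV. A t $ i $ j * v t $ j) has_field_derivative
      (\<Sum>j\<in>UNIV. A' $ i $ j * v s $ j + v' $ j * A s $ i $ j)) (at s)"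
    by (intro DERIV_sum DERIV_mult A v)
  then show ?thesis by (simp add: matrix_vector_mult_def sum.distrib mult.commute)
qed

lemma deriv_mexp_0:
  fixes N :: "complex^'n^'n"
  assumes N: "nilpotent N" and w: "(w has_field_derivative w') (at s)" "w s = 0"
  shows "((\<lambda>t. mexp (mat (w t) ** N) $ i $ j) has_field_derivative (mat w' ** N) $ i $ j) (at s)"
proof -
  have e: "mexp (mat (w t) ** N) $ i $ j = (\<Sum>k\<le>CARD('n). w t ^ k * (matpow N k $ i $ j / fact k))" for t
    by (simp add: mexp_scalar[OF N] fps_ev_def mat_scalar_nth)
  have "((\<lambda>t. \<Sum>k\<le>CARD('n). w t ^ k * (matpow N k $ i $ j / fact k)) has_field_derivative
      (\<Sum>k\<le>CARD('n). (of_nat k * (w' * w s ^ (k - Suc 0))) * (matpow N k $ i $ j / fact k))) (at s)"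
    by (intro DERIV_sum DERIV_cmult_right DERIV_power w)
  also have "(\<Sum>k\<le>CARD('n). (of_nat k * (w' * w s ^ (k - Suc 0))) * (matpow N k $ i $ j / fact k))
      = (\<Sum>k\<in>{1}. (of_nat k * (w' * w s ^ (k - Suc 0))) * (matpow N k $ i $ j / fact k))"
    using w(2) by (intro sum.mono_neutral_right) (auto simp: Suc_le_eq power_0_left)
  finally show ?thesis by (simp add: e mat_scalar_nth)
qed

context bigraded_frame
begin

lemma supp_HW:
  assumes "\<And>k v. v \<in> HW k \<Longrightarrow> A *v v \<in> HW (k - j)"
  shows "supp {d. wt d \<le> - j} A"
proof (rule sec_image_supp)
  fix v y assume "v \<in> sec {y}"
  then have "v \<in> HW (wt y)" unfolding HW_def by (rule sec_mono[THEN subsetD, rotated]) simp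
  from assms[OF this] show "A *v v \<in> sec {x. x - y \<in> {d. wt d \<le> - j}}"
    unfolding HW_def by (rule sec_mono[THEN subsetD, rotated]) auto
qed

lemma HW_supp: "supp {d. wt d \<le> - j} A \<Longrightarrow> v \<in> HW k \<Longrightarrow> A *v v \<in> HW (k - j)"
  unfolding HW_def by (rule supp_sec) auto

lemma NegT_eq: "NegT = {d. wt d \<le> - 1}" by (auto simp: NegT_def)

lemma hol_filtration_image:
  assumes F: "hol_filtration F S" and K: "invertible K"
  shows "hol_filtration (\<lambda>t p. (*v) K ` F t p) S"
  unfolding hol_filtration_def
proof (intro ballI allI)
  fix s p assume s: "s \<in> S"
  obtain r and B :: "complex \<Rightarrow> complex^'n^'n" and J where r: "0 < r" "ball s r \<subseteq> S" "hol_mat B (ball s r)"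
    "\<forall>t\<in>ball s r. invertible (B t) \<and> F t p = (*v) (B t) ` coord_subspace J"
    using F s by (rule hol_filtrationE[where p = p])
  have "hol_mat (\<lambda>t. K ** B t) (ball s r)" by (intro hol_mat_mult hol_mat_const r)
  moreover have "\<forall>t\<in>ball s r. invertible (K ** B t) \<and> (*v) K ` F t p = (*v) (K ** B t) ` coord_subspace J"
    using r K invertible_mult image_mat_mult by metis
  ultimately show "\<exists>r>0. ball s r \<subseteq> S \<and> (\<exists>(B :: complex \<Rightarrow> complex^'n^'n) J. hol_mat B (ball s r) \<and>
      (\<forall>t\<in>ball s r. invertible (B t) \<and> (*v) K ` F t p = (*v) (B t) ` coord_subspace J))"
    using r by (intro exI[of _ r] exI[of _ "\<lambda>t. K ** B t"] exI[of _ J] conjI) auto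
qed

lemma dim_gr_HF:
  fixes h :: "int \<Rightarrow> int \<Rightarrow> nat"
  assumes h: "\<And>p q. h p q = vec.dim (sec {(p, q)})"
  shows "vec.dim (gr_ind HF HW k p) - vec.dim (HW (k - 1)) = (\<Sum>r \<in> {r. p \<le> r \<and> h r (k - r) \<noteq> 0}. h r (k - r))"
proof -
  let ?S = "{x. p \<le> fst x \<and> wt x = k}"
  have hR: "x \<in> R" if "vec.dim (sec {x}) \<noteq> 0" for x
  proof (rule ccontr)
    assume "x \<notin> R"
    then have "sec {x} = {0}" using sec_R[of "{x}"] sec_empty by simp
    then show False using that by simp
  qed
  have e: "{x::int \<times> int. wt x < k} = {x. wt x \<le> k - 1}" by auto
  have "vec.dim (gr_ind HF HW k p) = vec.dim (sec ?S) + vec.dim (HW (k - 1))"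
    unfolding gr_HF e HW_def by (rule dim_sec_Un) auto
  then have "vec.dim (gr_ind HF HW k p) - vec.dim (HW (k - 1)) = (\<Sum>x\<in>?S\<inter>R. vec.dim (sec {x}))"
    using dim_sec[of ?S] by simp
  also have "\<dots> = (\<Sum>x\<in>(\<lambda>r. (r, k - r)) ` {r. p \<le> r \<and> h r (k - r) \<noteq> 0}. vec.dim (sec {x}))"
  proof (rule sum.mono_neutral_right)
    show "finite (?S \<inter> R)" using finR by simp
    show "(\<lambda>r. (r, k - r)) ` {r. p \<le> r \<and> h r (k - r) \<noteq> 0} \<subseteq> ?S \<inter> R"
      using hR by (auto simp: h)
    show "\<forall>x\<in>?S \<inter> R - (\<lambda>r. (r, k - r)) ` {r. p \<le> r \<and> h r (k - r) \<noteq> 0}. vec.dim (sec {x}) = 0"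
    proof (intro ballI, rule ccontr)
      fix x assume x: "x \<in> ?S \<inter> R - (\<lambda>r. (r, k - r)) ` {r. p \<le> r \<and> h r (k - r) \<noteq> 0}" "vec.dim (sec {x}) \<noteq> 0"
      then have "x = (fst x, k - fst x)" by (auto simp: wt_def prod_eq_iff)
      moreover from this have "h (fst x) (k - fst x) \<noteq> 0" using x(2) by (simp only: h) simp
      ultimately have "x \<in> (\<lambda>r. (r, k - r)) ` {r. p \<le> r \<and> h r (k - r) \<noteq> 0}" using x(1) by blast
      then show False using x(1) by blast
    qed
  qed
  also have "\<dots> = (\<Sum>r \<in> {r. p \<le> r \<and> h r (k - r) \<noteq> 0}. h r (k - r))"
    by (subst sum.reindex) (auto simp: inj_on_def h)
  finally show ?thesis .
qed

lemma HF_top: "\<exists>a. HF a = UNIV" and HF_bot: "\<exists>b. HF b = {0}"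
proof -
  define a where "a = Min (insert 0 (fst ` R))"
  have "R \<subseteq> {x. a \<le> fst x}"
  proof
    fix x assume "x \<in> R"
    then have "Min (insert 0 (fst ` R)) \<le> fst x" using finR by (intro Min_le) auto
    then show "x \<in> {x. a \<le> fst x}" by (simp add: a_def)
  qed
  then have "{x. a \<le> fst x} \<inter> R = UNIV \<inter> R" by blast
  then have "HF a = UNIV" unfolding HF_def using sec_R[of "{x. a \<le> fst x}"] sec_R[of UNIV] sec_UNIV by simp
  then show "\<exists>a. HF a = UNIV" by blast
  define b where "b = Max (insert 0 (fst ` R)) + 1"
  have "fst x < b" if "x \<in> R" for x
  proof -
    have "fst x \<le> Max (insert 0 (fst ` R))" using finR that by (intro Max_ge) auto
    then show ?thesis by (simp add: b_def)
  qed
  then have "{x. b \<le> fst x} \<inter> R = {}" by force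
  then have "HF b = {0}" unfolding HF_def using sec_R[of "{x. b \<le> fst x}"] sec_empty by simp
  then show "\<exists>b. HF b = {0}" by blast
qed

end

section \<open>The period map of a variation with constant graded pieces\<close>

text \<open>A variation together with a frame adapted to the mixed Hodge structure of the reference fibre.\<close>

locale framed_variation = variation P W F Q z0 + bigraded_frame pr R
  for P :: "(real \<Rightarrow> complex) \<Rightarrow> complex ^ 'n ^ 'n" and W F Q z0
    and pr :: "int \<times> int \<Rightarrow> complex ^ 'n ^ 'n" and R +
  assumes W0: "W (cover z0) k = HW k"
    and gr0: "gr_ind (F (cover z0)) (W (cover z0)) k p = gr_ind HF HW k p"
begin

abbreviation N :: "complex ^ 'n ^ 'n" where "N \<equiv> mono_log P z0"
abbreviation T :: "complex ^ 'n ^ 'n" where "T \<equiv> monodromy P z0"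

lemma supp_T: "supp NegT (T - mat 1)"
  unfolding NegT_eq using monodromy_W unfolding W0 by (intro supp_HW) (simp add: algebra_simps)

lemma nilpotent_T: "nilpotent (T - mat 1)"
  using supp_nilpotent[OF supp_T] by simp

lemma supp_N: "supp NegT N"
  unfolding mono_log_def neg_log_unipotent_fps fps_ev_def
proof (intro supp_sum)
  fix k
  show "supp NegT (mat (fps_nth (Abs_fps (\<lambda>k. if k = 0 then 0 else (- 1) ^ k / of_nat k)) k) ** matpow (T - mat 1) k)"
  proof (cases k)
    case 0
    then have "mat (fps_nth (Abs_fps (\<lambda>k. if k = 0 then 0 else (- 1) ^ k / of_nat k)) k) ** matpow (T - mat 1) k = 0"
      by (simp add: vec_eq_iff mat_scalar_nth)
    then show ?thesis by (simp only: supp_0)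
  next
    case (Suc m)
    then show ?thesis using supp_matpow[OF supp_T add_closed_types(1)] by (simp only: supp_scalar)
  qed
qed

lemma nilpotent_N: "nilpotent N"
  using supp_nilpotent[OF supp_N] by simp

lemma real_N: "cnjm N = N"
  unfolding mono_log_def neg_log_unipotent_def
  by (simp add: cnjm_sum scaleR_mat cnjm_mult cnjm_matpow cnjm_diff monodromy_real)

lemma T_exp_N: "T ** mexp (mat 1 ** N) = mat 1"
  using mexp_neg_log[OF nilpotent_T] by (simp add: mono_log_def)

lemma UT_exp: "UT NegT (mexp (mat c ** N))"
  by (rule mexp_UT[OF supp_N add_closed_types(1)])

text \<open>The trivialization of the canonical extension as a function on the upper half-plane. It has period \<open>1\<close>
  because \<open>T mexp N = 1\<close>.\<close>

definition Phi :: "complex \<Rightarrow> complex ^ 'n ^ 'n" where "Phi z = Tr z ** mexp (mat z ** N)"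

lemma Phi_plus_1: "z \<in> uhp \<Longrightarrow> Phi (z + 1) = Phi z"
proof -
  assume z: "z \<in> uhp"
  have "mexp (mat (z + 1) ** N) = mexp (mat 1 ** N) ** mexp (mat z ** N)"
    using mexp_add[OF nilpotent_N, of 1 z] by (simp add: add.commute)
  then have "Phi (z + 1) = Tr z ** (T ** mexp (mat 1 ** N)) ** mexp (mat z ** N)"
    unfolding Phi_def Tr_plus_1[OF z] by (simp only: matrix_mul_assoc)
  then show ?thesis unfolding T_exp_N Phi_def by simp
qed

lemma Phi_cover: assumes "a \<in> uhp" "cover a = cover b" shows "Phi a = Phi b"
proof -
  have nat: "Phi (z + of_nat n) = Phi z" if "z \<in> uhp" for z n
  proof (induction n)
    case (Suc n)
    have "z + of_nat n \<in> uhp" using that by (simp add: uhp_def)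
    from Phi_plus_1[OF this] show ?case using Suc by (simp add: algebra_simps)
  qed simp
  obtain n :: int where n: "a = b + of_int n" using cover_eqD[OF assms(2)] by blast
  then have b: "b \<in> uhp" using assms(1) by (simp add: uhp_def)
  show ?thesis
  proof (cases "0 \<le> n")
    case True
    then have "a = b + of_nat (nat n)" using n by simp
    then show ?thesis using nat[OF b] by simp
  next
    case False
    then have "b = a + of_nat (nat (- n))" using n by simp
    then show ?thesis using nat[OF assms(1)] by simp
  qed
qed

lemma Phi_inv: "z \<in> uhp \<Longrightarrow> invertible (Phi z)"
  unfolding Phi_def using Tr_inv mexp_inv(1)[OF nilpotent_N] by (intro invertible_mult)

lemma Phi_matrix_inv: "z \<in> uhp \<Longrightarrow> matrix_inv (Phi z) = mexp (mat (- z) ** N) ** matrix_inv (Tr z)"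
  unfolding Phi_def using mat_inv_mult[OF Tr_inv mexp_inv(1)[OF nilpotent_N]] mexp_inv(2)[OF nilpotent_N] by simp

lemma Phi_cnj: "z \<in> uhp \<Longrightarrow> matrix_inv (Phi z) ** cnjm (Phi z) = mexp (mat (- 2 * \<i> * of_real (Im z)) ** N)"
proof -
  assume z: "z \<in> uhp"
  have "matrix_inv (Phi z) ** cnjm (Phi z) = mexp (mat (- z) ** N) ** (matrix_inv (Tr z) ** Tr z) ** mexp (mat (cnj z) ** N)"
    unfolding Phi_matrix_inv[OF z]
    by (simp only: Phi_def cnjm_mult Tr_real[OF z] cnjm_mexp[OF nilpotent_N real_N] matrix_mul_assoc)
  also have "\<dots> = mexp (mat (- z) ** N) ** mexp (mat (cnj z) ** N)"
    by (simp add: mat_inv_left[OF Tr_inv[OF z]])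
  also have "\<dots> = mexp (mat (- z + cnj z) ** N)" by (rule mexp_add[OF nilpotent_N, symmetric])
  also have "- z + cnj z = - 2 * \<i> * of_real (Im z)" by (simp add: complex_eq_iff)
  finally show ?thesis .
qed

lemma canonical_frame_Phi: "canonical_frame P z0 s = Phi (lift s)"
  by (simp add: canonical_frame_def Phi_def)

lemma Phi_HW: "z \<in> uhp \<Longrightarrow> (*v) (Phi z) ` HW k = W (cover z) k"
  using Tr_W[of z k] image_HW[OF UT_exp, of z k] by (simp add: Phi_def image_mat_mult W0)

lemma Phi_gr: "z \<in> uhp \<Longrightarrow> (*v) (Phi z) ` gr_ind HF HW k p = gr_ind (F (cover z)) (W (cover z)) k p"
  using Tr_gr[of z k p] image_gr_HF[OF UT_exp, of z k p] by (simp add: Phi_def image_mat_mult gr0)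

definition psi :: "complex \<Rightarrow> 'n filtration" where
  "psi s p = (*v) (matrix_inv (Phi (lift s))) ` F s p"

lemma psi_mem: "s \<in> D \<Longrightarrow> v \<in> psi s p \<longleftrightarrow> Phi (lift s) *v v \<in> F s p"
  unfolding psi_def using image_mat_inv_iff[OF invertible_mat_inv[OF Phi_inv[OF lift_uhp]], of s]
  by (simp add: mat_inv_inv Phi_inv lift_uhp)

lemma image_Phi_psi: "s \<in> D \<Longrightarrow> (*v) (Phi (lift s)) ` psi s p = F s p"
  unfolding psi_def by (rule image_inv_image(2)[OF Phi_inv[OF lift_uhp]])

lemma cover_lift_D: "s \<in> D \<Longrightarrow> cover (lift s) = s"
  by (rule cover_lift) (simp add: punctured_disk_def)

lemma untwisted_period_psi: "s \<in> D \<Longrightarrow> untwisted_period P F z0 s p = psi s p"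
proof -
  assume s: "s \<in> D"
  have z: "lift s \<in> uhp" by (rule lift_uhp[OF s])
  have "period_map P F z0 (lift s) p = (*v) (matrix_inv (Tr (lift s))) ` F s p"
  proof -
    have "v \<in> (*v) (matrix_inv (Tr (lift s))) ` F s p \<longleftrightarrow> Tr (lift s) *v v \<in> F s p" for v
      using image_mat_inv_iff[OF invertible_mat_inv[OF Tr_inv[OF z]]] by (simp add: mat_inv_inv[OF Tr_inv[OF z]])
    then show ?thesis unfolding period_map_def cover_lift_D[OF s] by blast
  qed
  then show ?thesis unfolding untwisted_period_def psi_def Phi_matrix_inv[OF z] by (simp only: image_mat_mult)
qed

lemma psi_same_gr: assumes s: "s \<in> D" shows "same_gr (psi s)"
  unfolding same_gr_def
proof (intro conjI allI)
  have z: "lift s \<in> uhp" by (rule lift_uhp[OF s])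
  let ?K = "matrix_inv (Phi (lift s))"
  have iK: "invertible ?K" by (rule invertible_mat_inv[OF Phi_inv[OF z]])
  have dF: "decreasing_filtration (F s)" using mhs_at[OF s] unfolding mixed_hodge_structure_def by (elim conjE)
  show "vec.subspace (psi s p)" for p
    unfolding psi_def using dF by (intro subspace_mv_image) (simp add: decreasing_filtration_def)
  have aF: "antimono (F s)" using dF unfolding decreasing_filtration_def by (elim conjE)
  show "antimono (psi s)"
  proof (rule antimonoI)
    fix p q :: int assume "p \<le> q"
    then show "psi s q \<subseteq> psi s p" unfolding psi_def using antimonoD[OF aF] by (intro image_mono)
  qed
  show "gr_ind (psi s) HW k p = gr_ind HF HW k p" for k p
  proof -
    have "HW k = (*v) ?K ` W s k" for k
      using Phi_HW[OF z, of k] image_inv_image(1)[OF Phi_inv[OF z], of "HW k"] by (simp add: cover_lift_D[OF s])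
    then have "gr_ind (psi s) HW k p = gr_ind (\<lambda>p. (*v) ?K ` F s p) (\<lambda>k. (*v) ?K ` W s k) k p"
      by (simp add: gr_ind_def psi_def)
    also have "\<dots> = (*v) ?K ` gr_ind (F s) (W s) k p" by (rule gr_ind_image[OF iK])
    also have "\<dots> = gr_ind HF HW k p"
      using Phi_gr[OF z, of k p] image_inv_image(1)[OF Phi_inv[OF z], of "gr_ind HF HW k p"]
      by (simp add: cover_lift_D[OF s])
    finally show ?thesis .
  qed
qed

text \<open>In flat coordinates around \<open>s\<close>, the trivialization at \<open>t\<close> is the one at \<open>s\<close> up to a factor that is
  holomorphic in \<open>t\<close>. So holomorphy and horizontality carry over to \<open>psi\<close>.\<close>

lemma Phi_local:
  assumes s: "s \<in> D" and t: "t \<in> ball s (norm s)" "t \<in> D"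
  defines "w \<equiv> branch (lift s) s t - lift s"
  shows "P (linepath t s) ** Phi (lift t) = Phi (lift s) ** mexp (mat w ** N)"
proof -
  let ?z = "lift s" and ?b = "branch (lift s) s t"
  have cz: "cover ?z = s" by (rule cover_lift_D[OF s])
  have n: "s \<noteq> 0" "t \<noteq> 0" "norm t < 1" using s t by (auto simp: punctured_disk_def)
  have cb: "cover ?b = t" by (rule cover_branch[OF n(1,2) cz])
  then have bu: "?b \<in> uhp" using n by (intro cover_lt_1) simp
  have "Phi (lift t) = Phi ?b" using Phi_cover[OF bu, of "lift t"] cb cover_lift_D[OF t(2)] by simp
  then have "P (linepath t s) ** Phi (lift t) = (P (linepath t s) ** Tr ?b) ** mexp (mat ?b ** N)"
    by (simp add: Phi_def matrix_mul_assoc)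
  also have "\<dots> = Tr ?z ** mexp (mat (?z + w) ** N)" by (simp add: Tr_branch(1)[OF s cz t] w_def)
  finally show ?thesis by (simp add: mexp_add[OF nilpotent_N] Phi_def matrix_mul_assoc)
qed

lemma flat_coords_psi:
  assumes s: "s \<in> D" and t: "t \<in> ball s (norm s)" "t \<in> D"
  shows "flat_coords P s (\<lambda>u. F u p) t = (*v) (Phi (lift s) ** mexp (mat (branch (lift s) s t - lift s) ** N)) ` psi t p"
proof -
  have "flat_coords P s (\<lambda>u. F u p) t = (*v) (P (linepath t s)) ` ((*v) (Phi (lift t)) ` psi t p)"
    unfolding flat_coords_def image_Phi_psi[OF t(2)] ..
  then show ?thesis unfolding image_mat_mult[symmetric] Phi_local[OF assms] .
qed

lemma hol_mexp: "f holomorphic_on S \<Longrightarrow> hol_mat (\<lambda>t. mexp (mat (f t) ** N)) S"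
proof -
  assume f: "f holomorphic_on S"
  have "hol_mat (\<lambda>t. \<Sum>k\<le>CARD('n). mat (f t ^ k / fact k) ** matpow N k) S"
    by (intro hol_mat_sum hol_mat_mult hol_mat_const hol_mat_scalar holomorphic_intros f) auto
  then show ?thesis by (simp add: mexp_scalar[OF nilpotent_N] fps_ev_def)
qed

lemma psi_hol: "hol_filtration psi D"
  unfolding hol_filtration_def
proof (intro ballI allI)
  fix s p assume s: "s \<in> D"
  have s0: "s \<noteq> 0" using s by (simp add: punctured_disk_def)
  have "holomorphic_subbundle D P (\<lambda>s. F s p)" using V unfolding gp_vmhs_def by blast
  then have "\<exists>r>0. ball s r \<subseteq> D \<and> (\<exists>(B :: complex \<Rightarrow> complex^'n^'n) J.
      (\<forall>i j. (\<lambda>t. B t $ i $ j) holomorphic_on ball s r) \<and>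
      (\<forall>t\<in>ball s r. invertible (B t) \<and> flat_coords P s (\<lambda>s. F s p) t = (*v) (B t) ` coord_subspace J))"
    unfolding holomorphic_subbundle_def using s by (rule bspec)
  then obtain r where r0: "0 < r \<and> ball s r \<subseteq> D \<and> (\<exists>(B :: complex \<Rightarrow> complex^'n^'n) J.
      (\<forall>i j. (\<lambda>t. B t $ i $ j) holomorphic_on ball s r) \<and>
      (\<forall>t\<in>ball s r. invertible (B t) \<and> flat_coords P s (\<lambda>s. F s p) t = (*v) (B t) ` coord_subspace J))" by (rule exE)
  then have "\<exists>(B :: complex \<Rightarrow> complex^'n^'n) J.
      (\<forall>i j. (\<lambda>t. B t $ i $ j) holomorphic_on ball s r) \<and>
      (\<forall>t\<in>ball s r. invertible (B t) \<and> flat_coords P s (\<lambda>s. F s p) t = (*v) (B t) ` coord_subspace J)" by (elim conjE)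
  then obtain B :: "complex \<Rightarrow> complex^'n^'n" where "\<exists>J.
      (\<forall>i j. (\<lambda>t. B t $ i $ j) holomorphic_on ball s r) \<and>
      (\<forall>t\<in>ball s r. invertible (B t) \<and> flat_coords P s (\<lambda>s. F s p) t = (*v) (B t) ` coord_subspace J)" by (rule exE)
  then obtain J where BJ: "(\<forall>i j. (\<lambda>t. B t $ i $ j) holomorphic_on ball s r) \<and>
      (\<forall>t\<in>ball s r. invertible (B t) \<and> flat_coords P s (\<lambda>s. F s p) t = (*v) (B t) ` coord_subspace J)" by (rule exE)
  define r' where "r' = min r (norm s)"
  have sub: "ball s r' \<subseteq> ball s r" "ball s r' \<subseteq> ball s (norm s)" by (auto simp: r'_def)
  define L where "L t = Phi (lift s) ** mexp (mat (branch (lift s) s t - lift s) ** N)" for t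
  have iL: "invertible (L t)" for t
    unfolding L_def using Phi_inv[OF lift_uhp[OF s]] mexp_inv(1)[OF nilpotent_N] by (rule invertible_mult)
  have bh: "branch (lift s) s holomorphic_on ball s r'" by (rule holomorphic_on_subset[OF branch_holomorphic sub(2)])
  have hL: "hol_mat L (ball s r')"
    unfolding L_def by (intro hol_mat_mult hol_mat_const hol_mexp holomorphic_intros bh)
  have hB: "hol_mat B (ball s r')"
    unfolding hol_mat_def using BJ holomorphic_on_subset[OF _ sub(1)] by blast
  have h: "hol_mat (\<lambda>t. matrix_inv (L t) ** B t) (ball s r')"
    by (intro hol_mat_mult hol_mat_inv hL hB iL)
  have e: "invertible (matrix_inv (L t) ** B t) \<and> psi t p = (*v) (matrix_inv (L t) ** B t) ` coord_subspace J"
    if t: "t \<in> ball s r'" for t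
  proof
    have tr: "t \<in> ball s r" "t \<in> ball s (norm s)" using t sub by blast+
    have tD: "t \<in> D" using tr(1) r0 by blast
    have Bt: "invertible (B t)" "flat_coords P s (\<lambda>s. F s p) t = (*v) (B t) ` coord_subspace J" using BJ tr(1) by simp_all
    show "invertible (matrix_inv (L t) ** B t)" using invertible_mat_inv[OF iL] Bt(1) by (rule invertible_mult)
    have "(*v) (L t) ` psi t p = (*v) (B t) ` coord_subspace J"
      using flat_coords_psi[OF s tr(2) tD, of p] Bt(2) by (simp add: L_def)
    then have "(*v) (matrix_inv (L t)) ` ((*v) (L t) ` psi t p) = (*v) (matrix_inv (L t)) ` ((*v) (B t) ` coord_subspace J)" by simp
    then show "psi t p = (*v) (matrix_inv (L t) ** B t) ` coord_subspace J"
      by (simp add: image_inv_image(1)[OF iL] image_mat_mult)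
  qed
  have "0 < r' \<and> ball s r' \<subseteq> D" using r0 s0 sub(1) by (auto simp: r'_def)
  then show "\<exists>r>0. ball s r \<subseteq> D \<and> (\<exists>(B :: complex \<Rightarrow> complex^'n^'n) J. hol_mat B (ball s r) \<and>
      (\<forall>t\<in>ball s r. invertible (B t) \<and> psi t p = (*v) (B t) ` coord_subspace J))"
    using h e by (intro exI[of _ r'] exI[of _ "\<lambda>t. matrix_inv (L t) ** B t"] exI[of _ J] conjI) auto
qed

text \<open>The derivative of a section in flat coordinates. The term with \<open>N\<close> is the derivative of the exponential
  factor, whose exponent \<open>branch (lift s) s t - lift s\<close> has derivative \<open>1 / (2 \<pi> i s)\<close>.\<close>

lemma psi_horizontal:
  assumes s: "s \<in> D" and v: "\<And>i. (\<lambda>t. v t $ i) holomorphic_on D" and vp: "\<And>t. t \<in> D \<Longrightarrow> v t \<in> psi t p"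
  shows "N *v v s + (2 * of_real pi * \<i> * s) *s (\<chi> i. deriv (\<lambda>t. v t $ i) s) \<in> psi s (p - 1)"
proof -
  have s0: "s \<noteq> 0" using s by (simp add: punctured_disk_def)
  obtain r0 where r0: "0 < r0" "ball s r0 \<subseteq> D" using open_punctured_disk s openE by blast
  define r where "r = min r0 (norm s)"
  have r: "0 < r" "ball s r \<subseteq> D" "ball s r \<subseteq> ball s (norm s)" using r0 s0 by (auto simp: r_def)
  define w where "w t = branch (lift s) s t - lift s" for t
  define E where "E t = mexp (mat (w t) ** N)" for t
  define f where "f t = Phi (lift s) *v (E t *v v t)" for t
  have hE: "hol_mat E (ball s r)"
    unfolding E_def w_def by (intro hol_mexp holomorphic_intros holomorphic_on_subset[OF branch_holomorphic r(3)])
  have fh: "(\<lambda>t. f t $ i) holomorphic_on ball s r" for i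
    unfolding f_def matrix_vector_mult_def using hE holomorphic_on_subset[OF v r(2)]
    by (auto intro!: holomorphic_intros simp: hol_mat_def)
  have ff: "f t \<in> flat_coords P s (\<lambda>u. F u p) t" if t: "t \<in> ball s r" for t
  proof -
    have "t \<in> D" "t \<in> ball s (norm s)" using t r by blast+
    then show ?thesis
      unfolding flat_coords_psi[OF s \<open>t \<in> ball s (norm s)\<close> \<open>t \<in> D\<close>] using vp[OF \<open>t \<in> D\<close>]
      by (auto simp: f_def E_def w_def matrix_vector_mul_assoc matrix_mul_assoc)
  qed
  have hor: "horizontal D P F" using V unfolding gp_vmhs_def by blast
  have fd: "(\<chi> i. deriv (\<lambda>u. f u $ i) s) \<in> flat_coords P s (\<lambda>u. F u (p - 1)) s"
    using hor[unfolded horizontal_def, rule_format, OF s r(1,2), of f p s] fh ff r(1) by simp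
  have fc: "flat_coords P s (\<lambda>u. F u (p - 1)) s = F s (p - 1)"
    by (simp add: flat_coords_def P_refl[OF s])
  let ?v' = "\<chi> i. deriv (\<lambda>t. v t $ i) s" and ?w' = "1 / (2 * of_real pi * \<i> * s)"
  have vd: "((\<lambda>t. v t $ i) has_field_derivative ?v' $ i) (at s)" for i
    using holomorphic_derivI[OF v open_punctured_disk s] by simp
  have w0: "w s = 0" using s0 by (simp add: w_def branch_def)
  have wd: "(w has_field_derivative ?w') (at s)" unfolding w_def[abs_def] by (rule branch_deriv[OF s0])
  have Ed: "((\<lambda>t. E t $ i $ j) has_field_derivative (mat ?w' ** N) $ i $ j) (at s)" for i j
    unfolding E_def by (rule deriv_mexp_0[where w = w, OF nilpotent_N wd w0])
  have E1: "E s = mat 1" using mexp_0[OF nilpotent_N] by (simp only: E_def w0)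
  define y where "y = (mat ?w' ** N) *v v s + E s *v ?v'"
  have EV: "((\<lambda>t. (E t *v v t) $ i) has_field_derivative y $ i) (at s)" for i
    unfolding y_def by (rule deriv_mat_vec[OF Ed vd])
  have "((\<lambda>t. f t $ i) has_field_derivative (0 *v (E s *v v s) + Phi (lift s) *v y) $ i) (at s)" for i
    unfolding f_def by (rule deriv_mat_vec[OF _ EV]) (simp add: DERIV_const)
  then have "deriv (\<lambda>t. f t $ i) s = (Phi (lift s) *v y) $ i" for i
    using DERIV_imp_deriv by fastforce
  then have "(\<chi> i. deriv (\<lambda>u. f u $ i) s) = Phi (lift s) *v y" by (simp add: vec_eq_iff)
  then have "Phi (lift s) *v y \<in> F s (p - 1)" using fd fc by simp
  then have "y \<in> psi s (p - 1)" by (simp add: psi_mem[OF s])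
  then have "(2 * of_real pi * \<i> * s) *s y \<in> psi s (p - 1)"
    using psi_same_gr[OF s] vec.subspace_scale by (auto simp: same_gr_def)
  moreover have "y = ?w' *s (N *v v s) + ?v'" by (simp add: y_def E1 mat_scalar_vec)
  then have "(2 * of_real pi * \<i> * s) *s y = N *v v s + (2 * of_real pi * \<i> * s) *s ?v'"
    using s0 by (simp add: vec.scale_right_distrib)
  ultimately show ?thesis by simp
qed

section \<open>The two implications\<close>

lemma W0_eq: "W (cover z0) = HW"
  using W0 by (rule ext)

lemma hodge_number_frame: "hodge_number (F (cover z0)) (W (cover z0)) p q = vec.dim (sec {(p, q)})"
proof -
  let ?A = "\<lambda>p q. {x. p \<le> fst x \<and> wt x = p + q} \<union> {x. wt x < p + q}"
  have g: "gr_ind (F (cover z0)) (W (cover z0)) (p + q) p' = sec ({x. p' \<le> fst x \<and> wt x = p + q} \<union> {x. wt x < p + q})" for p'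
    unfolding gr0 gr_HF ..
  have "({x. p \<le> fst x \<and> wt x = p + q} \<union> {x. wt x < p + q}) \<inter> prod.swap ` ({x. q \<le> fst x \<and> wt x = p + q} \<union> {x. wt x < p + q})
     = {(p, q)} \<union> {x. wt x \<le> p + q - 1}"
    unfolding swap_image by (auto simp: wt_def prod_eq_iff)
  then have "hodge_comp (F (cover z0)) (W (cover z0)) p q = sec ({(p, q)} \<union> {x. wt x \<le> p + q - 1})"
    unfolding hodge_comp_def g cnjv_sec sec_Int by (simp only:)
  moreover have "vec.dim (sec ({(p, q)} \<union> {x. wt x \<le> p + q - 1})) = vec.dim (sec {(p, q)}) + vec.dim (HW (p + q - 1))"
    unfolding HW_def by (rule dim_sec_Un) auto
  ultimately show ?thesis by (simp add: hodge_number_def W0)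
qed

lemma dim_gr0:
  "vec.dim (gr_ind HF HW k p) - vec.dim (HW (k - 1)) =
     (\<Sum>r \<in> {r. p \<le> r \<and> hodge_number (F (cover z0)) (W (cover z0)) r (k - r) \<noteq> 0}.
        hodge_number (F (cover z0)) (W (cover z0)) r (k - r))"
  by (rule dim_gr_HF) (rule hodge_number_frame)

lemma z0_D: "cover z0 \<in> D" by (rule cover_punctured_disk[OF z0])

lemma relative_weight_filtration_N:
  "(\<exists>M. relative_weight_filtration N (W (cover z0)) M) \<longleftrightarrow> supp {d. wt d \<le> - 2} N"
proof -
  have iW: "increasing_filtration HW"
    using mhs_at[OF z0_D] unfolding mixed_hodge_structure_def W0_eq by (elim conjE)
  have "(*v) N ` HW k \<subseteq> HW (k - 1)" for k
    using HW_supp[of 1 N] supp_N unfolding NegT_eq by blast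
  from relative_weight_filtration_iff[OF iW this]
  have "(\<exists>M. relative_weight_filtration N (W (cover z0)) M) \<longleftrightarrow> (\<forall>k. (*v) N ` HW k \<subseteq> HW (k - 2))"
    unfolding W0_eq .
  also have "\<dots> \<longleftrightarrow> supp {d. wt d \<le> - 2} N"
    using supp_HW[of N 2] HW_supp[of 2 N] by blast
  finally show ?thesis .
qed

text \<open>Up to the identification by \<open>Phi\<close>, the matrix that compares the bigrading given by \<open>g\<close> with its
  conjugate.\<close>

definition lam :: "complex \<Rightarrow> complex ^ 'n ^ 'n \<Rightarrow> complex ^ 'n ^ 'n" where
  "lam s g = matrix_inv g ** mexp (mat (- 2 * \<i> * of_real (- ln (norm s) / (2 * pi))) ** N) ** cnjm g"

definition Yc :: "complex \<Rightarrow> complex ^ 'n ^ 'n" where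
  "Yc s = matrix_inv (canonical_frame P z0 s) ** mhs_grading (F s) (W s) ** canonical_frame P z0 s"

text \<open>Since \<open>Phi\<close> is real up to the exponential of \<open>N\<close>, the condition of Deligne for \<open>Phi f h\<close> is a condition
  on \<open>lam s (f h)\<close>.\<close>

lemma splitting_at:
  assumes s: "s \<in> D" and f: "UT NegT f" and fp: "\<And>p. psi s p = (*v) f ` HF p"
  shows "\<exists>h. UT StabT h \<and> UT LamT (lam s (f ** h)) \<and> Yc s = (f ** h) ** YR ** matrix_inv (f ** h)"
proof -
  let ?z = "lift s"
  have z: "?z \<in> uhp" by (rule lift_uhp[OF s])
  have cz: "cover ?z = s" by (rule cover_lift_D[OF s])
  have iP: "invertible (Phi ?z)" by (rule Phi_inv[OF z])
  have if': "invertible f" by (rule UT_inv(1)[OF add_closed_types(1) f])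
  have s0: "s \<noteq> 0" using s by (simp add: punctured_disk_def)
  have conj: "matrix_inv (Phi ?z ** g) ** cnjm (Phi ?z ** g) = lam s g" if g: "invertible g" for g
  proof -
    have "matrix_inv (Phi ?z ** g) ** cnjm (Phi ?z ** g) = matrix_inv g ** (matrix_inv (Phi ?z) ** cnjm (Phi ?z)) ** cnjm g"
      by (simp add: mat_inv_mult[OF iP g] cnjm_mult matrix_mul_assoc)
    then show ?thesis unfolding Phi_cnj[OF z] Im_lift[OF s0] lam_def .
  qed
  have "UT NegT (lam s f)"
    unfolding lam_def using UT_inv(2)[OF add_closed_types(1) f] UT_exp UT_cnj[OF f]
    unfolding swap_NegT by (intro UT_mult add_closed_types)
  then have "UT NegT (matrix_inv (Phi ?z ** f) ** cnjm (Phi ?z ** f))" unfolding conj[OF if'] .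
  from deligne_splitting[OF invertible_mult[OF iP if'] this]
  obtain h where h: "UT StabT h" and hl: "UT LamT (matrix_inv (Phi ?z ** f ** h) ** cnjm (Phi ?z ** f ** h))" by blast
  let ?g = "f ** h" and ?G = "Phi ?z ** (f ** h)"
  have ih: "invertible h" by (rule UT_inv(1)[OF add_closed_types(2) h])
  have ig: "invertible ?g" using if' ih by (rule invertible_mult)
  have iG: "invertible ?G" using iP ig by (rule invertible_mult)
  have lG: "UT LamT (matrix_inv ?G ** cnjm ?G)" using hl by (simp add: matrix_mul_assoc)
  have F': "F s p = (*v) ?G ` HF p" for p
    using image_Phi_psi[OF s, of p] by (simp add: fp image_mat_mult image_HF[OF h])
  have hN: "UT NegT h" using h by (rule UT_StabT_NegT)
  have W': "W s k = (*v) ?G ` HW k" for k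
    using Phi_HW[OF z, of k] by (simp add: cz image_mat_mult image_HW[OF hN] image_HW[OF f])
  have "Yc s = matrix_inv (Phi ?z) ** (?G ** YR ** matrix_inv ?G) ** Phi ?z"
    unfolding Yc_def canonical_frame_Phi mhs_grading_frame[OF iG lG F' W'] ..
  also have "\<dots> = (matrix_inv (Phi ?z) ** Phi ?z) ** ?g ** YR ** matrix_inv ?g ** (matrix_inv (Phi ?z) ** Phi ?z)"
    unfolding mat_inv_mult[OF iP ig] by (simp only: matrix_mul_assoc)
  finally have "Yc s = ?g ** YR ** matrix_inv ?g" by (simp add: mat_inv_left[OF iP])
  moreover have "UT LamT (lam s ?g)" using lG unfolding conj[OF ig] .
  ultimately show ?thesis using h by blast
qed

lemma eventually_D: "\<forall>\<^sub>F s in at 0. s \<in> D"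
  unfolding eventually_at punctured_disk_def by (intro exI[of _ 1]) auto

lemma HF_decreasing:
  fixes g :: "complex^'n^'n"
  shows "invertible g \<Longrightarrow> decreasing_filtration (\<lambda>p. (*v) g ` HF p)"
proof -
  assume g: "invertible g"
  have s: "vec.subspace (HF p)" for p by (rule subspace_HF)
  obtain a b where ab: "HF a = UNIV" "HF b = {0}" using HF_top HF_bot by blast
  show ?thesis
    unfolding decreasing_filtration_def
  proof (intro conjI allI)
    show "vec.subspace ((*v) g ` HF p)" for p by (rule subspace_mv_image[OF s])
    show "antimono (\<lambda>p. (*v) g ` HF p)"
    proof (rule antimonoI, rule image_mono)
      show "HF q \<subseteq> HF p" if "p \<le> q" for p q unfolding HF_def using that by (intro sec_mono) auto
    qed
    have "(*v) g ` UNIV = UNIV" using image_mat_inv_iff[OF g] by blast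
    then show "\<exists>a. (*v) g ` HF a = UNIV" using ab(1) by (intro exI[of _ a]) simp
    show "\<exists>b. (*v) g ` HF b = {0}" using ab(2) by (intro exI[of _ b]) simp
  qed
qed

theorem extends_imp_admissible:
  assumes "grading_extends P W F z0"
  shows "admissible P W F Q z0"
proof -
  obtain Y0 where Y0: "(Yc \<longlongrightarrow> Y0) (at 0)"
    using assms unfolding grading_extends_def Yc_def[abs_def] by blast
  have "\<exists>h. UT StabT h \<and> UT LamT (lam s (chart (psi s) ** h)) \<and>
      Yc s = (chart (psi s) ** h) ** YR ** matrix_inv (chart (psi s) ** h)" if s: "s \<in> D" for s
    by (rule splitting_at[OF s UT_Neg_chart[OF psi_same_gr[OF s]]]) (simp add: chart_image[OF psi_same_gr[OF s]])
  then have "\<forall>s\<in>D. \<exists>h. UT StabT h \<and> UT LamT (lam s (chart (psi s) ** h)) \<and>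
      Yc s = (chart (psi s) ** h) ** YR ** matrix_inv (chart (psi s) ** h)" by blast
  from bchoice[OF this] obtain h where h: "\<forall>s\<in>D. UT StabT (h s) \<and> UT LamT (lam s (chart (psi s) ** h s)) \<and>
      Yc s = (chart (psi s) ** h s) ** YR ** matrix_inv (chart (psi s) ** h s)" by (rule exE)
  have hS: "UT StabT (h s)" if "s \<in> D" for s using bspec[OF h that] by (rule conjunct1)
  have hL: "UT LamT (lam s (chart (psi s) ** h s))" if "s \<in> D" for s
    using bspec[OF h that] by (rule conjunct1[OF conjunct2])
  have hY: "Yc s = (chart (psi s) ** h s) ** YR ** matrix_inv (chart (psi s) ** h s)" if "s \<in> D" for s
    using bspec[OF h that] by (rule conjunct2[OF conjunct2])
  define g where "g s = chart (psi s) ** h s" for s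
  have gU: "UT NegT (g s)" if s: "s \<in> D" for s
  proof -
    have "UT NegT (h s)" using hS[OF s] by (rule UT_StabT_NegT)
    then show ?thesis unfolding g_def using UT_Neg_chart[OF psi_same_gr[OF s]] by (intro UT_mult add_closed_types)
  qed
  have gpsi: "psi s p = (*v) (g s) ` HF p" if s: "s \<in> D" for s p
    by (simp add: g_def image_mat_mult image_HF[OF hS[OF s]] chart_image[OF psi_same_gr[OF s]])
  have evU: "\<forall>\<^sub>F s in at 0. UT NegT (g s)" using eventually_D by eventually_elim (rule gU)
  have "\<forall>\<^sub>F s in at 0. Yc s = g s ** YR ** matrix_inv (g s)"
    using eventually_D unfolding g_def by eventually_elim (rule hY)
  from conj_grading_converges[OF Lim_transform_eventually[OF Y0 this] evU]
  obtain g0 where g0: "(g \<longlongrightarrow> g0) (at 0)" by blast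
  have g0U: "UT NegT g0" by (rule UT_limit[OF g0 evU]) simp
  have ig0: "invertible g0" by (rule UT_inv(1)[OF add_closed_types(1) g0U])
  have "supp {d. wt d \<le> - 2} N"
  proof (rule weight_drop[OF supp_N g0 evU filterlim_minus_ln_norm])
    show "\<forall>\<^sub>F s in at 0. UT LamT (matrix_inv (g s) ** mexp (mat (- 2 * \<i> * of_real (- ln (norm s) / (2 * pi))) ** N) ** cnjm (g s))"
      using eventually_D unfolding g_def lam_def[symmetric] by eventually_elim (rule hL)
  qed simp
  then have rW: "\<exists>M. relative_weight_filtration N (W (cover z0)) M" by (simp only: relative_weight_filtration_N)
  define Finf where "Finf p = (*v) g0 ` HF p" for p
  have lim: "subspace_tendsto (\<lambda>s. untwisted_period P F z0 s p) (Finf p) (at 0)" for p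
    unfolding Finf_def
  proof (rule subspace_tendsto_moving[OF g0 ig0])
    show "vec.subspace (HF p)" by (rule subspace_HF)
    show "\<forall>\<^sub>F s in at 0. untwisted_period P F z0 s p = (*v) (g s) ` HF p"
      using eventually_D by eventually_elim (simp add: untwisted_period_psi gpsi)
  qed
  have "same_gr Finf" unfolding Finf_def[abs_def] by (rule same_gr_image[OF same_gr_HF g0U])
  then have grF: "gr_ind Finf HW k p = gr_ind HF HW k p" for k p by (simp add: same_gr_def)
  have "riemann_first (F (cover z0)) (W (cover z0)) k (Q (cover z0) k)" for k
    using V z0_D unfolding gp_vmhs_def by blast
  then have "riemann_first Finf (W (cover z0)) k (Q (cover z0) k)" for k
    unfolding riemann_first_def gr0 unfolding W0_eq grF .
  moreover have "decreasing_filtration Finf" unfolding Finf_def[abs_def] by (rule HF_decreasing[OF ig0])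
  moreover have "vec.dim (gr_ind Finf (W (cover z0)) k p) - vec.dim (W (cover z0) (k - 1)) =
     (\<Sum>r \<in> {r. p \<le> r \<and> hodge_number (F (cover z0)) (W (cover z0)) r (k - r) \<noteq> 0}.
        hodge_number (F (cover z0)) (W (cover z0)) r (k - r))" for k p
    unfolding dim_gr0[symmetric] unfolding W0_eq grF ..
  ultimately have "Finf \<in> compact_dual (W (cover z0)) (Q (cover z0)) (hodge_number (F (cover z0)) (W (cover z0)))"
    unfolding compact_dual_def by blast
  then show ?thesis unfolding admissible_def using lim rW by blast
qed

text \<open>Horizontality in the limit: the derivative of a section of the extended bundle contributes
  \<open>2 \<pi> i s\<close> times a bounded term.\<close>

lemma limit_horizontal:
  assumes g: "UT NegT g" and u: "hol_mat u D" "(u \<longlongrightarrow> mat 1) (at 0)" "\<And>s. s \<in> D \<Longrightarrow> UT NegT (u s)"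
    and psi: "\<And>s p. s \<in> D \<Longrightarrow> psi s p = (*v) (g ** u s) ` HF p"
    and v: "v \<in> HF p"
  shows "(matrix_inv g ** N ** g) *v v \<in> HF (p - 1)"
proof -
  have ig: "invertible g" by (rule UT_inv(1)[OF add_closed_types(1) g])
  define u' where "u' s = (\<chi> i j. deriv (\<lambda>t. u t $ i $ j) s)" for s
  define \<nu> where "\<nu> = matrix_inv g ** N ** g"
  have du: "((\<lambda>t. u t $ i $ j) has_field_derivative u' s $ i $ j) (at s)" if "s \<in> D" for s i j
    using u(1) holomorphic_derivI[OF _ open_punctured_disk that] by (simp add: hol_mat_def u'_def)
  define y where "y s = matrix_inv (u s) *v (\<nu> *v (u s *v v) + (2 * of_real pi * \<i> * s) *s (u' s *v v))" for s
  have mem: "y s \<in> HF (p - 1)" if s: "s \<in> D" for s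
  proof -
    have iu: "invertible (u s)" by (rule UT_inv(1)[OF add_closed_types(1) u(3)[OF s]])
    let ?w = "\<lambda>t. (g ** u t) *v v"
    have wh: "(\<lambda>t. ?w t $ i) holomorphic_on D" for i
    proof -
      have "hol_mat (\<lambda>t. g ** u t) D" by (intro hol_mat_mult hol_mat_const u(1))
      then show ?thesis unfolding matrix_vector_mult_def by (auto intro!: holomorphic_intros simp: hol_mat_def)
    qed
    have "N *v ?w s + (2 * of_real pi * \<i> * s) *s (\<chi> i. deriv (\<lambda>t. ?w t $ i) s) \<in> psi s (p - 1)"
      by (rule psi_horizontal[OF s wh]) (use v psi in blast)
    moreover have "(\<chi> i. deriv (\<lambda>t. ?w t $ i) s) = g *v (u' s *v v)"
    proof -
      have ud: "((\<lambda>t. (u t *v v) $ i) has_field_derivative (u' s *v v + u s *v 0) $ i) (at s)" for i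
        by (rule deriv_mat_vec[OF du[OF s]]) simp
      have "((\<lambda>t. (g *v (u t *v v)) $ i) has_field_derivative (0 *v (u s *v v) + g *v (u' s *v v + u s *v 0)) $ i) (at s)" for i
        by (rule deriv_mat_vec[OF _ ud]) simp
      then have "deriv (\<lambda>t. (g *v (u t *v v)) $ i) s = (g *v (u' s *v v)) $ i" for i
        using DERIV_imp_deriv by fastforce
      then show ?thesis by (simp add: vec_eq_iff flip: matrix_vector_mul_assoc)
    qed
    moreover have "N *v ?w s = g *v (\<nu> *v (u s *v v))"
      by (simp add: \<nu>_def matrix_vector_mul_assoc matrix_mul_assoc mat_inv_right[OF ig])
    moreover have "g *v (\<nu> *v (u s *v v)) + (2 * of_real pi * \<i> * s) *s (g *v (u' s *v v)) = (g ** u s) *v y s"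
      by (simp add: y_def mat_inv_vec[OF iu] vec.add mv_scale flip: matrix_vector_mul_assoc)
    ultimately have "(g ** u s) *v y s \<in> (*v) (g ** u s) ` HF (p - 1)" using psi[OF s] by simp
    then show ?thesis
      using image_mat_inv_iff[OF invertible_mult[OF ig iu]] mat_inv_vec(1)[OF invertible_mult[OF ig iu]] by simp
  qed
  have ui: "((\<lambda>s. matrix_inv (u s)) \<longlongrightarrow> mat 1) (at 0)" using tendsto_mat_inv(2)[OF u(2) invertible_mat_1] by (simp add: mat_inv_mat_1)
  have su: "((\<lambda>s. mat s ** u' s) \<longlongrightarrow> 0) (at 0)"
    unfolding tendsto_mat_iff
  proof (intro allI)
    fix i j
    have "((\<lambda>s. s * deriv (\<lambda>t. u t $ i $ j) s) \<longlongrightarrow> 0) (at 0)"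
      using u(1,2) by (intro removable_decay(2)) (auto simp: hol_mat_def tendsto_mat_iff punctured_disk_def)
    then show "((\<lambda>s. (mat s ** u' s) $ i $ j) \<longlongrightarrow> 0 $ i $ j) (at 0)" by (simp add: mat_scalar_nth u'_def)
  qed
  have "((\<lambda>s. matrix_inv (u s) *v (\<nu> *v (u s *v v) + (mat (2 * of_real pi * \<i>) ** (mat s ** u' s)) *v v))
      \<longlongrightarrow> mat 1 *v (\<nu> *v (mat 1 *v v) + (mat (2 * of_real pi * \<i>) ** 0) *v v)) (at 0)"
    by (intro tendsto_mat_vec tendsto_add tendsto_mat_mult tendsto_const ui u(2) su)
  moreover have "matrix_inv (u s) *v (\<nu> *v (u s *v v) + (mat (2 * of_real pi * \<i>) ** (mat s ** u' s)) *v v) = y s" for s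
    by (simp add: y_def matrix_mul_assoc mat_mat mat_scalar_vec)
  ultimately have "(y \<longlongrightarrow> \<nu> *v v) (at 0)" by simp
  moreover have "closed (HF (p - 1))" unfolding HF_def by (rule closed_vec_subspace[OF subspace_sec])
  moreover have "\<forall>\<^sub>F s in at 0. y s \<in> HF (p - 1)" using eventually_D by eventually_elim (rule mem)
  ultimately show ?thesis unfolding \<nu>_def[symmetric] by (intro Lim_in_closed_set) auto
qed

theorem admissible_imp_extends:
  assumes "admissible P W F Q z0"
  shows "grading_extends P W F z0"
proof -
  obtain Finf where Finf: "Finf \<in> compact_dual (W (cover z0)) (Q (cover z0)) (hodge_number (F (cover z0)) (W (cover z0)))"
    and lim: "\<And>p. subspace_tendsto (\<lambda>s. untwisted_period P F z0 s p) (Finf p) (at 0)"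
    and rW: "\<exists>M. relative_weight_filtration N (W (cover z0)) M"
    using assms unfolding admissible_def by blast
  have N2: "supp {d. wt d \<le> - 2} N" using rW unfolding relative_weight_filtration_N .
  have lim_psi: "subspace_tendsto (\<lambda>s. psi s p) (Finf p) (at 0)" for p
  proof -
    obtain B :: "complex \<Rightarrow> complex^'n^'n" and B0 J where B: "(B \<longlongrightarrow> B0) (at 0)" "invertible B0"
      "Finf p = (*v) B0 ` coord_subspace J" "\<forall>\<^sub>F s in at 0. untwisted_period P F z0 s p = (*v) (B s) ` coord_subspace J"
      using lim[of p] unfolding subspace_tendsto_def by blast
    have "\<forall>\<^sub>F s in at 0. psi s p = (*v) (B s) ` coord_subspace J"
      using B(4) eventually_D by eventually_elim (simp add: untwisted_period_psi)
    then show ?thesis unfolding subspace_tendsto_def using B(1-3) by blast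
  qed
  have dF: "decreasing_filtration Finf" using Finf by (simp add: compact_dual_def)
  have dims: "vec.dim (gr_ind Finf HW k p) = vec.dim (gr_ind HF HW k p)" for k p
  proof -
    have "vec.dim (gr_ind Finf HW k p) - vec.dim (HW (k - 1)) = vec.dim (gr_ind HF HW k p) - vec.dim (HW (k - 1))"
      unfolding dim_gr0 using Finf by (simp add: compact_dual_def W0_eq)
    moreover have "vec.dim (HW (k - 1)) \<le> vec.dim (gr_ind H HW k p)" if H: "decreasing_filtration H" for H
    proof (rule vec.dim_subset)
      show "HW (k - 1) \<subseteq> gr_ind H HW k p"
      proof
        fix v assume "v \<in> HW (k - 1)"
        moreover have "0 \<in> H p \<inter> HW k"
          using H vec.subspace_0 subspace_sec by (auto simp: decreasing_filtration_def HW_def)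
        ultimately have "0 + v \<in> gr_ind H HW k p" unfolding gr_ind_def by (intro set_plus_intro)
        then show "v \<in> gr_ind H HW k p" by simp
      qed
    qed
    note this[OF dF]
    moreover have "vec.dim (HW (k - 1)) \<le> vec.dim (gr_ind HF HW k p)"
      unfolding gr_HF HW_def by (intro vec.dim_subset sec_mono) auto
    ultimately show ?thesis by linarith
  qed
  have ev_gr: "\<forall>\<^sub>F s in at 0. same_gr (psi s)" using eventually_D by eventually_elim (rule psi_same_gr)
  have sgF: "same_gr Finf" by (rule limit_same_gr[OF dF dims lim_psi ev_gr])
  define f where "f = chart Finf"
  have fU: "UT NegT f" unfolding f_def by (rule UT_Neg_chart[OF sgF])
  have if': "invertible f" by (rule UT_inv(1)[OF add_closed_types(1) fU])
  have "UT NegT (matrix_inv f ** cnjm f)"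
    using UT_inv(2)[OF add_closed_types(1) fU] UT_cnj[OF fU] unfolding swap_NegT by (intro UT_mult add_closed_types)
  from deligne_splitting[OF if' this] obtain h0 where h0: "UT StabT h0"
    and h0l: "UT LamT (matrix_inv (f ** h0) ** cnjm (f ** h0))" by blast
  define g where "g = f ** h0"
  define l0 where "l0 = matrix_inv g ** cnjm g"
  have l0: "UT LamT l0" using h0l by (simp add: l0_def g_def)
  have "UT NegT h0" using h0 by (rule UT_StabT_NegT)
  then have gU: "UT NegT g" unfolding g_def using fU by (intro UT_mult add_closed_types)
  have ig: "invertible g" by (rule UT_inv(1)[OF add_closed_types(1) gU])
  have icg: "invertible (cnjm g)" by (rule invertible_cnjm[OF ig])
  have Fg: "Finf p = (*v) g ` HF p" for p
    using chart_image[OF sgF] by (simp add: g_def f_def image_mat_mult image_HF[OF h0])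
  \<comment> \<open>The chart is centred at the limit, so that its coordinate \<open>u\<close> tends to the identity matrix and
    differs from it by a multiple of \<open>s\<close>.\<close>
  define E where "E s p = (*v) (matrix_inv g) ` psi s p" for s p
  have igi: "invertible (matrix_inv g)" by (rule invertible_mat_inv[OF ig])
  have giU: "UT NegT (matrix_inv g)" by (rule UT_inv(2)[OF add_closed_types(1) gU])
  have sgE: "same_gr (E s)" if "s \<in> D" for s
    unfolding E_def[abs_def] by (rule same_gr_image[OF psi_same_gr[OF that] giU])
  have "hol_filtration E D" unfolding E_def[abs_def] by (rule hol_filtration_image[OF psi_hol igi])
  define u where "u s = chart (E s)" for s
  have uh: "hol_mat u D" unfolding u_def[abs_def] by (rule chart_hol[OF \<open>hol_filtration E D\<close> sgE])
  have uU: "UT NegT (u s)" if "s \<in> D" for s unfolding u_def by (rule UT_Neg_chart[OF sgE[OF that]])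
  have limE: "subspace_tendsto (\<lambda>s. E s p) (HF p) (at 0)" for p
    using subspace_tendsto_image[OF lim_psi[of p] igi] unfolding E_def Fg image_inv_image(1)[OF ig] .
  have evE: "\<forall>\<^sub>F s in at 0. same_gr (E s)" using eventually_D by eventually_elim (rule sgE)
  have u1: "(u \<longlongrightarrow> mat 1) (at 0)"
    using chart_tendsto[OF limE evE same_gr_HF] unfolding u_def[abs_def] chart_HF .
  have psiu: "psi s p = (*v) (g ** u s) ` HF p" if s: "s \<in> D" for s p
  proof -
    have "(*v) (g ** u s) ` HF p = (*v) g ` E s p" by (simp add: image_mat_mult u_def chart_image[OF sgE[OF s]])
    then show ?thesis unfolding E_def image_inv_image(2)[OF ig] by simp
  qed
  \<comment> \<open>\<open>N\<close> is a morphism of type \<open>(-1,-1)\<close> of the limiting mixed Hodge structure. So \<open>g\<close> remains a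
    Deligne splitting after the twist by \<open>mexp (- 2 \<i> y N)\<close>, for each \<open>y\<close>.\<close>
  define \<nu> where "\<nu> = matrix_inv g ** N ** g"
  have nL: "supp LamT \<nu>"
  proof (rule horizontal_supp_LamT[OF _ _ l0])
    show "supp {d. wt d \<le> - 2} \<nu>"
    proof (rule supp_HW)
      fix k v assume "v \<in> HW k"
      then have "g *v v \<in> HW k" using image_HW[OF gU, of k] by blast
      then have "N *v (g *v v) \<in> HW (k - 2)" by (rule HW_supp[OF N2])
      then have "matrix_inv g *v (N *v (g *v v)) \<in> HW (k - 2)" using image_HW[OF giU, of "k - 2"] by blast
      then show "\<nu> *v v \<in> HW (k - 2)" by (simp add: \<nu>_def matrix_vector_mul_assoc matrix_mul_assoc)
    qed
    show "\<nu> *v v \<in> HF (p - 1)" if "v \<in> HF p" for p v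
      unfolding \<nu>_def by (rule limit_horizontal[OF gU uh u1 uU psiu that])
    have "l0 ** cnjm \<nu> = matrix_inv g ** (cnjm g ** matrix_inv (cnjm g)) ** N ** cnjm g"
      by (simp only: l0_def \<nu>_def cnjm_mult cnjm_inv[OF ig] real_N matrix_mul_assoc)
    also have "\<dots> = matrix_inv g ** N ** (g ** matrix_inv g) ** cnjm g"
      by (simp add: mat_inv_right[OF ig] mat_inv_right[OF icg])
    also have "\<dots> = \<nu> ** l0" by (simp only: \<nu>_def l0_def matrix_mul_assoc)
    finally show "l0 ** cnjm \<nu> = \<nu> ** l0" .
  qed
  have nil: "nilpotent \<nu>" by (rule supp_nilpotent[OF nL]) (auto simp: LamT_def NegT_def wt_def)
  have "\<exists>h. UT StabT h \<and> UT LamT (lam s ((g ** u s) ** h)) \<and>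
      Yc s = ((g ** u s) ** h) ** YR ** matrix_inv ((g ** u s) ** h)" if s: "s \<in> D" for s
    by (rule splitting_at[OF s UT_mult[OF add_closed_types(1) gU uU[OF s]] psiu[OF s]])
  then have "\<forall>s\<in>D. \<exists>h. UT StabT h \<and> UT LamT (lam s ((g ** u s) ** h)) \<and>
      Yc s = ((g ** u s) ** h) ** YR ** matrix_inv ((g ** u s) ** h)" by blast
  from bchoice[OF this] obtain h where h: "\<forall>s\<in>D. UT StabT (h s) \<and> UT LamT (lam s ((g ** u s) ** h s)) \<and>
      Yc s = ((g ** u s) ** h s) ** YR ** matrix_inv ((g ** u s) ** h s)" by (rule exE)
  have hS: "UT StabT (h s)" if "s \<in> D" for s using bspec[OF h that] by (rule conjunct1)
  have hL: "UT LamT (lam s ((g ** u s) ** h s))" if "s \<in> D" for s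
    using bspec[OF h that] by (rule conjunct1[OF conjunct2])
  have hY: "Yc s = ((g ** u s) ** h s) ** YR ** matrix_inv ((g ** u s) ** h s)" if "s \<in> D" for s
    using bspec[OF h that] by (rule conjunct2[OF conjunct2])
  let ?y = "\<lambda>s::complex. - ln (norm s) / (2 * pi)"
  define l where "l s = mexp (mat ((- 2 * \<i>) * of_real (?y s)) ** \<nu>) ** l0" for s
  have "(h \<longlongrightarrow> mat 1) (at 0)"
  proof (rule splitting_converges[where y = ?y and u = u and l = l and lam = "\<lambda>s. lam s ((g ** u s) ** h s)"])
    show "rapid ?y (at 0) (\<lambda>s. u s - mat 1)"
      using uh u1 by (intro hol_mat_rapid) (simp_all add: punctured_disk_def)
    show "\<forall>\<^sub>F s in at 0. UT NegT (u s)" using eventually_D by eventually_elim (rule uU)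
    show "\<forall>\<^sub>F s in at 0. UT StabT (h s)" using eventually_D by eventually_elim (rule hS)
    show "\<forall>\<^sub>F s in at 0. UT LamT (lam s ((g ** u s) ** h s))" using eventually_D by eventually_elim (rule hL)
    have "polyn ?y (\<lambda>s. mat 1 ** mexp (mat ((- 2 * \<i>) * of_real (?y s)) ** \<nu>) ** l0)"
      by (intro polyn_mult polyn_mexp nil)
    then show "polyn ?y l" unfolding l_def by simp
    show "UT LamT (l s)" for s
      unfolding l_def using mexp_UT[OF nL add_closed_types(3)] l0 by (intro UT_mult add_closed_types)
    show "\<forall>\<^sub>F s in at 0. h s ** lam s ((g ** u s) ** h s) = matrix_inv (u s) ** l s ** cnjm (u s) ** cnjm (h s)"
      using eventually_D
    proof eventually_elim
      case (elim s)
      have iu: "invertible (u s)" by (rule UT_inv(1)[OF add_closed_types(1) uU[OF elim]])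
      have ih: "invertible (h s)" by (rule UT_inv(1)[OF add_closed_types(2) hS[OF elim]])
      have igu: "invertible (g ** u s)" using ig iu by (rule invertible_mult)
      let ?e = "mexp (mat ((- 2 * \<i>) * of_real (?y s)) ** N)"
      have "h s ** lam s ((g ** u s) ** h s) =
          (h s ** matrix_inv (h s)) ** matrix_inv (u s) ** matrix_inv g ** ?e ** cnjm g ** cnjm (u s) ** cnjm (h s)"
        unfolding lam_def mat_inv_mult[OF igu ih] mat_inv_mult[OF ig iu] cnjm_mult by (simp only: matrix_mul_assoc)
      also have "\<dots> = matrix_inv (u s) ** (matrix_inv g ** ?e ** (g ** matrix_inv g) ** cnjm g) ** cnjm (u s) ** cnjm (h s)"
        by (simp add: mat_inv_right[OF ih] mat_inv_right[OF ig] matrix_mul_assoc)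
      also have "matrix_inv g ** ?e ** (g ** matrix_inv g) ** cnjm g = (matrix_inv g ** ?e ** g) ** l0"
        by (simp only: l0_def matrix_mul_assoc)
      also have "matrix_inv g ** ?e ** g = mexp (mat ((- 2 * \<i>) * of_real (?y s)) ** \<nu>)"
        unfolding \<nu>_def by (rule mexp_conj[OF ig nilpotent_N, symmetric])
      finally show ?case unfolding l_def .
    qed
  qed
  then have "((\<lambda>s. (g ** u s) ** h s) \<longlongrightarrow> (g ** mat 1) ** mat 1) (at 0)"
    by (intro tendsto_mat_mult tendsto_const u1)
  then have gl: "((\<lambda>s. (g ** u s) ** h s) \<longlongrightarrow> g) (at 0)" by simp
  have "((\<lambda>s. ((g ** u s) ** h s) ** YR ** matrix_inv ((g ** u s) ** h s)) \<longlongrightarrow> g ** YR ** matrix_inv g) (at 0)"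
    by (intro tendsto_mat_mult tendsto_const gl tendsto_mat_inv(2)[OF gl ig])
  moreover have "\<forall>\<^sub>F s in at 0. ((g ** u s) ** h s) ** YR ** matrix_inv ((g ** u s) ** h s) = Yc s"
    using eventually_D by eventually_elim (rule hY[symmetric])
  ultimately have "(Yc \<longlongrightarrow> g ** YR ** matrix_inv g) (at 0)" by (rule Lim_transform_eventually)
  moreover have "grading_of (g ** YR ** matrix_inv g) (W (cover z0))"
    unfolding W0_eq by (rule grading_of_conj[OF gU])
  ultimately show ?thesis unfolding grading_extends_def Yc_def[abs_def] by blast
qed

end

theorem theoremI:
  fixes P :: "(real \<Rightarrow> complex) \<Rightarrow> complex ^ 'n ^ 'n"
    and W F :: "complex \<Rightarrow> int \<Rightarrow> (complex ^ 'n) set"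
    and Q :: "complex \<Rightarrow> int \<Rightarrow> complex ^ 'n \<Rightarrow> complex ^ 'n \<Rightarrow> complex"
    and z0 :: complex
  assumes "gp_vmhs punctured_disk P W F Q"
    and "constant_graded punctured_disk P W F"
    and "0 < Im z0"
  shows "admissible P W F Q z0 \<longleftrightarrow> grading_extends P W F z0"
proof -
  have v: "variation P W F Q z0"
    by unfold_locales (use assms in \<open>simp_all add: uhp_def\<close>)
  then interpret variation P W F Q z0 .
  interpret m: mhs "F (cover z0)" "W (cover z0)"
    by unfold_locales (rule mhs_at[OF cover_punctured_disk[OF z0]])
  obtain R where R: "bigraded_frame m.hpr R" "\<And>k. W (cover z0) k = bigraded_frame.HW m.hpr k"
    "\<And>k p. gr_ind (F (cover z0)) (W (cover z0)) k p = gr_ind (bigraded_frame.HF m.hpr) (bigraded_frame.HW m.hpr) k p"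
    using m.frame_exists by blast
  interpret framed_variation P W F Q z0 m.hpr R
    by (rule framed_variation.intro[OF v R(1)], unfold_locales) (rule R(2), rule R(3))
  show ?thesis using extends_imp_admissible admissible_imp_extends by blast
qed

end
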